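(* Let $W$ be an irreducible CFC-finite Coxeter group. Suppose that $w\in\mathrm{CFC}(W)$ has full support, and that some generator in $S$ appears in $w$ (i.e. in a reduced expression for $w$) more than once. Then one of the following situations occurs. (i) $W=I_2(m)$ and $w=stst\cdots st$ (where $s,t$ are the two distinct generators, in some order) has even length and satisfies $0\leq \ell(w)<m$; or (ii) $W=H_n$ for some $n>2$, and $w$ has a large band.
   Context: $(W,S)$ is a Coxeter system of finite rank: $W=\langle S\mid (st)^{m(s,t)}=1\rangle$, where $m(s,t)=m(t,s)\in\{1,2,\dots,\infty\}$, $m(s,t)=1$ iff $s=t$, and $m(s,t)=\infty$ means no relation. The Coxeter graph has vertex set $S$ and an edge $\{s,t\}$ labeled $m(s,t)$ whenever $m(s,t)\ge 3$; $W$ is irreducible if this graph is connected. An expression for $w$ is a word in $S$ representing $w$; it is reduced if it has minimal length $\ell(w)$. The support $\mathrm{supp}(w)$ is the set of generators occurring in any reduced expression of $w$; $w$ has full support if $\mathrm{supp}(w)=S$. "Subword" means consecutive subword. $\langle s,t\rangle_m=stst\cdots$ ($m$ letters, starting with $s$). $I_2(m)$ is the dihedral Coxeter group with $S=\{s,t\}$, $m(s,t)=m$. $H_n$ has Coxeter graph a path on $n$ vertices whose first edge is labeled $5$ and all other edges $3$. Two words are commutation equivalent if they differ by a sequence of moves $st\leftrightarrow ts$ with $m(s,t)=2$. An element is fully commutative (FC) if all its reduced expressions are commutation equivalent. A cyclic shift of a word is any word obtained by repeatedly moving the first letter to the end. $w$ is cyclically fully commutative, $w\in\mathrm{CFC}(W)$,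 if every cyclic shift of every reduced expression for $w$ is a reduced expression for an FC element. $W$ is CFC-finite if $\mathrm{CFC}(W)$ is finite. (For FC elements the number of occurrences of each generator is the same in all reduced expressions.) An endpoint of a Coxeter graph is a vertex $s$ of degree $1$; its weight is $m(s,t)$ for the unique $t$ adjacent to it, and it is odd if this weight is a (finite) odd number. Bands: let $w\in\mathrm{CFC}(W)$ and let $(W',S')$ be the Coxeter system generated by $S'=\mathrm{supp}(w)$. For distinct $s,t\in S'$, exactly one of which is an odd endpoint of $(W',S')$, $w$ has an $st$-band if for some reduced expression $\mathsf{w}$ of $w$: (1) some cyclic shift of $\mathsf{w}$ is commutation equivalent to a reduced expression containing $\langle s,t\rangle_{m(s,t)-1}$ as a subword; and (2) neither $s$ nor $t$ appears elsewhere in $\mathsf{w}$. An $st$-band is small if $m(s,t)=3$ and large otherwise; $w$ has a large band if it has a large $st$-band for some ordered pair $(s,t)$. *)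

theory Defs
  imports "HOL-Algebra.Group" "HOL-Library.Extended_Nat"
begin

section \<open>Coxeter systems\<close>

definition coxeter_matrix :: "'a set \<Rightarrow> ('a \<Rightarrow> 'a \<Rightarrow> enat) \<Rightarrow> bool" where
  "coxeter_matrix S m \<longleftrightarrow>
     (\<forall>s\<in>S. \<forall>t\<in>S. m s t = m t s \<and> m s t \<ge> 1 \<and> (m s t = 1 \<longleftrightarrow> s = t))"

text \<open>
  The congruence on words generated by the relations \<open>(st)\<^sup>k = 1\<close> with \<open>k = m(s,t)\<close> finite.
  Because \<open>m(s,s) = 1\<close> gives \<open>ss = 1\<close>, no formal inverses of letters are needed and this
  monoid presentation is the group presentation.
\<close>
inductive coxeter_cong :: "'a set \<Rightarrow> ('a \<Rightarrow> 'a \<Rightarrow> enat) \<Rightarrow> 'a list \<Rightarrow> 'a list \<Rightarrow> bool"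
  for S :: "'a set" and m :: "'a \<Rightarrow> 'a \<Rightarrow> enat" where
  relation: "u \<in> lists S \<Longrightarrow> v \<in> lists S \<Longrightarrow> s \<in> S \<Longrightarrow> t \<in> S \<Longrightarrow> m s t = enat k \<Longrightarrow>
    coxeter_cong S m (u @ concat (replicate k [s, t]) @ v) (u @ v)"
| refl: "u \<in> lists S \<Longrightarrow> coxeter_cong S m u u"
| sym: "coxeter_cong S m u v \<Longrightarrow> coxeter_cong S m v u"
| trans: "coxeter_cong S m u v \<Longrightarrow> coxeter_cong S m v x \<Longrightarrow> coxeter_cong S m u x"

definition word_prod :: "('a, 'b) monoid_scheme \<Rightarrow> 'a list \<Rightarrow> 'a" where
  "word_prod W r = foldr (\<otimes>\<^bsub>W\<^esub>) r \<one>\<^bsub>W\<^esub>"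

text \<open>\<open>(W,S)\<close> is a Coxeter system of finite rank: \<open>W\<close> is generated by \<open>S\<close>, and two words
  in \<open>S\<close> have the same product exactly when the defining relations say so.\<close>
definition coxeter_system ::
  "('a, 'b) monoid_scheme \<Rightarrow> 'a set \<Rightarrow> ('a \<Rightarrow> 'a \<Rightarrow> enat) \<Rightarrow> bool" where
  "coxeter_system W S m \<longleftrightarrow>
     group W \<and> finite S \<and> S \<subseteq> carrier W \<and> coxeter_matrix S m \<and>
     carrier W = word_prod W ` lists S \<and>
     (\<forall>u\<in>lists S. \<forall>v\<in>lists S. word_prod W u = word_prod W v \<longleftrightarrow> coxeter_cong S m u v)"

section \<open>The Coxeter graph\<close>

definition coxeter_edges :: "'a set \<Rightarrow> ('a \<Rightarrow> 'a \<Rightarrow> enat) \<Rightarrow> ('a \<times> 'a) set" where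
  "coxeter_edges S m = {(s, t). s \<in> S \<and> t \<in> S \<and> s \<noteq> t \<and> m s t \<ge> 3}"

definition coxeter_irreducible :: "'a set \<Rightarrow> ('a \<Rightarrow> 'a \<Rightarrow> enat) \<Rightarrow> bool" where
  "coxeter_irreducible S m \<longleftrightarrow> (\<forall>s\<in>S. \<forall>t\<in>S. (s, t) \<in> (coxeter_edges S m)\<^sup>*)"

definition odd_endpoint :: "'a set \<Rightarrow> ('a \<Rightarrow> 'a \<Rightarrow> enat) \<Rightarrow> 'a \<Rightarrow> bool" where
  "odd_endpoint S m s \<longleftrightarrow>
     s \<in> S \<and> (\<exists>t k. {u. (s, u) \<in> coxeter_edges S m} = {t} \<and> m s t = enat k \<and> odd k)"

definition is_I2 :: "nat \<Rightarrow> 'a set \<Rightarrow> ('a \<Rightarrow> 'a \<Rightarrow> enat) \<Rightarrow> 'a \<Rightarrow> 'a \<Rightarrow> bool" where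
  "is_I2 k S m s t \<longleftrightarrow> S = {s, t} \<and> s \<noteq> t \<and> m s t = enat k"

definition is_H :: "nat \<Rightarrow> 'a set \<Rightarrow> ('a \<Rightarrow> 'a \<Rightarrow> enat) \<Rightarrow> bool" where
  "is_H n S m \<longleftrightarrow> (\<exists>p. bij_betw p {1..n} S \<and>
     (\<forall>i\<in>{1..n}. \<forall>j\<in>{1..n}. i < j \<longrightarrow>
        m (p i) (p j) = (if j = i + 1 then (if i = 1 then 5 else 3) else 2)))"

section \<open>Words and reduced expressions\<close>

definition coxeter_length :: "('a, 'b) monoid_scheme \<Rightarrow> 'a set \<Rightarrow> 'a \<Rightarrow> nat" where
  "coxeter_length W S w = (LEAST n. \<exists>r\<in>lists S. word_prod W r = w \<and> length r = n)"

definition reduced_expression ::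
  "('a, 'b) monoid_scheme \<Rightarrow> 'a set \<Rightarrow> 'a list \<Rightarrow> 'a \<Rightarrow> bool" where
  "reduced_expression W S r w \<longleftrightarrow>
     r \<in> lists S \<and> word_prod W r = w \<and> length r = coxeter_length W S w"

definition supp :: "('a, 'b) monoid_scheme \<Rightarrow> 'a set \<Rightarrow> 'a \<Rightarrow> 'a set" where
  "supp W S w = \<Union> {set r | r. reduced_expression W S r w}"

text \<open>\<open>alt_word s t n\<close> is the alternating word \<open>stst\<dots>\<close> with \<open>n\<close> letters.\<close>
fun alt_word :: "'a \<Rightarrow> 'a \<Rightarrow> nat \<Rightarrow> 'a list" where
  "alt_word s t 0 = []"
| "alt_word s t (Suc n) = s # alt_word t s n"

inductive commutation_move :: "('a \<Rightarrow> 'a \<Rightarrow> enat) \<Rightarrow> 'a list \<Rightarrow> 'a list \<Rightarrow> bool"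
  for m :: "'a \<Rightarrow> 'a \<Rightarrow> enat" where
  "m s t = 2 \<Longrightarrow> commutation_move m (u @ [s, t] @ v) (u @ [t, s] @ v)"

definition commutation_equiv :: "('a \<Rightarrow> 'a \<Rightarrow> enat) \<Rightarrow> 'a list \<Rightarrow> 'a list \<Rightarrow> bool" where
  "commutation_equiv m = (commutation_move m)\<^sup>*\<^sup>*"

section \<open>Fully commutative and cyclically fully commutative elements\<close>

definition FC ::
  "('a, 'b) monoid_scheme \<Rightarrow> 'a set \<Rightarrow> ('a \<Rightarrow> 'a \<Rightarrow> enat) \<Rightarrow> 'a set" where
  "FC W S m = {w \<in> carrier W. \<forall>r r'. reduced_expression W S r w \<longrightarrow>
     reduced_expression W S r' w \<longrightarrow> commutation_equiv m r r'}"

definition CFC ::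
  "('a, 'b) monoid_scheme \<Rightarrow> 'a set \<Rightarrow> ('a \<Rightarrow> 'a \<Rightarrow> enat) \<Rightarrow> 'a set" where
  "CFC W S m = {w \<in> carrier W. \<forall>r j. reduced_expression W S r w \<longrightarrow>
     (\<exists>v \<in> FC W S m. reduced_expression W S (rotate j r) v)}"

definition CFC_finite ::
  "('a, 'b) monoid_scheme \<Rightarrow> 'a set \<Rightarrow> ('a \<Rightarrow> 'a \<Rightarrow> enat) \<Rightarrow> bool" where
  "CFC_finite W S m \<longleftrightarrow> finite (CFC W S m)"

section \<open>Bands\<close>

text \<open>
  The standard parabolic subgroup generated by \<open>supp(w)\<close> has as its Coxeter matrix the
  restriction of \<open>m\<close>, so its odd endpoints are those of the induced subgraph.
  Cyclic shifts and commutation moves only permute the letter occurrences of \<open>r\<close>; hence the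
  occurrences of \<open>s\<close> and \<open>t\<close> elsewhere in \<open>r\<close> are those in \<open>x\<close> and \<open>y\<close>.
  If \<open>m(s,t) = 2\<close> no band exists: \<open>t\<close> is in the support but not in the one-letter factor \<open>s\<close>.
\<close>
definition has_band ::
  "('a, 'b) monoid_scheme \<Rightarrow> 'a set \<Rightarrow> ('a \<Rightarrow> 'a \<Rightarrow> enat) \<Rightarrow> 'a \<Rightarrow> 'a \<Rightarrow> 'a \<Rightarrow> bool" where
  "has_band W S m w s t \<longleftrightarrow>
     s \<in> supp W S w \<and> t \<in> supp W S w \<and> s \<noteq> t \<and>
     (odd_endpoint (supp W S w) m s \<noteq> odd_endpoint (supp W S w) m t) \<and>
     (\<exists>r k. reduced_expression W S r w \<and> m s t = enat k \<and>
        (\<exists>j x y v. commutation_equiv m (rotate j r) (x @ alt_word s t (k - 1) @ y) \<and>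
           reduced_expression W S (x @ alt_word s t (k - 1) @ y) v \<and>
           s \<notin> set (x @ y) \<and> t \<notin> set (x @ y)))"

definition has_large_band ::
  "('a, 'b) monoid_scheme \<Rightarrow> 'a set \<Rightarrow> ('a \<Rightarrow> 'a \<Rightarrow> enat) \<Rightarrow> 'a \<Rightarrow> bool" where
  "has_large_band W S m w \<longleftrightarrow> (\<exists>s t. has_band W S m w s t \<and> m s t \<noteq> 3)"

end

theory Submission
  imports Defs Complex_Main
begin

text \<open>
  Let \<open>w\<close> have full support. If no power of \<open>w\<close> contained a long braid up to commutation, all
  powers would be cyclically fully commutative and pairwise distinct, contradicting CFC-finiteness.
  So some power contains a convex alternating chain in two letters \<open>a\<close>, \<open>b\<close> of length \<open>m a b\<close>.
  The chain does not fit into one period, hence contains an occurrence of one of its letters, say \<open>a\<close>,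
  together with its translate. Convexity then forces all neighbours of \<open>a\<close> in the graph to be \<open>b\<close>,
  and if \<open>|S| \<ge> 3\<close> the chain stops there, so \<open>m a b\<close> is odd and \<open>w\<close> has a band.
  Deleting the leaf of a small band preserves the situation, so by induction there is a large band.
  Starting at an odd leaf of weight at least 5 and walking along the graph, any deviation from \<open>H\<^sub>n\<close>
  (a weight above 5, a second weight above 3, a branching) produces a periodic word all of
  whose powers are braid-free.

  That a word without long braids or squares up to commutation is reduced and fully commutative is
  derived from the exchange condition and from the fact that \<open>st\<close> has order exactly \<open>m s t\<close>.
\<close>

section \<open>Words\<close>

text \<open>Powers and rotations of \<open>w\<close> both matter, and both only up to commutation,
  so the proof needs a criterion that can be read off a single representative.
  \<open>braid_free\<close> is therefore a condition on positions of a function on the natural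
  numbers: the same predicate serves a finite word, a window of a periodic word and the whole
  periodic word.

  The neighbours of \<open>a\<close> are confined because a whole period lies between an occurrence
  and its translate, and every generator occurs in it. A neighbour there falls into a gap between
  two successive \<open>a\<close>'s of the chain, where convexity admits only \<open>b\<close>. If
  the chain went on by one letter, the same would hold for \<open>b\<close>, and
  \<open>{a, b}\<close> would be a component of the graph.

  The walks used at the end turn round only at chosen places. Alternating triples arise only at
  these turns, and a turn at an edge whose label is not 3 creates no braid. The leaf provides one
  turn; a branching or a second label other than 3 makes it possible to close the walk. A first
  label above 5 needs a different word, in which alternating chains have at most five
  letters.\<close>

locale coxeter_mat =
  fixes S :: "'a set" and m :: "'a \<Rightarrow> 'a \<Rightarrow> enat"
  assumes matrix: "coxeter_matrix S m"
begin

lemma m_sym: "s \<in> S \<Longrightarrow> t \<in> S \<Longrightarrow> m s t = m t s"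
  using matrix by (auto simp: coxeter_matrix_def)

lemma m_eq_1_iff: "s \<in> S \<Longrightarrow> t \<in> S \<Longrightarrow> m s t = 1 \<longleftrightarrow> s = t"
  using matrix by (auto simp: coxeter_matrix_def)

lemma m_ge_1: "s \<in> S \<Longrightarrow> t \<in> S \<Longrightarrow> m s t \<ge> 1"
  using matrix by (auto simp: coxeter_matrix_def)

lemma m_self_ne_2: "s \<in> S \<Longrightarrow> m s s \<noteq> 2"
  using m_eq_1_iff[of s s] by auto

lemma m_ge_3_iff: "s \<in> S \<Longrightarrow> t \<in> S \<Longrightarrow> m s t \<ge> 3 \<longleftrightarrow> s \<noteq> t \<and> m s t \<noteq> 2"
proof -
  assume "s \<in> S" "t \<in> S"
  note * = m_ge_1[OF this] m_eq_1_iff[OF this]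
  show ?thesis
  proof (cases "m s t")
    case (enat n)
    with * show ?thesis
      by (auto simp: numeral_eq_enat one_enat_def)
  next
    case infinity
    with * show ?thesis by auto
  qed
qed

end

section \<open>Alternating words\<close>

lemma length_alt_word [simp]: "length (alt_word s t n) = n"
  by (induction n arbitrary: s t) auto

lemma nth_alt_word: "j < n \<Longrightarrow> alt_word s t n ! j = (if even j then s else t)"
  by (induction n arbitrary: s t j) (auto simp: nth_Cons split: nat.splits)

lemma alt_word_snoc: "alt_word s t (Suc n) = alt_word s t n @ [if even n then s else t]"
  by (induction n arbitrary: s t) auto

lemma set_alt_word: "set (alt_word s t n) \<subseteq> {s, t}"
  by (induction n arbitrary: s t) auto

lemma alt_word_in_lists: "s \<in> S \<Longrightarrow> t \<in> S \<Longrightarrow> alt_word s t n \<in> lists S"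
  by (induction n arbitrary: s t) auto

lemma alt_word_add:
  "alt_word s t (k + n) =
     alt_word s t k @ (if even k then alt_word s t n else alt_word t s n)"
  by (induction k arbitrary: s t) auto

lemma concat_replicate_eq_alt_word: "concat (replicate k [s, t]) = alt_word s t (2 * k)"
  by (induction k) auto

text \<open>For involutory generators the reversed word is the inverse, so this identity turns the
  braid relation into \<open>(st)^k = 1\<close>.\<close>

lemma alt_word_append_rev: "alt_word s t k @ rev (alt_word t s k) = alt_word s t (2 * k)"
proof (induction k arbitrary: s t)
  case (Suc k)
  then show ?case
    using alt_word_snoc[of t s "Suc (2 * k)"] alt_word_snoc[of t s "2*k"]
    by (simp flip: append_assoc)
qed auto

text \<open>These palindromes are the reflections attached to the letters of an alternating word, in
  the shape \<open>p @ c # rev p\<close> that the exchange condition delivers.\<close>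

lemma alt_word_palindrome:
  "alt_word s t i @ (if even i then s else t) # rev (alt_word s t i) = alt_word s t (2 * i + 1)"
proof (induction i arbitrary: s t)
  case (Suc i)
  have "alt_word s t (Suc i) @ (if even (Suc i) then s else t) # rev (alt_word s t (Suc i))
      = s # (alt_word t s i @ (if even i then t else s) # rev (alt_word t s i)) @ [s]"
    by simp
  also have "\<dots> = s # alt_word t s (2 * i + 1) @ [s]"
    unfolding Suc.IH[of t s] by simp
  also have "\<dots> = alt_word s t (2 * Suc i + 1)"
    using alt_word_snoc[of t s "2 * i + 1"] by simp
  finally show ?case .
qed auto

section \<open>The order of a product of two generators\<close>

text \<open>This is \<open>-2 B(s,u)\<close> for the canonical bilinear form, with
  \<open>B(s,u) = -cos (pi / m s u)\<close> off the diagonal and the limit value \<open>-1\<close>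
  for label \<infinity>.\<close>

definition cox_coeff :: "('a \<Rightarrow> 'a \<Rightarrow> enat) \<Rightarrow> 'a \<Rightarrow> 'a \<Rightarrow> real" where
  "cox_coeff m s u =
     (if s = u then - 2 else case m s u of enat k \<Rightarrow> 2 * cos (pi / real k) | \<infinity> \<Rightarrow> 2)"

text \<open>The contragredient of the geometric representation: a linear form is given by its values
  on the simple roots.\<close>
definition cox_refl :: "('a \<Rightarrow> 'a \<Rightarrow> enat) \<Rightarrow> 'a \<Rightarrow> ('a \<Rightarrow> real) \<Rightarrow> 'a \<Rightarrow> real" where
  "cox_refl m s f = (\<lambda>u. f u + cox_coeff m s u * f s)"

definition cox_act :: "('a \<Rightarrow> 'a \<Rightarrow> enat) \<Rightarrow> 'a list \<Rightarrow> ('a \<Rightarrow> real) \<Rightarrow> 'a \<Rightarrow> real" where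
  "cox_act m r = foldr (cox_refl m) r"

lemma cox_act_append: "cox_act m (u @ v) f = cox_act m u (cox_act m v f)"
  by (simp add: cox_act_def)

lemma cox_refl_involution: "cox_refl m s (cox_refl m s f) = f"
  by (auto simp: cox_refl_def cox_coeff_def fun_eq_iff)

lemma cox_act_pair_power:
  "cox_act m (concat (replicate i [s, t])) f = ((\<lambda>f. cox_refl m s (cox_refl m t f)) ^^ i) f"
  by (induction i) (auto simp: cox_act_def)

context
  fixes m :: "'a \<Rightarrow> 'a \<Rightarrow> enat" and s t :: 'a and f :: "'a \<Rightarrow> real"
  assumes ne: "s \<noteq> t" and sym: "m s t = m t s"
begin

definition orb :: "nat \<Rightarrow> 'a \<Rightarrow> real" where
  "orb i = ((\<lambda>f. cox_refl m s (cox_refl m t f)) ^^ i) f"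

lemma coeff_sym: "cox_coeff m t s = cox_coeff m s t"
  using sym by (simp add: cox_coeff_def)

lemma orb_Suc:
  "orb (Suc i) u = orb i u + cox_coeff m t u * orb i t
     + cox_coeff m s u * (orb i s + cox_coeff m s t * orb i t)"
  by (simp add: orb_def cox_refl_def coeff_sym)

lemma orb_Suc_s: "orb (Suc i) s = - (orb i s + cox_coeff m s t * orb i t)"
  unfolding orb_Suc using coeff_sym by (simp add: cox_coeff_def[of m s s] algebra_simps)

lemma orb_Suc_t:
  "orb (Suc i) t = - orb i t + cox_coeff m s t * (orb i s + cox_coeff m s t * orb i t)"
  unfolding orb_Suc by (simp add: cox_coeff_def[of m t t])

text \<open>With coefficient 2 the product \<open>st\<close> is unipotent on the coordinates
  \<open>s\<close> and \<open>t\<close>, so they drift linearly instead of rotating.\<close>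

lemma orb_infinite:
  assumes "m s t = \<infinity>" "f s = 1" "f t = 0"
  shows "orb i t = 2 * real i \<and> orb i s = 1 - 2 * real i"
proof (induction i)
  case 0
  show ?case using assms by (simp add: orb_def)
next
  case (Suc i)
  have "cox_coeff m s t = 2" using assms ne by (simp add: cox_coeff_def)
  with Suc show ?case
    unfolding orb_Suc_s orb_Suc_t by (simp add: algebra_simps)
qed

context
  fixes k :: nat and \<theta> :: real
  assumes fin: "m s t = enat k" and theta: "\<theta> = pi / real k" and k2: "k \<ge> 2"
begin

lemma coeff_eq: "cox_coeff m s t = 2 * cos \<theta>"
  using ne fin theta by (simp add: cox_coeff_def)

lemma sin_pos: "sin \<theta> > 0"
  unfolding theta using k2 by (intro sin_gt_zero) (auto simp: field_simps)

text \<open>On the coordinates \<open>s\<close> and \<open>t\<close> the product \<open>st\<close>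
  is conjugate to a rotation by \<open>2 * \<theta>\<close>, whence the sines. The factor
  \<open>sin \<theta>\<close> keeps the formulas free of division.\<close>

lemma orb_closed_form:
  "orb i t * sin \<theta> = f t * sin ((2 * real i + 1) * \<theta>) + f s * sin (2 * real i * \<theta>)"
  "orb i s * sin \<theta> = - f t * sin (2 * real i * \<theta>) - f s * sin ((2 * real i - 1) * \<theta>)"
proof -
  have rec: "sin (x + \<theta>) = 2 * cos \<theta> * sin x - sin (x - \<theta>)" for x
    by (simp add: sin_add sin_diff)
  have comb: "- (p * a1 + q * a0) + c * (p * a2 + q * a1) = p * (c * a2 - a1) + q * a2"
    if "a2 = c * a1 - a0" for p q c a0 a1 a2 :: real
    unfolding that by (simp add: algebra_simps)
  have "orb i t * sin \<theta> = f t * sin ((2 * real i + 1) * \<theta>) + f s * sin (2 * real i * \<theta>) \<and>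
    orb i s * sin \<theta> = - f t * sin (2 * real i * \<theta>) - f s * sin ((2 * real i - 1) * \<theta>)"
  proof (induction i)
    case 0
    show ?case by (simp add: orb_def)
  next
    case (Suc i)
    let ?A = "\<lambda>j. sin ((2 * real i + j) * \<theta>)"
    have A: "?A (j + 1) = 2 * cos \<theta> * ?A j - ?A (j - 1)" for j
      using rec[of "(2 * real i + j) * \<theta>"] by (simp add: algebra_simps)
    have A1: "?A 1 = 2 * cos \<theta> * ?A 0 - ?A (-1)" using A[of 0] by simp
    have A2: "?A 2 = 2 * cos \<theta> * ?A 1 - ?A 0" using A[of 1] by simp
    have A3: "?A 3 = 2 * cos \<theta> * ?A 2 - ?A 1" using A[of 2] by simp
    have T: "orb i t * sin \<theta> = f t * ?A 1 + f s * ?A 0"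
      and R: "orb i s * sin \<theta> = - f t * ?A 0 - f s * ?A (-1)"
      using Suc by simp_all
    have e: "(orb i s + 2 * cos \<theta> * orb i t) * sin \<theta> = f t * ?A 2 + f s * ?A 1"
    proof -
      have "(orb i s + 2 * cos \<theta> * orb i t) * sin \<theta>
          = orb i s * sin \<theta> + 2 * cos \<theta> * (orb i t * sin \<theta>)" by (simp add: algebra_simps)
      also have "\<dots> = f t * ?A 2 + f s * ?A 1" unfolding T R A2 A1 by (simp add: algebra_simps)
      finally show ?thesis .
    qed
    have "orb (Suc i) s * sin \<theta> = - f t * ?A 2 - f s * ?A 1"
      unfolding orb_Suc_s coeff_eq minus_mult_left[symmetric] e by simp
    moreover have "orb (Suc i) t * sin \<theta> = f t * ?A 3 + f s * ?A 2"
    proof -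
      have "orb (Suc i) t * sin \<theta>
          = - (orb i t * sin \<theta>) + 2 * cos \<theta> * ((orb i s + 2 * cos \<theta> * orb i t) * sin \<theta>)"
        unfolding orb_Suc_t coeff_eq by (simp add: algebra_simps)
      also have "\<dots> = f t * ?A 3 + f s * ?A 2"
        unfolding T e A3 by (rule comb[OF A2])
      finally show ?thesis .
    qed
    moreover have "2 * real (Suc i) + 1 = 2 * real i + 3" "2 * real (Suc i) = 2 * real i + 2"
      "2 * real (Suc i) - 1 = 2 * real i + 1"
      by simp_all
    ultimately show ?case by (simp only: simp_thms)
  qed
  then show "orb i t * sin \<theta> = f t * sin ((2 * real i + 1) * \<theta>) + f s * sin (2 * real i * \<theta>)"
    "orb i s * sin \<theta> = - f t * sin (2 * real i * \<theta>) - f s * sin ((2 * real i - 1) * \<theta>)"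
    by blast+
qed

lemma k_theta: "2 * real k * \<theta> = 2 * pi"
  using k2 theta by simp

lemma orb_period_st: "orb k t = f t" "orb k s = f s"
proof -
  have "(2 * real k + 1) * \<theta> = \<theta> + 2 * pi" "(2 * real k - 1) * \<theta> = - \<theta> + 2 * pi"
    using k_theta by (simp_all add: algebra_simps)
  then have "orb k t * sin \<theta> = f t * sin \<theta>" "orb k s * sin \<theta> = f s * sin \<theta>"
    unfolding orb_closed_form k_theta by (simp_all only: sin_periodic) simp_all
  then show "orb k t = f t" "orb k s = f s" using sin_pos by auto
qed

text \<open>Returning at \<open>s\<close> and \<open>t\<close> is not enough: the other coordinates
  change by multiples of the sums \<open>E\<close> and \<open>F\<close> over one period. These
  satisfy \<open>2 E = c F\<close> and \<open>2 F = c E\<close> with \<open>c * c < 4\<close>, hence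
  vanish, like the sum over an orbit of a nontrivial rotation.\<close>

lemma orb_period: "orb k = f"
proof
  fix u
  define c where "c = cox_coeff m s t"
  define x where "x i = orb i s + c * orb i t" for i
  define E where "E = (\<Sum>i<k. orb i t)"
  define F where "F = (\<Sum>i<k. x i)"
  have shift: "(\<Sum>i<k. g (Suc i)) = (\<Sum>i<k. g i)" if "g k = g 0" for g :: "nat \<Rightarrow> real"
    using that sum.lessThan_Suc_shift[of g k] by simp
  have "orb (Suc i) t + orb i t = c * x i" for i
    unfolding orb_Suc_t x_def c_def by simp
  then have "(\<Sum>i<k. orb (Suc i) t) + E = c * F"
    unfolding E_def F_def sum_distrib_left by (simp flip: sum.distrib)
  then have 1: "2 * E = c * F"
    using shift[of "\<lambda>i. orb i t"] orb_period_st by (simp add: E_def orb_def)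
  have x': "x (Suc i) + x i = c * orb (Suc i) t" for i
    unfolding x_def orb_Suc_s c_def by simp
  have "(\<Sum>i<k. x (Suc i)) + F = c * (\<Sum>i<k. orb (Suc i) t)"
    unfolding F_def sum_distrib_left by (simp add: x' flip: sum.distrib)
  moreover have "x k = x 0" using orb_period_st by (simp add: x_def orb_def)
  ultimately have 2: "2 * F = c * E"
    using shift[of "\<lambda>i. orb i t"] shift[of x] orb_period_st by (simp add: E_def F_def orb_def)
  have "4 * E = 2 * (c * F)" using 1 by simp
  also have "\<dots> = c * (2 * F)" by simp
  also have "\<dots> = c * c * E" unfolding 2 by simp
  finally have "4 * E = c * c * E" .
  moreover have "c * c < 4"
  proof -
    have "(cos \<theta>)\<^sup>2 < 1" using sin_cos_squared_add[of \<theta>] sin_pos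
      by (smt (verit) zero_less_power)
    then show ?thesis by (simp add: c_def coeff_eq power2_eq_square)
  qed
  ultimately have "E = 0" by auto
  with 2 have "F = 0" by simp
  have "orb j u = f u + cox_coeff m t u * (\<Sum>i<j. orb i t) + cox_coeff m s u * (\<Sum>i<j. x i)" for j
  proof (induction j)
    case (Suc j)
    then show ?case unfolding orb_Suc by (simp add: x_def c_def algebra_simps)
  qed (simp add: orb_def)
  from this[of k] \<open>E = 0\<close> \<open>F = 0\<close> show "orb k u = f u" by (simp add: E_def F_def)
qed

text \<open>The value at \<open>t\<close> vanishes again after a half turn, when
  \<open>2 * i = k\<close>; there the value at \<open>s\<close> has become \<open>-1\<close>, which
  separates the form from \<open>f\<close>.\<close>

lemma orb_aperiodic:
  assumes "f s = 1" "f t = 0" "0 < i" "i < k"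
  shows "orb i \<noteq> f"
proof
  assume eq: "orb i = f"
  then have "sin (2 * real i * \<theta>) = 0"
    using orb_closed_form(1)[of i] assms by simp
  then obtain n :: int where n: "2 * real i * \<theta> = of_int n * pi"
    using sin_zero_iff_int2 by blast
  then have n': "2 * real i = of_int n * real k"
    using k2 by (simp add: theta field_simps)
  have l: "0 * real k < of_int n * real k" "of_int n * real k < 2 * real k"
    unfolding n'[symmetric] using assms by simp_all
  have "0 < real_of_int n" "real_of_int n < 2"
    by (rule mult_right_less_imp_less[OF l(1)], simp)
      (rule mult_right_less_imp_less[OF l(2)], simp)
  then have "n = 1" by linarith
  then have "2 * real i * \<theta> = pi" using n by simp
  then have "(2 * real i - 1) * \<theta> = pi - \<theta>" by (simp add: algebra_simps)
  then have "orb i s * sin \<theta> = - sin \<theta>"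
    using orb_closed_form(2)[of i] assms by simp
  with sin_pos eq assms show False by simp
qed

end

end

section \<open>The action of the group and the order of \<open>st\<close>\<close>

context coxeter_mat
begin

lemma cox_act_cong: "coxeter_cong S m u v \<Longrightarrow> cox_act m u f = cox_act m v f"
proof (induction arbitrary: f rule: coxeter_cong.induct)
  case (relation u v s t k)
  have "cox_act m (concat (replicate k [s, t])) f = f" for f
  proof (cases "s = t")
    case True
    then have "((\<lambda>f. cox_refl m s (cox_refl m t f)) ^^ k) f = f"
      by (induction k) (auto simp: cox_refl_involution)
    then show ?thesis by (simp add: cox_act_pair_power)
  next
    case False
    have "k \<ge> 2"
      using relation m_ge_1[of s t] m_eq_1_iff[of s t] False
      by (auto simp: one_enat_def)
    from orb_period[OF False m_sym[OF relation(3,4)] relation(5) HOL.refl this]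
    show ?thesis
      by (simp add: cox_act_pair_power orb_def[OF False m_sym[OF relation(3,4)]])
  qed
  then show ?case by (simp add: cox_act_append)
qed auto

lemma pair_power_nontrivial:
  assumes "s \<in> S" "t \<in> S" "s \<noteq> t" "0 < i" "enat i < m s t"
  shows "\<not> coxeter_cong S m (concat (replicate i [s, t])) []"
proof
  assume "coxeter_cong S m (concat (replicate i [s, t])) []"
  note * = cox_act_cong[OF this]
  \<comment> \<open>The form dual to the simple root of \<open>s\<close>: it takes the values 1 at
    \<open>s\<close> and 0 at \<open>t\<close> for which both orbit computations are made.\<close>
  define f :: "'a \<Rightarrow> real" where "f = (\<lambda>u. if u = s then 1 else 0)"
  note sy = m_sym[OF assms(1,2)]
  have eq: "orb m s t f i = f"
    using *[of f] by (simp add: cox_act_pair_power orb_def[OF assms(3) sy]) (simp add: cox_act_def)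
  have f: "f s = 1" "f t = 0" using assms by (auto simp: f_def)
  show False
  proof (cases "m s t")
    case (enat k)
    have "k \<ge> 2" using assms enat by auto
    from orb_aperiodic[OF assms(3) sy enat HOL.refl this f \<open>0 < i\<close>] eq assms enat
    show False by simp
  next
    case infinity
    from orb_infinite[OF assms(3) sy this f, of i] eq f assms show False by simp
  qed
qed

end

section \<open>The exchange condition\<close>

declare in_listsI [rule del] in_listsD [rule del]

lemma rev_in_lists [simp]: "rev r \<in> lists S \<longleftrightarrow> r \<in> lists S"
  by (simp add: in_lists_conv_set)

text \<open>The parity of the number of \<open>j\<close> with \<open>s\<^sub>1 \<dots> s\<^sub>j \<dots> s\<^sub>1 = x\<close> in the word \<open>s\<^sub>1 \<dots> s\<^sub>n\<close>. Unlike the list of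
  these reflections, it depends only on the group element, which yields the exchange condition.\<close>
fun refl_parity :: "('a, 'b) monoid_scheme \<Rightarrow> 'a list \<Rightarrow> 'a \<Rightarrow> bool" where
  "refl_parity W [] x = False"
| "refl_parity W (s # r) x = ((x = s) \<noteq> refl_parity W r (s \<otimes>\<^bsub>W\<^esub> x \<otimes>\<^bsub>W\<^esub> s))"

locale coxeter =
  fixes W :: "('a, 'b) monoid_scheme" (structure) and S :: "'a set" and m :: "'a \<Rightarrow> 'a \<Rightarrow> enat"
  assumes system: "coxeter_system W S m"

sublocale coxeter \<subseteq> coxeter_mat S m
  using system by unfold_locales (simp add: coxeter_system_def)

sublocale coxeter \<subseteq> group W
  using system by (simp add: coxeter_system_def)

context coxeter
begin

abbreviation wp :: "'a list \<Rightarrow> 'a" where "wp \<equiv> word_prod W"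

lemma finite_S: "finite S"
  using system by (simp add: coxeter_system_def)

lemma S_carrier: "s \<in> S \<Longrightarrow> s \<in> carrier W"
  using system by (auto simp: coxeter_system_def)

lemma carrier_eq: "carrier W = wp ` lists S"
  using system by (simp add: coxeter_system_def)

lemma wp_eq_iff: "u \<in> lists S \<Longrightarrow> v \<in> lists S \<Longrightarrow> wp u = wp v \<longleftrightarrow> coxeter_cong S m u v"
  using system by (simp add: coxeter_system_def)

lemma wp_Nil [simp]: "wp [] = \<one>"
  by (simp add: word_prod_def)

lemma wp_Cons [simp]: "wp (s # r) = s \<otimes> wp r"
  by (simp add: word_prod_def)

lemma wp_closed [intro, simp]: "r \<in> lists S \<Longrightarrow> wp r \<in> carrier W"
  by (induction r) (auto simp: S_carrier)

lemma wp_append [simp]: "u \<in> lists S \<Longrightarrow> v \<in> lists S \<Longrightarrow> wp (u @ v) = wp u \<otimes> wp v"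
  by (induction u) (auto simp: S_carrier m_assoc)

lemma wp_pair_power:
  assumes "s \<in> S" "t \<in> S" "m s t = enat k"
  shows "wp (concat (replicate k [s, t])) = \<one>"
proof -
  have "concat (replicate k [s, t]) \<in> lists S"
    unfolding concat_replicate_eq_alt_word using assms by (rule_tac alt_word_in_lists)
  moreover have "coxeter_cong S m (concat (replicate k [s, t])) []"
    using coxeter_cong.relation[of "[]" S "[]" s t m k] assms by simp
  ultimately show ?thesis using wp_eq_iff[of "concat (replicate k [s, t])" "[]"] by simp
qed

lemma pair_power_ne_one:
  assumes "s \<in> S" "t \<in> S" "s \<noteq> t" "0 < i" "enat i < m s t"
  shows "wp (alt_word s t (2 * i)) \<noteq> \<one>"
  using pair_power_nontrivial[OF assms] wp_eq_iff[of "alt_word s t (2 * i)" "[]"] assms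
    alt_word_in_lists[of s S t]
  by (simp add: concat_replicate_eq_alt_word)

lemma gen_square: "s \<in> S \<Longrightarrow> s \<otimes> s = \<one>"
  using wp_pair_power[of s s 1] m_eq_1_iff[of s s] S_carrier[of s] by (simp add: one_enat_def)

lemma inv_gen: "s \<in> S \<Longrightarrow> inv s = s"
  using gen_square S_carrier by (intro inv_equality) auto

lemma gen_cancel: "s \<in> S \<Longrightarrow> x \<in> carrier W \<Longrightarrow> s \<otimes> (s \<otimes> x) = x"
  by (simp add: S_carrier gen_square flip: m_assoc)

lemma wp_rev_cancel: "r \<in> lists S \<Longrightarrow> wp r \<otimes> wp (rev r) = \<one>"
proof (induction r)
  case (Cons s r)
  from Cons.prems have "wp (s # r) \<otimes> wp (rev (s # r)) = s \<otimes> (wp r \<otimes> wp (rev r)) \<otimes> s"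
    by (simp add: S_carrier m_assoc)
  also have "\<dots> = \<one>" using Cons by (simp add: S_carrier gen_square)
  finally show ?case .
qed simp

lemma inv_wp: "r \<in> lists S \<Longrightarrow> inv (wp r) = wp (rev r)"
  using wp_rev_cancel[of "rev r"] by (intro inv_equality) auto

lemma wp_braid:
  assumes "s \<in> S" "t \<in> S" "m s t = enat k"
  shows "wp (alt_word s t k) = wp (alt_word t s k)"
proof -
  have l: "alt_word s t k \<in> lists S" "alt_word t s k \<in> lists S"
    using alt_word_in_lists[of s S t k] alt_word_in_lists[of t S s k] assms by blast+
  have "wp (alt_word s t k) \<otimes> inv (wp (alt_word t s k)) = wp (alt_word s t k @ rev (alt_word t s k))"
    using l by (simp add: inv_wp)
  also have "\<dots> = \<one>"
    using wp_pair_power[OF assms] unfolding alt_word_append_rev concat_replicate_eq_alt_word .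
  finally show ?thesis using inv_equality[of "wp (alt_word s t k)" "inv (wp (alt_word t s k))"] l
    by simp
qed

text \<open>Cocycle rule: the reflection that a letter of \<open>v\<close> contributes to
  \<open>u @ v\<close> is its reflection in \<open>v\<close> conjugated by \<open>wp u\<close>, so
  \<open>x\<close> has to be conjugated back.\<close>

lemma refl_parity_append:
  assumes "u \<in> lists S" "v \<in> lists S" "x \<in> carrier W"
  shows "refl_parity W (u @ v) x =
    (refl_parity W u x \<noteq> refl_parity W v (inv (wp u) \<otimes> x \<otimes> wp u))"
  using assms
proof (induction u arbitrary: x)
  case (Cons s u)
  have "inv (wp u) \<otimes> (s \<otimes> x \<otimes> s) \<otimes> wp u = inv (wp (s # u)) \<otimes> x \<otimes> wp (s # u)"
  proof -
    have c: "s \<in> carrier W" "wp u \<in> carrier W" "s \<in> S"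
      using Cons.hyps by (simp_all add: S_carrier)
    show ?thesis using c Cons.prems by (simp add: m_assoc inv_mult_group inv_gen)
  qed
  with Cons show ?case by (auto simp: S_carrier)
qed simp

lemma refl_parity_alt_word:
  assumes "s \<in> S" "t \<in> S" "x \<in> carrier W"
  shows "refl_parity W (alt_word s t n) x =
    odd (length (filter (\<lambda>i. x = wp (alt_word s t (2 * i + 1))) [0..<n]))"
  using assms
proof (induction n arbitrary: s t x)
  case (Suc n)
  have eq: "s \<otimes> x \<otimes> s = wp (alt_word t s (2 * i + 1)) \<longleftrightarrow> x = wp (alt_word s t (2 * Suc i + 1))" for i
  proof -
    have l: "alt_word t s (2 * i + 1) \<in> lists S" using alt_word_in_lists[OF Suc.prems(2,1)] .
    have "alt_word s t (2 * Suc i + 1) = s # alt_word t s (2 * i + 1) @ [s]"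
      using alt_word_snoc[of t s "2 * i + 1"] by simp
    then have "wp (alt_word s t (2 * Suc i + 1)) = s \<otimes> wp (alt_word t s (2 * i + 1)) \<otimes> s"
      using l Suc.prems by (simp add: S_carrier m_assoc del: alt_word.simps)
    moreover have "s \<otimes> (s \<otimes> x \<otimes> s) \<otimes> s = x"
      using Suc.prems by (simp add: S_carrier m_assoc gen_cancel gen_square)
    moreover have "s \<otimes> (s \<otimes> y \<otimes> s) \<otimes> s = y" if "y \<in> carrier W" for y
      using Suc.prems that by (simp add: S_carrier m_assoc gen_cancel gen_square)
    ultimately show ?thesis using l by (metis wp_closed)
  qed
  have "[0..<Suc n] = 0 # map Suc [0..<n]"
    by (simp add: map_Suc_upt upt_conv_Cons del: upt_Suc)
  moreover have "wp (alt_word s t (2 * 0 + 1)) = s" using Suc.prems by (simp add: S_carrier)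
  ultimately have "length (filter (\<lambda>i. x = wp (alt_word s t (2 * i + 1))) [0..<Suc n]) =
    (if x = s then 1 else 0) + length (filter (\<lambda>i. x = wp (alt_word s t (2 * Suc i + 1))) [0..<n])"
    by (simp add: filter_map o_def del: upt_Suc)
  moreover have "refl_parity W (alt_word t s n) (s \<otimes> x \<otimes> s) =
    odd (length (filter (\<lambda>i. x = wp (alt_word s t (2 * Suc i + 1))) [0..<n]))"
    unfolding eq[symmetric] using Suc by (simp add: S_carrier)
  ultimately show ?case by simp
qed simp

text \<open>The \<open>2 * k\<close> reflections of this word repeat with period \<open>k\<close>
  because \<open>(st)^k = 1\<close>, so each is counted an even number of times.\<close>

lemma refl_parity_pair_power:
  assumes "s \<in> S" "t \<in> S" "x \<in> carrier W" "m s t = enat k"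
  shows "\<not> refl_parity W (concat (replicate k [s, t])) x"
proof -
  let ?Q = "\<lambda>i. x = wp (alt_word s t (2 * i + 1))"
  have "?Q (i + k) \<longleftrightarrow> ?Q i" for i
  proof -
    have "alt_word s t (2 * (i + k) + 1) = alt_word s t (2 * k) @ alt_word s t (2 * i + 1)"
      using alt_word_add[of s t "2 * k" "2 * i + 1"] by (simp add: algebra_simps)
    then show ?thesis
      using assms wp_pair_power[OF assms(1,2,4)] alt_word_in_lists[OF assms(1,2)]
      by (simp add: concat_replicate_eq_alt_word del: alt_word.simps)
  qed
  moreover have "[0..<2 * k] = [0..<k] @ map (\<lambda>i. i + k) [0..<k]"
    using upt_add_eq_append[of 0 k k] by (simp add: map_add_upt mult_2)
  ultimately have "length (filter ?Q [0..<2 * k]) = 2 * length (filter ?Q [0..<k])"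
    by (simp add: filter_map o_def)
  then show ?thesis
    unfolding concat_replicate_eq_alt_word refl_parity_alt_word[OF assms(1-3)] by simp
qed

lemma refl_parity_cong:
  "coxeter_cong S m u v \<Longrightarrow> x \<in> carrier W \<Longrightarrow> refl_parity W u x = refl_parity W v x"
proof (induction arbitrary: x rule: coxeter_cong.induct)
  case (relation u v s t k)
  let ?p = "concat (replicate k [s, t])"
  have p: "?p \<in> lists S"
    unfolding concat_replicate_eq_alt_word using relation by (rule_tac alt_word_in_lists)
  have "inv (wp u) \<otimes> x \<otimes> wp u \<in> carrier W" using relation by simp
  then show ?case
    using relation p refl_parity_pair_power[of s t _ k] wp_pair_power[of s t k]
    by (simp add: refl_parity_append)
qed auto

lemma refl_parity_eq:
  "u \<in> lists S \<Longrightarrow> v \<in> lists S \<Longrightarrow> wp u = wp v \<Longrightarrow> x \<in> carrier W \<Longrightarrow>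
    refl_parity W u x = refl_parity W v x"
  using refl_parity_cong wp_eq_iff by blast

lemma refl_parity_occurs:
  assumes "r \<in> lists S" "x \<in> carrier W" "refl_parity W r x"
  obtains p c q where "r = p @ c # q" "x = wp (p @ c # rev p)"
  using assms
proof (induction r arbitrary: x thesis)
  case (Cons s r)
  show ?case
  proof (cases "x = s")
    case True
    with Cons.prems show ?thesis by (intro Cons.prems(1)[of "[]" s r]) (auto simp: S_carrier)
  next
    case False
    with Cons.prems have "refl_parity W r (s \<otimes> x \<otimes> s)" by simp
    with Cons obtain p c q where *: "r = p @ c # q" "s \<otimes> x \<otimes> s = wp (p @ c # rev p)"
      by (metis Cons_in_lists_iff S_carrier m_closed)
    have "x = s \<otimes> (s \<otimes> x \<otimes> s) \<otimes> s"
      using Cons.hyps Cons.prems(2) by (simp add: S_carrier m_assoc gen_cancel gen_square)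
    also have "\<dots> = wp ((s # p) @ c # rev (s # p))"
      unfolding *(2) using Cons.hyps * by (simp add: S_carrier m_assoc)
    finally show ?thesis using * by (intro Cons.prems(1)[of "s # p" c q]) auto
  qed
qed simp

section \<open>Reduced words and left descents\<close>

definition reduced :: "'a list \<Rightarrow> bool" where
  "reduced r \<longleftrightarrow> r \<in> lists S \<and> (\<forall>v\<in>lists S. wp v = wp r \<longrightarrow> length r \<le> length v)"

lemma reduced_in_lists: "reduced r \<Longrightarrow> r \<in> lists S"
  by (simp add: reduced_def)

lemma reduced_le: "reduced r \<Longrightarrow> v \<in> lists S \<Longrightarrow> wp v = wp r \<Longrightarrow> length r \<le> length v"
  by (simp add: reduced_def)

lemma reduced_length_eq: "reduced u \<Longrightarrow> reduced v \<Longrightarrow> wp u = wp v \<Longrightarrow> length u = length v"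
  by (metis le_antisym reduced_def)

lemma reduced_eq_length:
  "reduced u \<Longrightarrow> v \<in> lists S \<Longrightarrow> wp v = wp u \<Longrightarrow> length v \<le> length u \<Longrightarrow> reduced v"
  unfolding reduced_def using le_trans by metis

lemma reduced_expression_iff: "reduced_expression W S r w \<longleftrightarrow> reduced r \<and> wp r = w"
proof (cases "r \<in> lists S \<and> wp r = w")
  case True
  let ?P = "\<lambda>n. \<exists>r\<in>lists S. wp r = w \<and> length r = n"
  have P: "?P (length r)" using True by blast
  have "length r = (LEAST n. ?P n) \<longleftrightarrow> (\<forall>v\<in>lists S. wp v = wp r \<longrightarrow> length r \<le> length v)"
  proof
    assume "length r = (LEAST n. ?P n)"
    then show "\<forall>v\<in>lists S. wp v = wp r \<longrightarrow> length r \<le> length v"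
      using True Least_le[of ?P] by metis
  next
    assume "\<forall>v\<in>lists S. wp v = wp r \<longrightarrow> length r \<le> length v"
    then show "length r = (LEAST n. ?P n)"
      using True P by (intro Least_equality[symmetric]) auto
  qed
  with True show ?thesis
    by (simp add: reduced_expression_def coxeter_length_def reduced_def)
next
  case False
  then show ?thesis by (auto simp: reduced_expression_def reduced_def)
qed

lemma ex_reduced:
  assumes "w \<in> carrier W"
  obtains r where "reduced r" "wp r = w"
proof -
  have "\<exists>r. r \<in> lists S \<and> wp r = w" using assms carrier_eq by auto
  then obtain r where "r \<in> lists S \<and> wp r = w"
    "\<forall>v. v \<in> lists S \<and> wp v = w \<longrightarrow> length r \<le> length v"
    using ex_has_least_nat[of "\<lambda>r. r \<in> lists S \<and> wp r = w" _ length] by blast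
  then show ?thesis using that by (auto simp: reduced_def)
qed

lemma reduced_tail: "reduced (s # r) \<Longrightarrow> reduced r"
proof -
  assume *: "reduced (s # r)"
  then have r: "r \<in> lists S" "s \<in> S" by (auto simp: reduced_def)
  show "reduced r"
    unfolding reduced_def
  proof (intro conjI ballI impI)
    fix v assume v: "v \<in> lists S" "wp v = wp r"
    then have "length (s # r) \<le> length (s # v)" using * r by (intro reduced_le) auto
    then show "length r \<le> length v" by simp
  qed (use r in simp)
qed

text \<open>Since \<open>s\<close> is the conjugate of \<open>c\<close> by \<open>wp p\<close>, it
  passes through \<open>p\<close> as \<open>c\<close> and cancels that letter.\<close>

lemma delete_letter:
  assumes "p @ c # q \<in> lists S" "s \<in> S" "s = wp (p @ c # rev p)"
  shows "s \<otimes> wp (p @ c # q) = wp (p @ q)"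
proof -
  have l: "p \<in> lists S" "c \<in> S" "q \<in> lists S" using assms by auto
  have c: "wp (rev p) \<otimes> wp p = \<one>" using wp_rev_cancel[of "rev p"] l by simp
  have "s \<otimes> wp (p @ c # q) = wp p \<otimes> (c \<otimes> ((wp (rev p) \<otimes> wp p) \<otimes> (c \<otimes> wp q)))"
    unfolding assms(3) using l by (simp add: S_carrier m_assoc)
  also have "\<dots> = wp (p @ q)" unfolding c using l by (simp add: S_carrier gen_cancel)
  finally show ?thesis .
qed

text \<open>Together with \<open>not_reduced_Cons\<close> this identifies left descents by odd
  parity. With even parity, \<open>s\<close> would be a reflection of \<open>r\<close>, and deleting
  the corresponding letter would shorten \<open>s # r\<close> by two.\<close>

lemma refl_parity_hd:
  assumes "reduced (s # r)"
  shows "refl_parity W (s # r) s"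
proof (rule ccontr)
  have l: "s \<in> S" "r \<in> lists S" using assms by (auto simp: reduced_def)
  assume "\<not> refl_parity W (s # r) s"
  then have "refl_parity W r s" using l by (simp add: S_carrier gen_square)
  then obtain p c q where *: "r = p @ c # q" "s = wp (p @ c # rev p)"
    using l S_carrier by (metis refl_parity_occurs)
  then have "wp (s # r) = wp (p @ q)" using delete_letter l by simp
  then have "length (s # r) \<le> length (p @ q)" using assms * l by (intro reduced_le) auto
  with * show False by simp
qed

lemma exchange:
  assumes "reduced r" "s \<in> S" "refl_parity W r s"
  obtains p c q where "r = p @ c # q" "s = wp (p @ c # rev p)" "reduced (s # p @ q)"
    "wp (s # p @ q) = wp r"
proof -
  have r: "r \<in> lists S" using assms by (simp add: reduced_def)
  obtain p c q where *: "r = p @ c # q" "s = wp (p @ c # rev p)"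
    using refl_parity_occurs[OF r _ assms(3)] assms S_carrier by metis
  have l: "p \<in> lists S" "c \<in> S" "q \<in> lists S" using r * by auto
  have "wp (s # p @ q) = s \<otimes> (s \<otimes> wp r)" using delete_letter * r assms by simp
  also have "\<dots> = wp r" using gen_cancel r assms by simp
  finally have "wp (s # p @ q) = wp r" .
  moreover have "reduced (s # p @ q)"
    by (rule reduced_eq_length[OF assms(1)]) (use calculation l assms * in auto)
  ultimately show ?thesis using that * by blast
qed

text \<open>Parity depends only on the element, so it can be evaluated on a shorter expression of
  \<open>wp (s # r)\<close>. Even parity for \<open>r\<close> makes it odd there, and deleting a
  letter leaves an expression of \<open>wp r\<close> shorter than \<open>r\<close>.\<close>

lemma not_reduced_Cons:
  assumes "reduced r" "s \<in> S" "\<not> reduced (s # r)"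
  shows "refl_parity W r s"
proof (rule ccontr)
  assume np: "\<not> refl_parity W r s"
  have r: "r \<in> lists S" using assms by (simp add: reduced_def)
  obtain r' where r': "reduced r'" "wp r' = wp (s # r)"
    using ex_reduced[of "wp (s # r)"] r assms by (auto simp: S_carrier)
  then have l': "r' \<in> lists S" by (simp add: reduced_def)
  have "length r' < length (s # r)"
    using assms(3) r' reduced_eq_length[of r' "s # r"] r assms(2) not_le_imp_less by auto
  have "refl_parity W (s # r) s" using np assms by (simp add: S_carrier gen_square)
  then have "refl_parity W r' s"
    using refl_parity_eq[of r' "s # r" s] r' l' r assms by (simp add: S_carrier)
  from exchange[OF r'(1) assms(2) this] obtain p c q
    where *: "r' = p @ c # q" "s = wp (p @ c # rev p)" "wp (s # p @ q) = wp r'" .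
  have "wp (p @ q) = wp r"
    using delete_letter[of p c q s] * l' r' gen_cancel[of s "wp r"] assms r by simp
  then have "length r \<le> length (p @ q)" using assms(1) l' * by (intro reduced_le) auto
  with \<open>length r' < length (s # r)\<close> * show False by simp
qed

end

section \<open>Commutation classes\<close>

lemma commutation_equiv_refl [simp]: "commutation_equiv m u u"
  by (simp add: commutation_equiv_def)

lemma commutation_equiv_trans [trans]:
  "commutation_equiv m u v \<Longrightarrow> commutation_equiv m v x \<Longrightarrow> commutation_equiv m u x"
  by (simp add: commutation_equiv_def)

lemma commutation_move_context:
  assumes "commutation_move m u v"
  shows "commutation_move m (x @ u @ y) (x @ v @ y)"
  using assms
proof cases
  case (1 s t u' v')
  then show ?thesis using commutation_move.intros[of m s t "x @ u'" "v' @ y"] by simp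
qed

lemma commutation_equiv_context:
  assumes "commutation_equiv m u v"
  shows "commutation_equiv m (x @ u @ y) (x @ v @ y)"
  using assms unfolding commutation_equiv_def
  by (induction rule: rtranclp_induct)
    (auto intro: rtranclp.rtrancl_into_rtrancl commutation_move_context)

lemma commutation_equiv_append:
  assumes "commutation_equiv m u v" "commutation_equiv m u' v'"
  shows "commutation_equiv m (u @ u') (v @ v')"
  using commutation_equiv_context[OF assms(1), of "[]" u']
    commutation_equiv_context[OF assms(2), of v "[]"]
  by (auto intro: commutation_equiv_trans)

lemma commutation_equiv_Cons:
  "commutation_equiv m u v \<Longrightarrow> commutation_equiv m (a # u) (a # v)"
  using commutation_equiv_context[of m u v "[a]" "[]"] by simp

lemma commutation_equiv_swap: "m s t = 2 \<Longrightarrow> commutation_equiv m (x @ s # t # y) (x @ t # s # y)"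
  using commutation_move.intros[of m s t x y] by (auto simp: commutation_equiv_def)

lemma commutation_move_count: "commutation_move m u v \<Longrightarrow> count_list u x = count_list v x"
  by (induction rule: commutation_move.induct) auto

lemma commutation_equiv_count: "commutation_equiv m u v \<Longrightarrow> count_list u x = count_list v x"
  unfolding commutation_equiv_def
  by (induction rule: rtranclp_induct) (auto dest: commutation_move_count)

lemma commutation_equiv_set: "commutation_equiv m u v \<Longrightarrow> set u = set v"
  using commutation_equiv_count[of m u v] by (metis count_list_0_iff subsetI subset_antisym)

lemma commutation_equiv_in_lists: "commutation_equiv m u v \<Longrightarrow> u \<in> lists S \<longleftrightarrow> v \<in> lists S"
  using commutation_equiv_set[of m u v] by (simp add: in_lists_conv_set)

lemma commutation_move_length: "commutation_move m u v \<Longrightarrow> length u = length v"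
  by (induction rule: commutation_move.induct) auto

lemma commutation_equiv_length: "commutation_equiv m u v \<Longrightarrow> length u = length v"
  unfolding commutation_equiv_def
  by (induction rule: rtranclp_induct) (auto dest: commutation_move_length)

text \<open>Two letters selected by \<open>P\<close> are never swapped, so the projection to them is
  an invariant of the commutation class.\<close>

lemma commutation_equiv_filter:
  assumes "commutation_equiv m u v" "\<And>x y. P x \<Longrightarrow> P y \<Longrightarrow> m x y \<noteq> 2"
  shows "filter P u = filter P v"
proof -
  have "commutation_move m u v \<Longrightarrow> filter P u = filter P v" for u v
    by (induction rule: commutation_move.induct) (use assms(2) in auto)
  with assms(1) show ?thesis
    unfolding commutation_equiv_def by (induction rule: rtranclp_induct) auto
qed

text \<open>Deleting the first copy of \<open>a\<close> either destroys the swapped pair or leaves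
  the swap in place. This allows a common letter to be cancelled from commutation equivalent
  words.\<close>

lemma commutation_move_remove1:
  "commutation_move m u v \<Longrightarrow> remove1 a u = remove1 a v \<or> commutation_move m (remove1 a u) (remove1 a v)"
proof (induction rule: commutation_move.induct)
  case (1 s t u v)
  note intros = commutation_move.intros[of m s t, OF 1]
  consider "a \<in> set u" | "a \<notin> set u" "a = s \<or> a = t" | "a \<notin> set u" "a \<noteq> s" "a \<noteq> t" by blast
  then show ?case
  proof cases
    case 1
    then show ?thesis using intros[of "remove1 a u" v] by (simp add: remove1_append)
  next
    case 2
    then show ?thesis by (auto simp: remove1_append)
  next
    case 3
    then show ?thesis using intros[of u "remove1 a v"] by (simp add: remove1_append)
  qed
qed

lemma commutation_equiv_remove1:
  "commutation_equiv m u v \<Longrightarrow> commutation_equiv m (remove1 a u) (remove1 a v)"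
  unfolding commutation_equiv_def
  by (induction rule: rtranclp_induct)
    (auto dest: commutation_move_remove1[of m _ _ a] intro: rtranclp.rtrancl_into_rtrancl)

lemma commutation_equiv_Cons_snoc:
  "(\<And>x. x \<in> set z \<Longrightarrow> m a x = 2) \<Longrightarrow> commutation_equiv m (a # z) (z @ [a])"
proof (induction z)
  case (Cons x z)
  have "commutation_equiv m (a # x # z) (x # a # z)"
    using commutation_equiv_swap[of m a x "[]" z] Cons.prems by simp
  also have "commutation_equiv m (x # a # z) (x # z @ [a])"
    using Cons by (intro commutation_equiv_Cons) auto
  finally show ?case by simp
qed simp

lemma commutation_equiv_snoc_Cons:
  "(\<And>x. x \<in> set z \<Longrightarrow> m x a = 2) \<Longrightarrow> commutation_equiv m (z @ [a]) (a # z)"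
proof (induction z)
  case (Cons x z)
  have "commutation_equiv m (x # z @ [a]) (x # a # z)"
    using Cons by (intro commutation_equiv_Cons) auto
  also have "commutation_equiv m (x # a # z) (a # x # z)"
    using commutation_equiv_swap[of m x a "[]" z] Cons.prems by simp
  finally show ?case by simp
qed simp

lemma commutation_equiv_partition:
  "(\<And>x y. x \<in> set v \<Longrightarrow> y \<in> set v \<Longrightarrow> \<not> P x \<Longrightarrow> P y \<Longrightarrow> m x y = 2) \<Longrightarrow>
    commutation_equiv m v (filter P v @ filter (\<lambda>x. \<not> P x) v)"
proof (induction v)
  case (Cons x v)
  have IH: "commutation_equiv m (x # v) (x # filter P v @ filter (\<lambda>x. \<not> P x) v)"
    using Cons by (intro commutation_equiv_Cons) auto
  show ?case
  proof (cases "P x")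
    case True
    with IH show ?thesis by simp
  next
    case False
    note IH
    also have "commutation_equiv m (x # filter P v @ filter (\<lambda>x. \<not> P x) v)
       (filter P v @ x # filter (\<lambda>x. \<not> P x) v)"
      using commutation_equiv_append[OF commutation_equiv_Cons_snoc[of "filter P v" m x]
          commutation_equiv_refl[of m "filter (\<lambda>x. \<not> P x) v"]]
        Cons.prems False by auto
    finally show ?thesis using False by simp
  qed
qed simp

lemma nth_in_lists: "u \<in> lists S \<Longrightarrow> q < length u \<Longrightarrow> u ! q \<in> S"
  by (simp add: in_lists_conv_set)

section \<open>Braid-free words\<close>

text \<open>Two occurrences in a word are unordered up to commutation unless a chain of non-commuting
  letters joins them. An alternating sequence of occurrences can be made contiguous by commutations
  exactly when it is convex for this order, and for at least three occurrences convexity can be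
  tested on the gaps between equal letters, without reference to the commutation class.\<close>

definition tight_chain ::
  "('a \<Rightarrow> 'a \<Rightarrow> enat) \<Rightarrow> (nat \<Rightarrow> 'a) \<Rightarrow> (nat \<Rightarrow> nat) \<Rightarrow> nat \<Rightarrow> bool" where
  "tight_chain m f i k \<longleftrightarrow>
     (\<forall>j. Suc j < k \<longrightarrow> i j < i (Suc j)) \<and>
     (\<forall>j. j + 2 < k \<longrightarrow> f (i (j + 2)) = f (i j) \<and>
        (\<forall>q. i j < q \<longrightarrow> q < i (j + 2) \<longrightarrow> m (f q) (f (i j)) \<noteq> 2 \<longrightarrow> q = i (Suc j)))"

text \<open>The first clause excludes squares up to commutation. A further copy of
  \<open>f p\<close> in between also counts as a witness, since diagonal labels are 1, so only
  successive copies are really tested. Chains start at length 3 because a braid of length 2 is a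
  mere commutation.\<close>

definition braid_free :: "('a \<Rightarrow> 'a \<Rightarrow> enat) \<Rightarrow> (nat \<Rightarrow> 'a) \<Rightarrow> nat \<Rightarrow> bool" where
  "braid_free m f N \<longleftrightarrow>
     (\<forall>p q. p < q \<longrightarrow> q < N \<longrightarrow> f p = f q \<longrightarrow> (\<exists>x. p < x \<and> x < q \<and> m (f x) (f p) \<noteq> 2)) \<and>
     (\<forall>i k. 3 \<le> k \<longrightarrow> tight_chain m f i k \<longrightarrow> i (k - 1) < N \<longrightarrow>
        m (f (i 0)) (f (i 1)) \<noteq> enat k)"

lemma braid_free_chain:
  "braid_free m f N \<Longrightarrow> 3 \<le> k \<Longrightarrow> tight_chain m f i k \<Longrightarrow> i (k - 1) < N \<Longrightarrow>
    m (f (i 0)) (f (i 1)) \<noteq> enat k"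
  by (simp add: braid_free_def)

abbreviation good_word :: "('a \<Rightarrow> 'a \<Rightarrow> enat) \<Rightarrow> 'a list \<Rightarrow> bool" where
  "good_word m u \<equiv> braid_free m ((!) u) (length u)"

lemma tight_chain_less: "tight_chain m f i k \<Longrightarrow> a < b \<Longrightarrow> b < k \<Longrightarrow> i a < i b"
proof (induction b)
  case (Suc b)
  then have "i b < i (Suc b)" by (simp add: tight_chain_def)
  with Suc show ?case by (cases "a = b") auto
qed simp

lemma tight_chain_le: "tight_chain m f i k \<Longrightarrow> a \<le> b \<Longrightarrow> b < k \<Longrightarrow> i a \<le> i b"
  using tight_chain_less[of m f i k a b] by (cases "a = b") auto

lemma tight_chain_bound:
  assumes "tight_chain m f i k" "i (k - 1) < N" "j < k"
  shows "i j < N"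
proof -
  have "i j \<le> i (k - 1)" using assms(3) by (intro tight_chain_le[OF assms(1)]) auto
  with assms(2) show ?thesis by simp
qed

lemma tight_chain_letter:
  "tight_chain m f i k \<Longrightarrow> j < k \<Longrightarrow> f (i j) = (if even j then f (i 0) else f (i 1))"
proof (induction j rule: less_induct)
  case (less j)
  show ?case
  proof (cases "j < 2")
    case True
    then have "j = 0 \<or> j = 1" by auto
    then show ?thesis by auto
  next
    case False
    then obtain l where l: "j = l + 2" by (metis add.commute le_Suc_ex not_less)
    then have "f (i j) = f (i l)" using less.prems by (simp add: tight_chain_def)
    with less.IH[of l] less.prems l show ?thesis by simp
  qed
qed

lemma tight_chain_interval:
  assumes "tight_chain m f i k" "i 0 \<le> q" "q \<le> i (k - 1)" "0 < k"
  obtains j where "j < k" "i j \<le> q" "Suc j < k \<Longrightarrow> q < i (Suc j)"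
proof -
  define j where "j = (GREATEST j. j \<le> k - 1 \<and> i j \<le> q)"
  have j: "j \<le> k - 1 \<and> i j \<le> q"
    unfolding j_def by (rule GreatestI_nat[of _ 0 "k - 1"]) (use assms in auto)
  have "l \<le> j" if "l \<le> k - 1" "i l \<le> q" for l
    unfolding j_def by (rule Greatest_le_nat[of _ _ "k - 1"]) (use that in auto)
  from this[of "Suc j"] have "Suc j < k \<Longrightarrow> q < i (Suc j)" by force
  moreover have "j < k" using j assms(4) by linarith
  ultimately show ?thesis using that j by blast
qed

lemma tight_chain_gap:
  "tight_chain m f i k \<Longrightarrow> j + 2 < k \<Longrightarrow> i j < q \<Longrightarrow> q < i (j + 2) \<Longrightarrow> q \<noteq> i (Suc j) \<Longrightarrow>
    m (f q) (f (i j)) = 2"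
  unfolding tight_chain_def by metis

lemma tight_chain_cong:
  assumes "tight_chain m f i k" "i (k - 1) < N" "\<And>q. q < N \<Longrightarrow> f q = g q"
  shows "tight_chain m g i k"
proof -
  have lt: "i j < N" if "j < k" for j
    using tight_chain_bound[OF assms(1,2)] that .
  show ?thesis
    unfolding tight_chain_def
  proof (intro conjI allI impI)
    fix j assume j: "Suc j < k"
    then show "i j < i (Suc j)" using assms(1) by (simp add: tight_chain_def)
  next
    fix j assume j: "j + 2 < k"
    then show "g (i (j + 2)) = g (i j)"
      using assms(1) lt[of j] lt[of "j + 2"] by (simp add: tight_chain_def flip: assms(3))
  next
    fix j q assume j: "j + 2 < k" and q: "i j < q" "q < i (j + 2)" "m (g q) (g (i j)) \<noteq> 2"
    then have "q < N" "i j < N" using lt[of "j + 2"] by auto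
    then show "q = i (Suc j)"
      using tight_chain_gap[OF assms(1) j q(1,2)] q(3) assms(3) by auto
  qed
qed

text \<open>Agreement of \<open>g\<close> with the shifted \<open>f\<close> is required only up to
  the end of the chain, so that \<open>g\<close> may be \<open>(!) u\<close>, which is unspecified
  beyond the length of \<open>u\<close>.\<close>

lemma tight_chain_shift:
  assumes "tight_chain m f i k" "\<And>q. p + q \<le> i (k - 1) \<Longrightarrow> g q = f (p + q)" "p \<le> i 0" "0 < k"
  shows "tight_chain m g (\<lambda>j. i j - p) k"
proof -
  have ge: "p \<le> i j" "i j \<le> i (k - 1)" if "j < k" for j
    using tight_chain_le[OF assms(1), of 0 j] tight_chain_le[OF assms(1), of j "k - 1"]
      that assms(3) by auto
  have g: "g (i j - p) = f (i j)" if "j < k" for j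
    using assms(2)[of "i j - p"] ge[OF that] by simp
  show ?thesis
    unfolding tight_chain_def
  proof (intro conjI allI impI)
    fix j assume j: "Suc j < k"
    then show "i j - p < i (Suc j) - p" using assms(1) ge[of j] by (simp add: tight_chain_def diff_less_mono)
  next
    fix j assume j: "j + 2 < k"
    then show "g (i (j + 2) - p) = g (i j - p)"
      using assms(1) by (simp add: g tight_chain_def)
  next
    fix j q assume j: "j + 2 < k"
      and q: "i j - p < q" "q < i (j + 2) - p" "m (g q) (g (i j - p)) \<noteq> 2"
    have "g q = f (p + q)" using q ge[OF j] by (intro assms(2)) auto
    moreover have "i j < p + q" "p + q < i (j + 2)" using q ge[OF j] ge[of j] j by linarith+
    ultimately have "p + q = i (Suc j)"
      using tight_chain_gap[OF assms(1) j, of "p + q"] q g[of j] j by auto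
    then show "q = i (Suc j) - p" by simp
  qed
qed

lemma tight_chain_unshift:
  "tight_chain m (\<lambda>q. f (p + q)) i k \<Longrightarrow> tight_chain m f (\<lambda>j. p + i j) k"
  unfolding tight_chain_def
proof (intro conjI allI impI)
  fix j q
  assume *: "(\<forall>j. Suc j < k \<longrightarrow> i j < i (Suc j)) \<and>
     (\<forall>j. j + 2 < k \<longrightarrow> f (p + i (j + 2)) = f (p + i j) \<and>
        (\<forall>q. i j < q \<longrightarrow> q < i (j + 2) \<longrightarrow> m (f (p + q)) (f (p + i j)) \<noteq> 2 \<longrightarrow> q = i (Suc j)))"
    and j: "j + 2 < k" and q: "p + i j < q" "q < p + i (j + 2)" "m (f q) (f (p + i j)) \<noteq> 2"
  have "i j < q - p" "q - p < i (j + 2)" "m (f (p + (q - p))) (f (p + i j)) \<noteq> 2"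
    using q by auto
  then have "q - p = i (Suc j)" using * j by blast
  then show "q = p + i (Suc j)" using q by simp
qed auto

lemma braid_free_cong:
  assumes "braid_free m f N" "\<And>q. q < N \<Longrightarrow> f q = g q"
  shows "braid_free m g N"
  unfolding braid_free_def
proof (intro conjI allI impI)
  fix p q assume *: "p < q" "q < N" "g p = g q"
  then obtain x where "p < x" "x < q" "m (f x) (f p) \<noteq> 2"
    using assms unfolding braid_free_def by (metis order_less_trans)
  with * assms(2) show "\<exists>x>p. x < q \<and> m (g x) (g p) \<noteq> 2"
    by (metis order_less_trans)
next
  fix i k assume *: "3 \<le> k" "tight_chain m g i k" "i (k - 1) < N"
  have "tight_chain m f i k" by (rule tight_chain_cong[OF *(2,3)]) (simp add: assms(2))
  moreover have "i 0 < N" "i 1 < N"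
    using tight_chain_bound[OF *(2,3)] * by simp_all
  ultimately show "m (g (i 0)) (g (i 1)) \<noteq> enat k"
    using braid_free_chain[OF assms(1) *(1), of i] *(3) assms(2) by auto
qed

lemma braid_free_factor:
  assumes "braid_free m f N" "p + n \<le> N"
  shows "braid_free m (\<lambda>q. f (p + q)) n"
  unfolding braid_free_def
proof (intro conjI allI impI)
  fix a b assume *: "a < b" "b < n" "f (p + a) = f (p + b)"
  then have "p + a < p + b" "p + b < N" using assms(2) by auto
  then obtain x where x: "p + a < x" "x < p + b" "m (f x) (f (p + a)) \<noteq> 2"
    using assms(1) *(3) unfolding braid_free_def by blast
  then have "a < x - p" "x - p < b" "p + (x - p) = x" by auto
  with x show "\<exists>x>a. x < b \<and> m (f (p + x)) (f (p + a)) \<noteq> 2" by metis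
next
  fix i k assume *: "3 \<le> k" "tight_chain m (\<lambda>q. f (p + q)) i k" "i (k - 1) < n"
  have "tight_chain m f (\<lambda>j. p + i j) k" by (rule tight_chain_unshift[OF *(2)])
  then show "m (f (p + i 0)) (f (p + i 1)) \<noteq> enat k"
    using braid_free_chain[OF assms(1) *(1), of "\<lambda>j. p + i j"] assms(2) *(3) by simp
qed

lemma good_word_factor:
  assumes "good_word m (x @ u @ y)"
  shows "good_word m u"
  by (rule braid_free_cong[OF braid_free_factor[OF assms, of "length x" "length u"]])
    (auto simp: nth_append)

lemma not_good_word_square: "\<not> good_word m (x @ a # a # y)"
proof
  assume "good_word m (x @ a # a # y)"
  from good_word_factor[of m x "[a, a]" y] this have g: "good_word m [a, a]" by simp
  then have "\<exists>x>0. x < (1::nat) \<and> m ([a, a] ! x) ([a, a] ! 0) \<noteq> 2"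
    unfolding braid_free_def by (metis One_nat_def length_Cons lessI list.size(3) nth_Cons_0 nth_Cons_Suc zero_less_one)
  then show False by auto
qed

lemma not_good_word_braid:
  assumes "m a b = enat k" "3 \<le> k"
  shows "\<not> good_word m (x @ alt_word a b k @ y)"
proof
  assume "good_word m (x @ alt_word a b k @ y)"
  then have "good_word m (alt_word a b k)" by (rule good_word_factor)
  moreover have "tight_chain m ((!) (alt_word a b k)) (\<lambda>j. j) k"
    unfolding tight_chain_def by (auto simp: nth_alt_word)
  ultimately have "m (alt_word a b k ! 0) (alt_word a b k ! 1) \<noteq> enat k"
    using assms(2) unfolding braid_free_def by fastforce
  then show False using assms by (simp add: nth_alt_word)
qed

text \<open>Being braid-free depends only on the relative order of non-commuting letters. The
  rearrangement is taken to be an involution, as for a single swap, so that \<open>order\<close> can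
  be applied in both directions.\<close>

lemma braid_free_rearrange:
  assumes bf: "braid_free m f N"
    and inv: "\<And>q. \<sigma> (\<sigma> q) = q" and bound: "\<And>q. q < N \<Longrightarrow> \<sigma> q < N"
    and eq: "\<And>q. q < N \<Longrightarrow> g q = f (\<sigma> q)"
    and sym: "\<And>p q. p < N \<Longrightarrow> q < N \<Longrightarrow> m (g p) (g q) = m (g q) (g p)"
    and self: "\<And>q. q < N \<Longrightarrow> m (g q) (g q) \<noteq> 2"
    and order: "\<And>p q. p < q \<Longrightarrow> q < N \<Longrightarrow> m (g p) (g q) \<noteq> 2 \<Longrightarrow> \<sigma> p < \<sigma> q"
  shows "braid_free m g N"
proof -
  \<comment> \<open>A letter of \<open>f\<close> between the images that does not commute with them
    cannot come from outside the originals, since \<open>order\<close> would then put it outside the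
    images too.\<close>
  have between: "p < \<sigma> x \<and> \<sigma> x < q \<and> g (\<sigma> x) = f x"
    if "p < q" "q < N" "g p = g q" "\<sigma> p < x" "x < \<sigma> q" "m (f x) (g p) \<noteq> 2" for p q x
  proof -
    have x: "x < N" "\<sigma> x < N" "g (\<sigma> x) = f x"
      using that bound[of q] bound[of x] eq[of "\<sigma> x"] inv by auto
    have "\<not> \<sigma> x < p" using order[of "\<sigma> x" p] that x inv by auto
    moreover have "\<not> q < \<sigma> x" using order[of q "\<sigma> x"] that x inv sym[of q "\<sigma> x"] by auto
    moreover have "\<sigma> x \<noteq> p" "\<sigma> x \<noteq> q" using that inv by auto
    ultimately show ?thesis using x by auto
  qed
  show ?thesis
    unfolding braid_free_def
  proof (intro conjI allI impI)
    fix p q assume *: "p < q" "q < N" "g p = g q"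
    then have "\<sigma> p < \<sigma> q" using order self[of p] by auto
    moreover have "f (\<sigma> p) = g p" "f (\<sigma> q) = g q" "\<sigma> q < N" using * eq bound by auto
    ultimately obtain x where x: "\<sigma> p < x" "x < \<sigma> q" "m (f x) (g p) \<noteq> 2"
      using bf * unfolding braid_free_def by metis
    from between[OF * this] x show "\<exists>x>p. x < q \<and> m (g x) (g p) \<noteq> 2" by metis
  next
    fix i k assume *: "3 \<le> k" "tight_chain m g i k" "i (k - 1) < N"
    have lt: "i j < N" if "j < k" for j
      using tight_chain_bound[OF *(2,3)] that .
    show "m (g (i 0)) (g (i 1)) \<noteq> enat k"
    proof
      assume e: "m (g (i 0)) (g (i 1)) = enat k"
      have "enat k \<noteq> 2" using *(1) by (simp add: numeral_eq_enat)
      then have ne: "m (g (i j)) (g (i (Suc j))) \<noteq> 2" if "Suc j < k" for j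
        using tight_chain_letter[OF *(2), of j] tight_chain_letter[OF *(2), of "Suc j"] that e
          sym[of "i 0" "i 1"] lt[of 0] lt[of 1] *(1) by (cases "even j") auto
      have "tight_chain m f (\<lambda>j. \<sigma> (i j)) k"
        unfolding tight_chain_def
      proof (intro conjI allI impI)
        fix j assume "Suc j < k"
        then show "\<sigma> (i j) < \<sigma> (i (Suc j))"
          using ne lt order *(2) by (simp add: tight_chain_def)
      next
        fix j assume j: "j + 2 < k"
        then have "g (i (j + 2)) = g (i j)" using *(2) unfolding tight_chain_def by blast
        then show "f (\<sigma> (i (j + 2))) = f (\<sigma> (i j))" using eq lt[of j] lt[of "j + 2"] j by simp
      next
        fix j q assume j: "j + 2 < k"
          and q: "\<sigma> (i j) < q" "q < \<sigma> (i (j + 2))" "m (f q) (f (\<sigma> (i j))) \<noteq> 2"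
        have "g (i (j + 2)) = g (i j)" using *(2) j unfolding tight_chain_def by blast
        moreover have "i j < i (j + 2)" using tight_chain_less[OF *(2), of j "j + 2"] j by simp
        ultimately have "i j < \<sigma> q \<and> \<sigma> q < i (j + 2) \<and> g (\<sigma> q) = f q"
          using between[of "i j" "i (j + 2)" q] lt[of j] lt[of "j + 2"] j q eq by auto
        then have "\<sigma> q = i (Suc j)"
          using tight_chain_gap[OF *(2) j, of "\<sigma> q"] q(3) eq[of "i j"] lt[of j] j by auto
        then show "q = \<sigma> (i (Suc j))" using inv by metis
      qed
      moreover have "\<sigma> (i (k - 1)) < N" using bound *(3) by simp
      ultimately have "m (f (\<sigma> (i 0))) (f (\<sigma> (i 1))) \<noteq> enat k"
        using bf *(1) unfolding braid_free_def by auto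
      with e eq lt[of 0] lt[of 1] *(1) show False by auto
    qed
  qed
qed

context coxeter_mat
begin

lemma commutation_move_sym:
  "commutation_move m u v \<Longrightarrow> u \<in> lists S \<Longrightarrow> commutation_move m v u"
proof (induction rule: commutation_move.induct)
  case (1 s t u v)
  then show ?case using commutation_move.intros[of m t s u v] m_sym[of s t] by simp
qed

lemma commutation_equiv_sym:
  assumes "commutation_equiv m u v" "u \<in> lists S"
  shows "commutation_equiv m v u"
  using assms(1) unfolding commutation_equiv_def
proof (induction rule: rtranclp_induct)
  case (step v x)
  have "v \<in> lists S"
    using step(1) assms(2) commutation_equiv_in_lists[of m u v S] by (simp add: commutation_equiv_def)
  with step(2) have "commutation_move m x v" by (rule commutation_move_sym)
  with step(3) show ?case by (rule_tac converse_rtranclp_into_rtranclp)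
qed simp

lemma good_word_move:
  assumes "commutation_move m u v" "u \<in> lists S" "good_word m u"
  shows "good_word m v"
  using assms(1)
proof cases
  case (1 s t x y)
  define n where "n = length x"
  define \<sigma> where "\<sigma> q = (if q = n then Suc n else if q = Suc n then n else q)" for q
  have st: "s \<in> S" "t \<in> S" "v \<in> lists S" using assms(2) 1 by auto
  have vS: "v ! q \<in> S" if "q < length v" for q
    using nth_in_lists[OF st(3) that] .
  have "good_word m u" by fact
  then have "braid_free m ((!) u) (length v)" using 1 by simp
  then show ?thesis
  proof (rule braid_free_rearrange[where \<sigma> = \<sigma>])
    fix p q assume *: "p < q" "q < length v" "m (v ! p) (v ! q) \<noteq> 2"
    have "\<not> (p = n \<and> q = Suc n)"
      using * 1 m_sym[OF st(1,2)] by (auto simp: n_def nth_append)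
    with * show "\<sigma> p < \<sigma> q" by (auto simp: \<sigma>_def)
  next
    fix q assume "q < length v"
    then show "v ! q = u ! \<sigma> q" using 1 by (auto simp: \<sigma>_def n_def nth_append nth_Cons')
  next
    fix p q assume "p < length v" "q < length v"
    then show "m (v ! p) (v ! q) = m (v ! q) (v ! p)" by (intro m_sym vS)
  next
    fix q assume "q < length v"
    then show "m (v ! q) (v ! q) \<noteq> 2" by (intro m_self_ne_2 vS)
  qed (use 1 in \<open>auto simp: \<sigma>_def n_def\<close>)
qed

lemma good_word_equiv:
  assumes "commutation_equiv m u v" "u \<in> lists S" "good_word m u"
  shows "good_word m v"
  using assms(1) unfolding commutation_equiv_def
proof (induction rule: rtranclp_induct)
  case (step v x)
  have "v \<in> lists S"
    using step(1) assms(2) commutation_equiv_in_lists[of m u v S] by (simp add: commutation_equiv_def)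
  with step show ?case by (blast intro: good_word_move)
qed (use assms in simp)

text \<open>The word is cut at the first, second, last but one and last positions of the chain. The
  outer gaps are guarded for one letter only: what lies in the first commutes with \<open>a\<close>
  and in the last with \<open>c\<close>, so these two end letters are moved inwards. The middle
  segment is guarded for both letters, so everything else in it can be pushed to its right end, and
  \<open>c\<close> then moves past it.\<close>

lemma gather_chain:
  assumes u: "u \<in> lists S" and ch: "tight_chain m ((!) u) i k" and k: "3 \<le> k"
    and N: "i (k - 1) < length u" and ab: "u ! i 0 = a" "u ! i 1 = b" "m a b \<noteq> 2"
  obtains x y where "commutation_equiv m u (x @ alt_word a b k @ y)"
    "i 0 = 0 \<Longrightarrow> Suc (i (k - 1)) = length u \<Longrightarrow> a \<notin> set (x @ y) \<and> b \<notin> set (x @ y)"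
proof -
  define f where "f = (!) u"
  define c where "c = f (i (k - 1))"
  let ?P = "\<lambda>x. x = a \<or> x = b"
  have lt: "i j < length u" if "j < k" for j
    using tight_chain_bound[OF ch N] that .
  have fS: "f q \<in> S" if "q < length u" for q
    unfolding f_def using nth_in_lists[OF u that] .
  have fab: "f (i 0) = a" "f (i 1) = b" using ab by (simp_all add: f_def)
  have abS: "a \<in> S" "b \<in> S" using fS[OF lt[of 0]] fS[OF lt[of 1]] fab k by simp_all
  have ba: "m b a \<noteq> 2" using ab(3) m_sym[OF abS] by simp
  note letter = tight_chain_letter[OF ch, folded f_def]
  note gap = tight_chain_gap[OF ch, folded f_def]
  note mono = tight_chain_less[OF ch]
  define v where "v = map f [i 1..<Suc (i (k - 2))]"
  define z1 where "z1 = map f [Suc (i 0)..<i 1]"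
  define z2 where "z2 = map f [Suc (i (k - 2))..<i (k - 1)]"
  define z0 where "z0 = map f [0..<i 0]"
  define z3 where "z3 = map f [Suc (i (k - 1))..<length u]"
  have ord: "i 0 < i 1" "i 1 \<le> i (k - 2)" "i (k - 2) < i (k - 1)"
    using mono[of 0 1] tight_chain_le[OF ch, of 1 "k - 2"] mono[of "k - 2" "k - 1"] k by auto
  have split: "[p..<r] = [p..<q] @ [q..<r]" if "p \<le> q" "q \<le> r" for p q r :: nat
    using upt_add_eq_append[of p q "r - q"] that by simp
  have "[0..<length u] = [0..<i 0] @ [i 0] @ [Suc (i 0)..<i 1] @ [i 1..<Suc (i (k - 2))] @
      [Suc (i (k - 2))..<i (k - 1)] @ [i (k - 1)] @ [Suc (i (k - 1))..<length u]"
  proof -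
    have "[0..<length u] = [0..<i 0] @ [i 0..<Suc (i 0)] @ [Suc (i 0)..<i 1] @
      [i 1..<Suc (i (k - 2))] @ [Suc (i (k - 2))..<i (k - 1)] @ [i (k - 1)..<Suc (i (k - 1))] @
      [Suc (i (k - 1))..<length u]"
      using ord N split[of 0 "i 0" "length u"] split[of "i 0" "Suc (i 0)" "length u"]
        split[of "Suc (i 0)" "i 1" "length u"] split[of "i 1" "Suc (i (k - 2))" "length u"]
        split[of "Suc (i (k - 2))" "i (k - 1)" "length u"]
        split[of "i (k - 1)" "Suc (i (k - 1))" "length u"]
      by (simp del: upt_Suc)
    then show ?thesis by simp
  qed
  then have "map f [0..<length u] = z0 @ [f (i 0)] @ z1 @ v @ z2 @ [c] @ z3"
    unfolding z0_def z1_def z2_def z3_def v_def c_def map_append[symmetric] list.map(2)[symmetric]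
    by simp
  moreover have "map f [0..<length u] = u" by (simp add: f_def map_nth)
  ultimately have ueq: "u = z0 @ [a] @ z1 @ v @ z2 @ [c] @ z3" using ab by (simp add: f_def)
  have z1: "m a x = 2" if x: "x \<in> set z1" for x
  proof -
    obtain q where q: "x = f q" "i 0 < q" "q < i 1" using x by (auto simp: z1_def)
    have "i 1 < i 2" using mono[of 1 2] k by simp
    then have "m x a = 2" using gap[of 0 q] q k ab by (simp add: f_def numeral_2_eq_2)
    moreover have "x \<in> S" using q fS lt[of 1] k by simp
    ultimately show ?thesis using m_sym abS by simp
  qed
  then have c1: "commutation_equiv m ([a] @ z1) (z1 @ [a])"
    using commutation_equiv_Cons_snoc[of z1 m a] by simp
  have z2: "m x c = 2" if x: "x \<in> set z2" for x
  proof -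
    obtain q where q: "x = f q" "i (k - 2) < q" "q < i (k - 1)" using x by (auto simp: z2_def)
    obtain l where l: "k = l + 3" using k by (metis add.commute le_Suc_ex)
    have "i l < i (Suc l)" using mono[of l "Suc l"] l by simp
    then have "m x (f (i l)) = 2"
      using gap[of l q] q l by simp
    moreover have "f (i l) = c" using letter[of l] letter[of "l + 2"] l by (simp add: c_def)
    ultimately show ?thesis by simp
  qed
  then have c2: "commutation_equiv m (z2 @ [c]) ([c] @ z2)"
    using commutation_equiv_snoc_Cons[of z2 m c] by simp
  \<comment> \<open>A middle position that is not on the chain lies in two overlapping gaps, one
    between copies of \<open>a\<close> and one between copies of \<open>b\<close>, and therefore
    commutes with both.\<close>
  have v_chain: "\<exists>j<k - 1. q = i j" if "i 1 \<le> q" "q \<le> i (k - 2)" "m (f q) a \<noteq> 2 \<or> m (f q) b \<noteq> 2" for q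
  proof -
    have "i 0 \<le> q" "q \<le> i (k - 1)" using that ord by simp_all
    then obtain j where jj: "j < k" "i j \<le> q" "Suc j < k \<Longrightarrow> q < i (Suc j)"
      using tight_chain_interval[OF ch] k by (metis less_le_trans zero_less_numeral)
    have "j < k - 1" using jj(2) that(2) ord(3) tight_chain_le[OF ch, of "k - 1" j] jj(1) by force
    have "1 \<le> j" using jj(3) that(1) k by (cases j) auto
    show ?thesis
    proof (cases "q = i j")
      case True
      then show ?thesis using \<open>j < k - 1\<close> by blast
    next
      case False
      then have ij: "i j < q" using jj by simp
      then have "j \<noteq> k - 2" using that(2) by auto
      then have "j < k - 2" using \<open>j < k - 1\<close> by simp
      then have q1: "q < i (Suc j)" using jj(3) by simp
      obtain l where l: "j = Suc l" using \<open>1 \<le> j\<close> by (cases j) auto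
      have "i (Suc j) < i (j + 2)" "i l < i j"
        using mono[of "Suc j" "j + 2"] mono[of l j] l \<open>j < k - 2\<close> by auto
      then have "m (f q) (f (i j)) = 2" "m (f q) (f (i l)) = 2"
        using gap[of j q] gap[of l q] q1 ij l \<open>j < k - 2\<close> by auto
      moreover have "{f (i j), f (i l)} = {a, b}"
        using letter[of j] letter[of l] l \<open>j < k - 2\<close> ab by (auto simp: f_def)
      ultimately show ?thesis using that(3) by (auto simp: doubleton_eq_iff)
    qed
  qed
  have P_iff: "?P (f q) \<longleftrightarrow> m (f q) a \<noteq> 2 \<or> m (f q) b \<noteq> 2" if "i 1 \<le> q" "q \<le> i (k - 2)" for q
  proof
    assume "?P (f q)" then show "m (f q) a \<noteq> 2 \<or> m (f q) b \<noteq> 2" using ab ba by auto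
  next
    assume "m (f q) a \<noteq> 2 \<or> m (f q) b \<noteq> 2"
    from v_chain[OF that this] obtain j where "j < k - 1" "q = i j" by blast
    then show "?P (f q)" using letter[of j] ab by (auto simp: f_def)
  qed
  have c3: "commutation_equiv m v (filter ?P v @ filter (\<lambda>x. \<not> ?P x) v)"
  proof (rule commutation_equiv_partition)
    fix x y assume "x \<in> set v" "\<not> ?P x" "?P y"
    moreover from this obtain q where q: "x = f q" "i 1 \<le> q" "q \<le> i (k - 2)" by (auto simp: v_def)
    ultimately show "m x y = 2" using P_iff[OF q(2,3)] by blast
  qed
  \<comment> \<open>The letters \<open>a\<close> and \<open>b\<close> in the middle segment sit
    exactly at the inner chain positions; both lists are sorted and distinct, so comparing their
    sets suffices.\<close>
  have "filter (\<lambda>q. ?P (f q)) [i 1..<Suc (i (k - 2))] = map i [1..<k - 1]"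
  proof (rule sorted_distinct_set_unique)
    have sm: "strict_mono_on {1..<k - 1} i"
      using mono k by (auto simp: strict_mono_on_def)
    show "distinct (map i [1..<k - 1])"
      using strict_mono_on_imp_inj_on[OF sm] by (simp add: distinct_map)
    show "sorted (map i [1..<k - 1])"
      unfolding sorted_iff_nth_mono by (simp add: tight_chain_le[OF ch])
    have A: "q \<in> i ` {1..<k - 1}" if q: "i 1 \<le> q" "q \<le> i (k - 2)" "?P (f q)" for q
    proof -
      obtain j where j: "j < k - 1" "q = i j"
        using v_chain[OF q(1,2)] P_iff[OF q(1,2)] q(3) by blast
      have "j \<noteq> 0" using j(2) ord(1) q(1) by (metis not_le)
      with j show ?thesis by auto
    qed
    have B: "i 1 \<le> i j \<and> i j < Suc (i (k - 2)) \<and> ?P (f (i j))" if j: "1 \<le> j" "j < k - 1" for j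
    proof -
      have "i j \<le> i (k - 2)" "i 1 \<le> i j"
        by (rule tight_chain_le[OF ch]; use j k in linarith)+
      moreover have "?P (f (i j))" using letter[of j] j(2) fab by auto
      ultimately show ?thesis by simp
    qed
    have "set (map i [1..<k - 1]) = i ` {1..<k - 1}"
      "set (filter (\<lambda>q. ?P (f q)) [i 1..<Suc (i (k - 2))]) =
        {q. i 1 \<le> q \<and> q < Suc (i (k - 2)) \<and> ?P (f q)}"
      by (auto simp del: upt_Suc)
    moreover have "{q. i 1 \<le> q \<and> q < Suc (i (k - 2)) \<and> ?P (f q)} = i ` {1..<k - 1}"
    proof (intro equalityI subsetI)
      fix q assume "q \<in> {q. i 1 \<le> q \<and> q < Suc (i (k - 2)) \<and> ?P (f q)}"
      then show "q \<in> i ` {1..<k - 1}" using A[of q] by (simp add: less_Suc_eq_le)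
    next
      fix q assume "q \<in> i ` {1..<k - 1}"
      then obtain j where "q = i j" "1 \<le> j" "j < k - 1" by auto
      then show "q \<in> {q. i 1 \<le> q \<and> q < Suc (i (k - 2)) \<and> ?P (f q)}" using B[of j] by simp
    qed
    ultimately show "set (filter (\<lambda>q. ?P (f q)) [i 1..<Suc (i (k - 2))]) = set (map i [1..<k - 1])"
      by (simp only:)
  qed (simp_all add: sorted_wrt_filter del: upt_Suc)
  then have "filter ?P v = map f (map i [1..<k - 1])"
    by (simp add: v_def filter_map o_def del: upt_Suc)
  also have "\<dots> = alt_word b a (k - 2)"
  proof (rule nth_equalityI)
    fix j assume "j < length (map f (map i [1..<k - 1]))"
    then show "map f (map i [1..<k - 1]) ! j = alt_word b a (k - 2) ! j"
      using letter[of "Suc j"] fab by (simp add: nth_alt_word)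
  qed simp
  finally have fv: "filter ?P v = alt_word b a (k - 2)" .
  have alt: "[a] @ alt_word b a (k - 2) @ [c] = alt_word a b k"
  proof -
    define l where "l = k - 2"
    have l: "k = Suc (Suc l)" using k by (simp add: l_def)
    have "c = (if even l then b else a)" using letter[of "Suc l"] fab l by (simp add: c_def)
    then show ?thesis using alt_word_snoc[of b a l] l by simp
  qed
  have cab: "c = a \<or> c = b" using letter[of "k - 1"] k fab by (auto simp: c_def)
  let ?r = "filter (\<lambda>x. \<not> ?P x) v"
  have c4: "commutation_equiv m (?r @ [c]) (c # ?r)"
  proof (rule commutation_equiv_snoc_Cons)
    fix x assume x: "x \<in> set ?r"
    then obtain q where q: "x = f q" "i 1 \<le> q" "q \<le> i (k - 2)" "\<not> ?P (f q)" by (auto simp: v_def)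
    show "m x c = 2" using P_iff[OF q(2,3)] q(1,4) cab by blast
  qed
  have "commutation_equiv m u (z0 @ (z1 @ [a]) @ (filter ?P v @ ?r) @ ([c] @ z2) @ z3)"
    unfolding ueq
    using commutation_equiv_append[OF commutation_equiv_refl[of m z0] commutation_equiv_append[OF c1
        commutation_equiv_append[OF c3 commutation_equiv_append[OF c2 commutation_equiv_refl[of m z3]]]]]
    by simp
  also have "commutation_equiv m \<dots> (z0 @ (z1 @ [a]) @ filter ?P v @ [c] @ ?r @ z2 @ z3)"
    using commutation_equiv_context[OF c4, of "z0 @ (z1 @ [a]) @ filter ?P v" "z2 @ z3"] by simp
  also have "\<dots> = (z0 @ z1) @ alt_word a b k @ (?r @ z2 @ z3)"
    unfolding alt[symmetric] fv by simp
  finally show ?thesis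
  proof (rule that)
    assume "i 0 = 0" "Suc (i (k - 1)) = length u"
    then have "z0 = []" "z3 = []" by (simp_all add: z0_def z3_def)
    moreover have "a \<notin> set z1" "b \<notin> set z1"
      using z1[of a] z1[of b] ab(3) m_self_ne_2[OF abS(1)] by auto
    moreover have "a \<notin> set z2" "b \<notin> set z2"
      using z2[of a] z2[of b] cab ab(3) ba m_self_ne_2[OF abS(1)] m_self_ne_2[OF abS(2)] by auto
    ultimately show "a \<notin> set ((z0 @ z1) @ (?r @ z2 @ z3)) \<and> b \<notin> set ((z0 @ z1) @ (?r @ z2 @ z3))"
      by simp
  qed
qed

lemma not_good_word_cases:
  assumes "u \<in> lists S" "\<not> good_word m u"
  obtains (square) x a y where "commutation_equiv m u (x @ a # a # y)"
  | (braid) x a b k y where "commutation_equiv m u (x @ alt_word a b k @ y)" "a \<in> S" "b \<in> S"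
      "m a b = enat k" "3 \<le> k"
proof -
  have uS: "u ! q \<in> S" if "q < length u" for q
    using nth_in_lists[OF assms(1) that] .
  from assms(2) consider
    p q where "p < q" "q < length u" "u ! p = u ! q"
      "\<And>x. p < x \<Longrightarrow> x < q \<Longrightarrow> m (u ! x) (u ! p) = 2"
    | i k where "3 \<le> k" "tight_chain m ((!) u) i k" "i (k - 1) < length u"
      "m (u ! i 0) (u ! i 1) = enat k"
    unfolding braid_free_def by blast
  then show ?thesis
  proof cases
    case (1 p q)
    define z where "z = take (q - Suc p) (drop (Suc p) u)"
    have "u = take p u @ [u ! p] @ drop (Suc p) u" using id_take_nth_drop[of p u] 1(1,2) by simp
    moreover have "drop (Suc p) u = z @ u ! q # drop (Suc q) u"
      using 1 id_take_nth_drop[of "q - Suc p" "drop (Suc p) u"] by (simp add: z_def)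
    ultimately have u: "u = take p u @ (u ! p # z) @ u ! p # drop (Suc q) u"
      using 1(3) by (metis append_Cons append_Nil append_assoc)
    have "m (u ! p) x = 2" if x: "x \<in> set z" for x
    proof -
      obtain l where l: "l < length z" "x = z ! l" using x by (auto simp: in_set_conv_nth)
      then have "x = u ! (Suc p + l)" "Suc p + l < q" using 1 by (auto simp: z_def)
      moreover from this have "x \<in> S" "u ! p \<in> S" using 1(1,2) uS by simp_all
      ultimately show ?thesis using 1(4)[of "Suc p + l"] m_sym[of "u ! p" x] by simp
    qed
    then have "commutation_equiv m (u ! p # z) (z @ [u ! p])" by (rule commutation_equiv_Cons_snoc)
    from commutation_equiv_context[OF this, of "take p u" "u ! p # drop (Suc q) u"]
    have "commutation_equiv m u ((take p u @ z) @ u ! p # u ! p # drop (Suc q) u)"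
      unfolding u[symmetric] by simp
    then show ?thesis by (rule square)
  next
    case (2 i k)
    have "i 0 < length u" "i 1 < length u"
      using tight_chain_bound[OF 2(2,3)] 2 by simp_all
    moreover have "m (u ! i 0) (u ! i 1) \<noteq> 2" using 2 by (auto simp: numeral_eq_enat)
    ultimately show ?thesis using gather_chain[OF assms(1) 2(2,1,3) HOL.refl HOL.refl] 2 uS braid by metis
  qed
qed

end

section \<open>Braid-free words are reduced and fully commutative\<close>

context coxeter
begin

lemma wp_commutation_equiv:
  assumes "commutation_equiv m u v" "u \<in> lists S"
  shows "wp u = wp v"
  using assms(1) unfolding commutation_equiv_def
proof (induction rule: rtranclp_induct)
  case (step v x)
  have v: "v \<in> lists S"
    using step(1) assms(2) commutation_equiv_in_lists[of m u v S] by (simp add: commutation_equiv_def)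
  from step(2) have "wp v = wp x"
  proof cases
    case (1 s t p q)
    then have st: "s \<in> S" "t \<in> S" "p \<in> lists S" "q \<in> lists S" using v by auto
    have "wp [s, t] = wp [t, s]"
      using wp_braid[of s t 2] st 1 by (simp add: numeral_eq_enat numeral_2_eq_2)
    moreover have "wp v = wp p \<otimes> wp [s, t] \<otimes> wp q" "wp x = wp p \<otimes> wp [t, s] \<otimes> wp q"
      using st 1 by (simp_all add: m_assoc S_carrier)
    ultimately show ?thesis by simp
  qed
  with step show ?case by simp
qed simp

lemma reduced_commutation_equiv:
  assumes "commutation_equiv m u v" "reduced u"
  shows "reduced v"
proof (rule reduced_eq_length[OF assms(2)])
  have u: "u \<in> lists S" using assms by (simp add: reduced_def)
  then show "v \<in> lists S" "wp v = wp u" "length v \<le> length u"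
    using commutation_equiv_in_lists[OF assms(1)] wp_commutation_equiv[OF assms(1)]
      commutation_equiv_length[OF assms(1)] by auto
qed

text \<open>The exchange condition puts \<open>b\<close> in front and deletes one letter. If that
  letter belonged to the alternating prefix, \<open>b\<close> would equal a palindrome in
  \<open>a\<close> and \<open>b\<close>, giving \<open>(ba)^(i+1) = 1\<close> with
  \<open>i + 1\<close> below the order. So the prefix survives and grows by one.\<close>

lemma extend_alternating_prefix:
  assumes r: "reduced (alt_word a b j @ x)" and ab: "a \<in> S" "b \<in> S" "a \<noteq> b"
    and j: "enat j < m a b" and desc: "refl_parity W (alt_word a b j @ x) b"
  obtains x' where "reduced (alt_word b a (Suc j) @ x')"
    "wp (alt_word b a (Suc j) @ x') = wp (alt_word a b j @ x)"
proof -
  obtain p c q where *: "alt_word a b j @ x = p @ c # q" "b = wp (p @ c # rev p)"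
    "reduced (b # p @ q)" "wp (b # p @ q) = wp (alt_word a b j @ x)"
    using exchange[OF r ab(2) desc] by metis
  show ?thesis
  proof (cases "length p < j")
    case True
    define i where "i = length p"
    have "alt_word a b j = alt_word a b i @ (if even i then alt_word a b (j - i) else alt_word b a (j - i))"
      using alt_word_add[of a b i "j - i"] True by (simp add: i_def)
    moreover obtain l where "j - i = Suc l" using True by (metis Suc_diff_Suc i_def)
    ultimately have "alt_word a b j = alt_word a b i @ (if even i then a else b) #
        (if even i then alt_word b a l else alt_word a b l)" by simp
    with *(1) have "p = alt_word a b i" "c = (if even i then a else b)"
      by (auto simp: i_def append_eq_append_conv)
    then have "b = wp (alt_word a b (2 * i + 1))"
      using *(2) alt_word_palindrome[of a b i] by simp
    moreover have "b \<otimes> b = \<one>" using gen_square ab by simp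
    ultimately have "wp (b # alt_word a b (2 * i + 1)) = \<one>" by simp
    moreover have "b # alt_word a b (2 * i + 1) = alt_word b a (2 * Suc i)" by simp
    ultimately have "wp (alt_word b a (2 * Suc i)) = \<one>" by (simp only:)
    moreover have "enat (Suc i) < m b a"
      using True j m_sym[OF ab(1,2)] by (metis Suc_leI enat_ord_simps(1) i_def order_le_less_trans)
    ultimately show ?thesis
      using pair_power_ne_one[OF ab(2,1) ab(3)[symmetric] zero_less_Suc] by blast
  next
    case False
    have "take j (p @ c # q) = alt_word a b j" unfolding *(1)[symmetric] by simp
    with False have "take j p = alt_word a b j" by simp
    then have p: "p = alt_word a b j @ drop j p" by (metis append_take_drop_id)
    have eq: "b # p @ q = alt_word b a (Suc j) @ drop j p @ q" by (subst p) simp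
    show ?thesis
      by (rule that[of "drop j p @ q"]) (use *(3,4) eq in simp_all)
  qed
qed

text \<open>Matsumoto's argument: a braid-free expression and another reduced expression that start with
  different letters \<open>s\<close>, \<open>t\<close> are both commutation equivalent to expressions starting with the
  alternating words of length \<open>m s t\<close>, so \<open>m s t = 2\<close>.\<close>
lemma good_word_reduced:
  assumes "u \<in> lists S" "good_word m u"
  shows "reduced u \<and> (\<forall>v. reduced v \<longrightarrow> wp v = wp u \<longrightarrow> commutation_equiv m u v)"
  using assms
proof (induction "length u" arbitrary: u)
  case 0
  have "reduced []" by (simp add: reduced_def)
  moreover have "v = []" if "reduced v" "wp v = wp []" for v
    using reduced_length_eq[OF that(1) \<open>reduced []\<close> that(2)] by simp
  moreover have "u = []" using 0 by simp
  ultimately show ?case using commutation_equiv_refl by metis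
next
  case (Suc n)
  then obtain s u' where u: "u = s # u'" by (cases u) auto
  have l: "s \<in> S" "u' \<in> lists S" "length u' = n" using Suc.prems Suc.hyps u by auto
  have IH: "reduced y \<and> (\<forall>v. reduced v \<longrightarrow> wp v = wp y \<longrightarrow> commutation_equiv m y v)"
    if "y \<in> lists S" "length y = n" "good_word m y" for y
    using Suc.hyps(1)[of y] that by simp
  have tail: "good_word m y" if "good_word m (a # y)" for a y
    using good_word_factor[of m "[a]" y "[]"] that by simp
  have u': "reduced u'" "\<And>v. reduced v \<Longrightarrow> wp v = wp u' \<Longrightarrow> commutation_equiv m u' v"
    using IH[OF l(2,3) tail[OF Suc.prems(2)[unfolded u]]] by auto
  \<comment> \<open>Otherwise exchange gives a reduced expression of \<open>wp u'\<close> beginning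
    with \<open>s\<close>. By induction commutations lead to it from \<open>u'\<close>, which
    exposes a square in \<open>u\<close>.\<close>
  have red: "reduced u"
  proof (rule ccontr)
    assume "\<not> reduced u"
    then have "refl_parity W u' s" using not_reduced_Cons u u'(1) l by simp
    then obtain p c q where *: "reduced (s # p @ q)" "wp (s # p @ q) = wp u'"
      using exchange[OF u'(1) l(1)] by metis
    then have "commutation_equiv m u (s # s # p @ q)"
      unfolding u using u'(2) by (blast intro: commutation_equiv_Cons)
    then have "good_word m (s # s # p @ q)"
      using good_word_equiv Suc.prems by blast
    then show False using not_good_word_square[of m "[]" s "p @ q"] by simp
  qed
  have same: "commutation_equiv m y v"
    if y: "y \<in> lists S" "length y = Suc n" "good_word m y" and v: "reduced v" "wp v = wp y"
      and hd: "y = a # y'" "v = a # v'" for y v a y' v'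
  proof -
    have l': "a \<in> S" "y' \<in> lists S" "v' \<in> lists S" using y hd reduced_in_lists[OF v(1)] by auto
    have "a \<otimes> wp v' = a \<otimes> wp y'" using v hd by simp
    then have "wp v' = wp y'" using l' by (simp add: S_carrier)
    moreover have "reduced v'" using v hd reduced_tail by blast
    ultimately have "commutation_equiv m y' v'"
      using IH[of y'] l' y hd tail by auto
    then show ?thesis unfolding hd by (rule commutation_equiv_Cons)
  qed
  have "commutation_equiv m u v" if v: "reduced v" "wp v = wp u" for v
  proof -
    have "length v = Suc n" using reduced_length_eq[OF v(1) red v(2)] Suc.hyps by simp
    then obtain t v' where vt: "v = t # v'" by (cases v) auto
    have t: "t \<in> S" "v' \<in> lists S" using reduced_in_lists[OF v(1)] vt by auto
    show ?thesis
    proof (cases "t = s")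
      case True
      then show ?thesis using same[OF Suc.prems(1) _ Suc.prems(2) v] u vt Suc.hyps by simp
    next
      case False
      \<comment> \<open>Both letters are left descents of the common element, and parity transfers
        this to each of its reduced expressions.\<close>
      have desc: "refl_parity W r s" "refl_parity W r t" if "reduced r" "wp r = wp u" for r
        using refl_parity_hd[OF red[unfolded u]] refl_parity_hd[OF v(1)[unfolded vt]] u vt
          refl_parity_eq[of r u s] refl_parity_eq[of r v t] that v red S_carrier l t
          reduced_in_lists by auto
      let ?E = "\<lambda>a b j. \<exists>x. reduced (alt_word a b j @ x) \<and> wp (alt_word a b j @ x) = wp u"
      have ext: "?E b a (Suc j)" if "?E a b j" "{a, b} = {s, t}" "enat j < m s t" for a b j
      proof -
        obtain x where x: "reduced (alt_word a b j @ x)" "wp (alt_word a b j @ x) = wp u"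
          using \<open>?E a b j\<close> by blast
        have ab: "a \<in> S" "b \<in> S" "a \<noteq> b" "enat j < m a b"
          using that False l t m_sym[of s t] by (auto simp: doubleton_eq_iff)
        have "refl_parity W (alt_word a b j @ x) b"
          using desc[OF x] that(2) by (auto simp: doubleton_eq_iff)
        from extend_alternating_prefix[OF x(1) ab this] x(2) show ?thesis by metis
      qed
      \<comment> \<open>Each step puts the other letter in front, so which letter leads depends on
        parity; the disjunction spares tracking it.\<close>
      have ex: "?E s t (Suc j) \<or> ?E t s (Suc j)" if "enat (Suc j) \<le> m s t" for j
        using that
      proof (induction j)
        case 0
        have "reduced (alt_word s t (Suc 0) @ u')" using red u by simp
        then show ?case using u by auto
      next
        case (Suc j)
        have "enat (Suc j) < enat (Suc (Suc j))" by simp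
        also have "\<dots> \<le> m s t" by fact
        finally have lt: "enat (Suc j) < m s t" .
        then have "?E s t (Suc j) \<or> ?E t s (Suc j)" by (intro Suc.IH) simp
        then show ?case using ext[of s t "Suc j"] ext[of t s "Suc j"] lt by auto
      qed
      show ?thesis
      proof (cases "m s t")
        \<comment> \<open>The alternating prefix would have \<open>n + 2\<close> letters, more than
          the common length \<open>n + 1\<close>.\<close>
        case infinity
        then obtain a b x where "reduced (alt_word a b (Suc (Suc n)) @ x)"
          "wp (alt_word a b (Suc (Suc n)) @ x) = wp u"
          using ex[of "Suc n"] by auto
        from reduced_length_eq[OF this(1) red this(2)] Suc.hyps show ?thesis by simp
      next
        case (enat k)
        have "k \<noteq> 0" "k \<noteq> 1"
          using m_ge_1[of s t] m_eq_1_iff[of s t] l t enat False by (auto simp: one_enat_def)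
        then obtain k' where k: "k = Suc k'" "k' \<ge> 1" by (cases k) auto
        have braid: "?E b a k" if "?E a b k" "{a, b} = {s, t}" for a b
        proof -
          obtain x where x: "reduced (alt_word a b k @ x)" "wp (alt_word a b k @ x) = wp u"
            using \<open>?E a b k\<close> by blast
          have ab: "a \<in> S" "b \<in> S" "m a b = enat k"
            using that(2) l t m_sym[of s t] enat by (auto simp: doubleton_eq_iff)
          have x': "x \<in> lists S" using reduced_in_lists[OF x(1)] by simp
          have al: "alt_word a b k \<in> lists S" "alt_word b a k \<in> lists S"
            by (rule alt_word_in_lists; fact)+
          have eq: "wp (alt_word b a k @ x) = wp (alt_word a b k @ x)"
            using wp_braid[OF ab] x' al by simp
          have "reduced (alt_word b a k @ x)"
            by (rule reduced_eq_length[OF x(1) _ eq]) (use x' al in simp_all)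
          with eq x(2) show ?thesis by auto
        qed
        have "?E s t k \<or> ?E t s k" using ex[of k'] k enat by simp
        then have "?E s t k" "?E t s k" using braid[of s t] braid[of t s] by (auto simp: insert_commute)
        then obtain x where x: "reduced (alt_word s t k @ x)" "wp (alt_word s t k @ x) = wp u" by blast
        \<comment> \<open>This expression starts with \<open>s\<close> like \<open>u\<close>, so
          induction applies to the tails. If \<open>k\<close> were at least 3, a word equivalent to
          \<open>u\<close> would contain a braid.\<close>
        have ux: "commutation_equiv m u (alt_word s t k @ x)"
          using same[OF Suc.prems(1) _ Suc.prems(2) x, of s u' "alt_word t s k' @ x"] u k Suc.hyps by simp
        have gx: "good_word m (alt_word s t k @ x)" using good_word_equiv[OF ux] Suc.prems by simp
        have "\<not> 3 \<le> k" using not_good_word_braid[of m s t k "[]" x] enat gx by auto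
        then have "k = 2" using k by simp
        have xS: "x \<in> lists S" using reduced_in_lists[OF x(1)] by simp
        have st: "alt_word s t k @ x = s # t # x" using \<open>k = 2\<close> by (simp add: numeral_2_eq_2)
        have "commutation_equiv m (s # t # x) (t # s # x)"
          using commutation_equiv_swap[of m s t "[]" x] enat \<open>k = 2\<close> by (simp add: numeral_eq_enat)
        with ux st have ut: "commutation_equiv m u (t # s # x)"
          by (auto intro: commutation_equiv_trans)
        have "good_word m (t # s # x)" using good_word_equiv[OF ut] Suc.prems by simp
        moreover have "wp v = wp (t # s # x)" using wp_commutation_equiv[OF ut] Suc.prems v by simp
        moreover have "length (t # s # x) = Suc n" using commutation_equiv_length[OF ut] Suc.hyps by simp
        ultimately have "commutation_equiv m (t # s # x) v"
          using same[of "t # s # x" v t "s # x" v'] v(1) vt l t xS by simp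
        with ut show ?thesis by (rule commutation_equiv_trans)
      qed
    qed
  qed
  with red show ?case by blast
qed

lemma good_word_FC:
  assumes "u \<in> lists S" "good_word m u"
  shows "wp u \<in> FC W S m"
proof -
  have "commutation_equiv m r r'" if "reduced r" "wp r = wp u" "reduced r'" "wp r' = wp u" for r r'
  proof -
    have "commutation_equiv m r u"
      using good_word_reduced[OF assms] that assms by (blast intro: commutation_equiv_sym)
    moreover have "commutation_equiv m u r'" using good_word_reduced[OF assms] that by blast
    ultimately show ?thesis by (rule commutation_equiv_trans)
  qed
  then show ?thesis using assms by (simp add: FC_def reduced_expression_iff)
qed

text \<open>A square would allow shortening. A braid could be replaced by its mirror, and full
  commutativity would make the two words commutation equivalent; but their projections to
  \<open>{a, b}\<close> are invariant and differ.\<close>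

lemma FC_good_word:
  assumes "reduced r" "wp r \<in> FC W S m"
  shows "good_word m r"
proof (rule ccontr)
  assume "\<not> good_word m r"
  have r: "r \<in> lists S" using assms by (simp add: reduced_def)
  from r \<open>\<not> good_word m r\<close> show False
  proof (cases rule: not_good_word_cases)
    case (square x a y)
    have red: "reduced (x @ a # a # y)" by (rule reduced_commutation_equiv[OF square assms(1)])
    then have l: "x \<in> lists S" "a \<in> S" "y \<in> lists S" by (auto dest: reduced_in_lists)
    then have "wp (x @ y) = wp (x @ a # a # y)" by (simp add: gen_cancel)
    then have "length (x @ a # a # y) \<le> length (x @ y)" using l by (intro reduced_le[OF red]) simp_all
    then show False by simp
  next
    case (braid x a b k y)
    have red: "reduced (x @ alt_word a b k @ y)"
      by (rule reduced_commutation_equiv[OF braid(1) assms(1)])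
    then have l: "x \<in> lists S" "y \<in> lists S" by (auto dest: reduced_in_lists)
    have al: "alt_word a b k \<in> lists S" "alt_word b a k \<in> lists S"
      by (rule alt_word_in_lists; fact)+
    have eq: "wp (x @ alt_word b a k @ y) = wp (x @ alt_word a b k @ y)"
      using l al wp_braid[OF braid(2-4)] by simp
    moreover have "reduced (x @ alt_word b a k @ y)"
      by (rule reduced_eq_length[OF red _ eq]) (use l al in auto)
    ultimately have "commutation_equiv m r (x @ alt_word b a k @ y)"
      using assms wp_commutation_equiv[OF braid(1) r]
      by (simp add: FC_def reduced_expression_iff)
    then have rb: "commutation_equiv m (x @ alt_word a b k @ y) (x @ alt_word b a k @ y)"
      by (rule commutation_equiv_trans[OF commutation_equiv_sym[OF braid(1) r]])
    let ?P = "\<lambda>c. c = a \<or> c = b"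
    have "enat k \<noteq> 2" using braid(5) by (simp add: numeral_eq_enat)
    then have "m c d \<noteq> 2" if "?P c" "?P d" for c d
      using that braid(4) m_self_ne_2[OF braid(2)] m_self_ne_2[OF braid(3)] m_sym[OF braid(2,3)]
      by metis
    then have "filter ?P (x @ alt_word a b k @ y) = filter ?P (x @ alt_word b a k @ y)"
      by (rule commutation_equiv_filter[OF rb])
    moreover have "filter ?P (alt_word c d n) = alt_word c d n" if "{c, d} = {a, b}" for c d n
      using set_alt_word[of c d n] that by (intro filter_True) auto
    ultimately have "alt_word a b k = alt_word b a k" by (simp add: insert_commute)
    then have "a = b" using braid(5) by (cases k) auto
    with braid m_eq_1_iff[of a b] show False by (simp add: one_enat_def)
  qed
qed

lemma CFC_good_rotation:
  assumes "w \<in> CFC W S m" "reduced r" "wp r = w"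
  shows "good_word m (rotate j r)"
proof -
  obtain v where "v \<in> FC W S m" "reduced (rotate j r)" "wp (rotate j r) = v"
    using assms by (auto simp: CFC_def reduced_expression_iff)
  then show ?thesis using FC_good_word by blast
qed

end

section \<open>Powers of a word\<close>

lemma length_power_word: "length (concat (replicate K r)) = K * length r"
  by (induction K) auto

lemma power_word_in_lists: "r \<in> lists S \<Longrightarrow> concat (replicate K r) \<in> lists S"
  by (induction K) auto

lemma nth_power_word: "i < K * length r \<Longrightarrow> concat (replicate K r) ! i = r ! (i mod length r)"
proof (induction K arbitrary: i)
  case (Suc K)
  then show ?case
    by (auto simp: nth_append le_mod_geq)
qed simp

definition power_good :: "('a \<Rightarrow> 'a \<Rightarrow> enat) \<Rightarrow> 'a list \<Rightarrow> bool" where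
  "power_good m r \<longleftrightarrow> (\<forall>N. braid_free m (\<lambda>i. r ! (i mod length r)) N)"

lemma power_good_good_word: "power_good m r \<Longrightarrow> good_word m (concat (replicate K r))"
  unfolding power_good_def length_power_word
  by (rule braid_free_cong[of _ "\<lambda>i. r ! (i mod length r)"]) (auto simp: nth_power_word)

context coxeter
begin

text \<open>A reduced expression \<open>r'\<close> of the power is commutation equivalent to it, so
  \<open>r' @ r'\<close> is equivalent to the doubled power and is again good. Every rotation of
  \<open>r'\<close> is a factor of \<open>r' @ r'\<close>.\<close>

lemma power_good_CFC:
  assumes "r \<in> lists S" "power_good m r"
  shows "wp (concat (replicate K r)) \<in> CFC W S m"
proof -
  let ?u = "concat (replicate K r)"
  have u: "?u \<in> lists S" using assms(1) by (rule power_word_in_lists)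
  have "rotate j r' \<in> lists S \<and> good_word m (rotate j r')" if r': "reduced r'" "wp r' = wp ?u" for r' j
  proof -
    have l: "r' \<in> lists S" using r' by (simp add: reduced_def)
    have "commutation_equiv m ?u r'"
      using good_word_reduced[OF u power_good_good_word[OF assms(2)]] r' by blast
    then have "commutation_equiv m (?u @ ?u) (r' @ r')" by (rule commutation_equiv_append) fact
    moreover have "?u @ ?u = concat (replicate (K + K) r)" by (simp add: replicate_add)
    ultimately have g: "good_word m (r' @ r')"
      using good_word_equiv power_good_good_word[OF assms(2)] u by (metis append_in_lists_conv)
    define d where "d = j mod length r'"
    have "r' @ r' = take d r' @ rotate j r' @ drop d r'"
      unfolding d_def by (simp add: rotate_drop_take)
    then have "good_word m (rotate j r')" using good_word_factor g by metis
    then show ?thesis using l by (simp add: in_lists_conv_set)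
  qed
  then have "\<exists>v\<in>FC W S m. reduced_expression W S (rotate j r') v"
    if "reduced_expression W S r' (wp ?u)" for r' j
    using that good_word_FC good_word_reduced by (auto simp: reduced_expression_iff)
  then show ?thesis using u by (simp add: CFC_def)
qed

text \<open>The powers of \<open>r\<close> are reduced, so they are told apart by their lengths
  \<open>K * length r\<close>.\<close>

lemma CFC_finite_no_power_good:
  assumes "CFC_finite W S m" "r \<in> lists S" "power_good m r"
  shows "r = []"
proof (rule ccontr)
  assume "r \<noteq> []"
  let ?v = "\<lambda>K. wp (concat (replicate K r))"
  have red: "reduced (concat (replicate K r))" for K
    using good_word_reduced[OF power_word_in_lists[OF assms(2)] power_good_good_word[OF assms(3)]]
    by blast
  have "inj ?v"
  proof (rule injI)
    fix K L assume "?v K = ?v L"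
    then have "length (concat (replicate K r)) = length (concat (replicate L r))"
      by (rule reduced_length_eq[OF red red])
    then show "K = L" using \<open>r \<noteq> []\<close> by (simp add: length_power_word)
  qed
  moreover have "range ?v \<subseteq> CFC W S m" using power_good_CFC assms by blast
  ultimately have "infinite (CFC W S m)"
    using range_inj_infinite finite_subset by blast
  with assms(1) show False by (simp add: CFC_finite_def)
qed

end

section \<open>Bands\<close>

text \<open>Connectedness in terms of cuts: this is the form in which an edge leaving a given set is
  produced and in which a leaf can be removed.\<close>

definition cut_connected :: "'a set \<Rightarrow> ('a \<Rightarrow> 'a \<Rightarrow> enat) \<Rightarrow> bool" where
  "cut_connected S m \<longleftrightarrow> (\<forall>A. A \<subset> S \<longrightarrow> A \<noteq> {} \<longrightarrow> (\<exists>x\<in>A. \<exists>y\<in>S - A. m x y \<noteq> 2))"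

lemma cut_connectedE:
  assumes "cut_connected S m" "A \<subset> S" "A \<noteq> {}"
  obtains x y where "x \<in> A" "y \<in> S" "y \<notin> A" "m x y \<noteq> 2"
  using assms unfolding cut_connected_def by blast

lemma count_list_rotate: "count_list (rotate j r) x = count_list r x"
proof -
  have "count_list r x = count_list (take (j mod length r) r @ drop (j mod length r) r) x" by simp
  then show ?thesis unfolding rotate_drop_take count_list_append by simp
qed

lemma filter_eq_appendE:
  assumes "filter P r = u @ v"
  obtains p q where "r = p @ q" "filter P p = u" "filter P q = v"
  using assms
proof (induction r arbitrary: u thesis)
  case Nil
  then show ?case by simp
next
  case (Cons x r)
  show ?case
  proof (cases "P x \<and> u \<noteq> []")
    case True
    then obtain u' where u': "u = x # u'" "filter P r = u' @ v"
      using Cons.prems(2) by (cases u) auto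
    from Cons.IH[OF _ u'(2)] obtain p q where "r = p @ q" "filter P p = u'" "filter P q = v" by blast
    then show ?thesis using Cons.prems(1)[of "x # p" q] u' True by simp
  next
    case False
    show ?thesis
    proof (cases "u = []")
      case True
      then show ?thesis using Cons.prems by (intro Cons.prems(1)[of "[]" "x # r"]) auto
    next
      case u: False
      then have "filter P r = u @ v" using False Cons.prems(2) by auto
      from Cons.IH[OF _ this] obtain p q where "r = p @ q" "filter P p = u" "filter P q = v" by blast
      then show ?thesis using Cons.prems(1)[of "x # p" q] u False by simp
    qed
  qed
qed

text \<open>Rotations of a word with letters deleted come from rotations of the full word; this is
  how bands of the shorter word are lifted.\<close>

lemma rotate_filter:
  obtains j' where "rotate j (filter P r) = filter P (rotate j' r)"
proof -
  define d where "d = j mod length (filter P r)"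
  have "filter P r = take d (filter P r) @ drop d (filter P r)" by simp
  then obtain p q where pq: "r = p @ q" "filter P p = take d (filter P r)"
    "filter P q = drop d (filter P r)"
    by (rule filter_eq_appendE)
  have "rotate j (filter P r) = filter P (q @ p)"
    unfolding filter_append pq(2,3) d_def by (rule rotate_drop_take)
  also have "q @ p = rotate (length p) r" unfolding pq(1) by (simp add: rotate_append)
  finally show ?thesis by (rule that)
qed

context coxeter_mat
begin

lemma irreducible_cut_connected:
  assumes "coxeter_irreducible S m"
  shows "cut_connected S m"
  unfolding cut_connected_def
proof (intro allI impI)
  fix A assume A: "A \<subset> S" "A \<noteq> {}"
  then obtain a c where ac: "a \<in> A" "c \<in> S" "c \<notin> A" by blast
  then have "(a, c) \<in> (coxeter_edges S m)\<^sup>*"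
    using assms A by (auto simp: coxeter_irreducible_def)
  then have "c \<in> A \<or> (\<exists>x\<in>A. \<exists>y\<in>S - A. m x y \<noteq> 2)"
  proof (induction rule: rtrancl_induct)
    case base
    show ?case using ac by simp
  next
    case (step x y)
    then have "y \<in> S" "m x y \<noteq> 2" by (auto simp: coxeter_edges_def m_ge_3_iff)
    with step show ?case by blast
  qed
  with ac show "\<exists>x\<in>A. \<exists>y\<in>S - A. m x y \<noteq> 2" by blast
qed

lemma band_exists:
  assumes fin: "finite S" and conn: "cut_connected S m" and card: "3 \<le> card S"
    and r: "r \<in> lists S" "set r = S"
    and rot: "\<And>j. good_word m (rotate j r)" and np: "\<not> power_good m r"
  obtains a b k j x y where "a \<in> S" "b \<in> S" "m a b = enat k" "odd k" "3 \<le> k"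
    "\<And>c. c \<in> S \<Longrightarrow> c \<noteq> a \<Longrightarrow> m a c \<noteq> 2 \<Longrightarrow> c = b"
    "commutation_equiv m (rotate j r) (x @ alt_word b a (k - 1) @ y)"
    "a \<notin> set (x @ y)" "b \<notin> set (x @ y)"
proof -
  define n where "n = length r"
  define f where "f i = r ! (i mod n)" for i
  have "r \<noteq> []" using r(2) card by auto
  then have n: "n > 0" by (simp add: n_def)
  have per: "f (i + n) = f i" for i by (simp add: f_def)
  have fS: "f i \<in> S" for i using nth_in_lists[OF r(1)] n by (simp add: f_def n_def)
  have rot_nth: "rotate p r ! q = f (p + q)" if "q < n" for p q
    using that by (simp add: f_def n_def nth_rotate)
  have window: "braid_free m (\<lambda>q. f (p + q)) n" for p
  proof (rule braid_free_cong)
    show "braid_free m ((!) (rotate p r)) n" using rot[of p] by (simp add: n_def)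
  qed (simp add: rot_nth)
  have occ: "\<exists>q. p < q \<and> q < p + n \<and> f q = c" if c: "c \<in> S" "c \<noteq> f p" for c p
  proof -
    have "c \<in> set (rotate p r)" using c r by simp
    then obtain q where q: "q < n" "rotate p r ! q = c"
      unfolding in_set_conv_nth length_rotate n_def by blast
    then have "f (p + q) = c" using rot_nth by simp
    moreover from this have "q \<noteq> 0" using c(2) by (cases "q = 0") auto
    ultimately show ?thesis using q by (intro exI[of _ "p + q"]) auto
  qed
  obtain N where N: "\<not> braid_free m f N" using np unfolding power_good_def f_def n_def by blast
  \<comment> \<open>Shorter distances are covered by a window of one period. A distance of at least
    one period contains every generator, and by connectedness one of them does not commute with
    \<open>f p\<close>.\<close>
  have norep: "\<exists>x>p. x < q \<and> m (f x) (f p) \<noteq> 2" if pq: "p < q" "f p = f q" for p q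
  proof (cases "q < p + n")
    case True
    then have "0 < q - p" "q - p < n" "f (p + 0) = f (p + (q - p))" using pq by auto
    then obtain x where "0 < x" "x < q - p" "m (f (p + x)) (f (p + 0)) \<noteq> 2"
      using window[of p] unfolding braid_free_def by blast
    then show ?thesis by (intro exI[of _ "p + x"]) auto
  next
    case False
    have "{f p} \<noteq> S"
    proof
      assume "{f p} = S"
      then have "card S = 1" by (metis card_1_singleton_iff One_nat_def)
      with card show False by simp
    qed
    then have "{f p} \<subset> S" using fS by blast
    from cut_connectedE[OF conn this] obtain y where y: "y \<in> S" "y \<noteq> f p" "m (f p) y \<noteq> 2"
      by (metis insert_not_empty singletonD singletonI)
    from occ[OF y(1,2)] obtain x where "p < x" "x < p + n" "f x = y" by blast
    then show ?thesis using y False m_sym[OF fS y(1)] by (intro exI[of _ x]) auto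
  qed
  then obtain i k where ch: "3 \<le> k" "tight_chain m f i k" "m (f (i 0)) (f (i 1)) = enat k"
    using N unfolding braid_free_def by blast
  define a where "a = f (i 0)"
  define b where "b = f (i 1)"
  have abS: "a \<in> S" "b \<in> S" "m a b = enat k" using fS ch by (simp_all add: a_def b_def)
  have "enat k \<noteq> 2" "enat k \<noteq> 1" using ch(1) by (auto simp: numeral_eq_enat one_enat_def)
  then have ab: "a \<noteq> b" "m a b \<noteq> 2" "m b a \<noteq> 2" "m a a \<noteq> 2" "m b b \<noteq> 2"
    using abS m_eq_1_iff[OF abS(1,2)] m_sym[OF abS(1,2)] m_self_ne_2 by auto
  note letter = tight_chain_letter[OF ch(2), folded a_def b_def]
  note gap = tight_chain_gap[OF ch(2)]
  note mono = tight_chain_less[OF ch(2)]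
  have last: "i j \<le> i (k - 1)" if "j < k" for j
    using tight_chain_le[OF ch(2), of j "k - 1"] that by linarith
  \<comment> \<open>A chain spanning less than a period would lie in one rotation of
    \<open>r\<close>, and all rotations are good.\<close>
  have long: "i 0 + n \<le> i (k - 1)"
  proof (rule ccontr)
    assume "\<not> i 0 + n \<le> i (k - 1)"
    moreover have "i 0 < i (k - 1)" using mono[of 0 "k - 1"] ch(1) by simp
    ultimately have "i (k - 1) - i 0 < n" by simp
    moreover have "tight_chain m (\<lambda>q. f (i 0 + q)) (\<lambda>j. i j - i 0) k"
      using ch(1) by (intro tight_chain_shift[OF ch(2)]) auto
    moreover have "i 0 < i 1" using mono[of 0 1] ch(1) by simp
    ultimately show False using braid_free_chain[OF window ch(1)] ch(3) by fastforce
  qed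
  \<comment> \<open>The letters \<open>a\<close> and \<open>b\<close> commute with neither
    \<open>a\<close> nor \<open>b\<close>, so a single gap around \<open>q\<close> already forces
    \<open>q\<close> onto the chain.\<close>
  have pos: "\<exists>j<k. q = i j" if q: "i 0 \<le> q" "q \<le> i (k - 1)" "f q = a \<or> f q = b" for q
  proof -
    obtain j where j: "j < k" "i j \<le> q" "Suc j < k \<Longrightarrow> q < i (Suc j)"
      using tight_chain_interval[OF ch(2) q(1,2)] ch(1) by (metis less_le_trans zero_less_numeral)
    have "q = i j"
    proof (rule ccontr)
      assume ne: "q \<noteq> i j"
      then have lt: "i j < q" using j by simp
      then have sj: "Suc j < k" using q(2) j(1) by (cases "j = k - 1") auto
      show False
      proof (cases "j + 2 < k")
        case True
        then have "q < i (j + 2)" "q \<noteq> i (Suc j)" using j(3)[OF sj] mono[of "Suc j" "j + 2"] by auto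
        with gap[OF True lt] letter[of j] ab q(3) j(1) show False by (auto split: if_splits)
      next
        case False
        then obtain l where l: "j = Suc l" using ch(1) sj by (cases j) auto
        have "m (f q) (f (i l)) = 2"
          using gap[of l q] j(3)[OF sj] lt mono[of l j] l sj ne by simp
        with letter[of l] ab q(3) l j(1) show False by (auto split: if_splits)
      qed
    qed
    with j show ?thesis by blast
  qed
  \<comment> \<open>Here \<open>e = 0\<close> serves the neighbours of \<open>a\<close> and
    \<open>e = 1\<close> those of \<open>b\<close>. A neighbour \<open>c\<close> occurs within the
    period from \<open>i e\<close> to \<open>i (e + l)\<close>; choosing a gap whose index has the
    parity of \<open>e\<close> puts it between two copies of \<open>f (i e)\<close>.\<close>
  have nbr: "c = a \<or> c = b"
    if e: "e \<le> 1" "even l" "e + l < k" "i (e + l) = i e + n" and c: "c \<in> S" "m c (f (i e)) \<noteq> 2"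
    for e l c
  proof (rule ccontr)
    assume nc: "\<not> (c = a \<or> c = b)"
    then have "c \<noteq> f (i e)" using letter[of e] e by auto
    from occ[OF c(1) this] obtain q where q: "i e < q" "q < i e + n" "f q = c" by blast
    have le: "e < k" "0 < l" using e(3,4) n by (auto intro: gr0I)
    have "i 0 \<le> q" "q \<le> i (k - 1)"
      using q tight_chain_le[OF ch(2), of 0 e] last[OF e(3)] e(4) le by linarith+
    then obtain j where j: "j < k" "i j \<le> q" "Suc j < k \<Longrightarrow> q < i (Suc j)"
      using tight_chain_interval[OF ch(2)] ch(1) by (metis less_le_trans zero_less_numeral)
    have ne: "q \<noteq> i j'" if "j' < k" for j'
    proof
      assume "q = i j'"
      then have "c = a \<or> c = b" using q(3) letter[OF that] by (cases "even j'") auto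
      with nc show False by simp
    qed
    have lt: "i j < q" using ne j by (metis le_neq_implies_less)
    have jl: "j < e + l"
      using tight_chain_le[OF ch(2), of "e + l" j] j(1,2) q(2) e(4) by force
    have je: "e \<le> j" using j(3) tight_chain_le[OF ch(2), of "Suc j" e] q(1) le by force
    have qs: "q < i (Suc j)" using j(3) jl e(3) by simp
    have "\<exists>j'. i j' < q \<and> q < i (j' + 2) \<and> j' + 2 \<le> e + l \<and> (even j' \<longleftrightarrow> even e)"
    proof (cases "even j \<longleftrightarrow> even e")
      case True
      then have "j + 2 \<le> e + l" using jl e(2) by presburger
      moreover have "q < i (j + 2)" using qs mono[of "Suc j" "j + 2"] calculation e(3) by simp
      ultimately show ?thesis using lt True by blast
    next
      case False
      then have "e < j" using je by (cases "e = j") auto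
      then obtain l' where l': "j = Suc l'" by (cases j) auto
      have "i l' < q" using mono[of l' j] lt l' j(1) by simp
      then show ?thesis using qs False jl l' by (intro exI[of _ l']) auto
    qed
    then obtain j' where j': "i j' < q" "q < i (j' + 2)" "j' + 2 \<le> e + l" "even j' \<longleftrightarrow> even e" by blast
    then have "m (f q) (f (i j')) = 2" using gap[of j' q] ne[of "Suc j'"] e(3) by simp
    moreover have "f (i j') = f (i e)" using letter[of j'] letter[of e] j' e(3) by simp
    ultimately show False using q(3) c(2) by simp
  qed
  have "f (i 0 + n) = a" using per by (simp add: a_def)
  then obtain l where l: "l < k" "i 0 + n = i l" using pos[of "i 0 + n"] long by auto
  have lodd: "even l" using letter[OF l(1)] \<open>f (i 0 + n) = a\<close> l(2) ab(1) by (auto split: if_splits)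
  have l0: "0 < l" using l n by (auto intro: gr0I)
  have leaf: "c = b" if "c \<in> S" "c \<noteq> a" "m a c \<noteq> 2" for c
    using nbr[of 0 l c] that l lodd m_sym[OF abS(1) that(1)] by (simp add: a_def[symmetric])
  \<comment> \<open>If the chain extended beyond the translate of \<open>i 0\<close>, it would also
    contain the translate of \<open>i 1\<close>. Then neither \<open>a\<close> nor \<open>b\<close>
    has a neighbour outside \<open>{a, b}\<close>, against connectedness with at least three
    generators.\<close>
  have lk: "l = k - 1"
  proof (rule ccontr)
    assume "l \<noteq> k - 1"
    then have lk: "Suc l < k" using l by simp
    have i1: "i 0 < i 1" "i l < i (Suc l)" using mono[of 0 1] mono[of l "Suc l"] ch(1) lk by auto
    \<comment> \<open>If the two positions differed, translating the earlier one forwards or the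
      later one backwards by a period would give a \<open>b\<close> strictly between successive
      chain positions.\<close>
    have eq: "i (1 + l) = i 1 + n"
    proof (rule ccontr)
      assume ne: "i (1 + l) \<noteq> i 1 + n"
      have fb: "f (i (Suc l)) = b" using letter[OF lk] lodd by simp
      show False
      proof (cases "i 1 + n < i (Suc l)")
        case True
        have "f (i 1 + n) = b" using per by (simp add: b_def)
        moreover have "i 1 + n \<le> i (k - 1)" using True last[OF lk] by simp
        ultimately obtain j where j: "j < k" "i 1 + n = i j" using pos[of "i 1 + n"] i1 by auto
        have "\<not> j \<le> l" using j l i1 tight_chain_le[OF ch(2), of j l] by auto
        moreover have "\<not> Suc l \<le> j" using j True tight_chain_le[OF ch(2), of "Suc l" j] by auto
        ultimately show False by simp
      next
        case False
        let ?q = "i (Suc l) - n"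
        have q: "i 0 < ?q" "?q < i 1" "?q + n = i (Suc l)" using False ne i1 l by auto
        then have "f ?q = b" using per[of ?q] fb by simp
        moreover have "?q \<le> i (k - 1)" using q last[of 1] ch(1) by linarith
        ultimately obtain j where j: "j < k" "?q = i j" using pos[of ?q] q(1) by auto
        have "j \<noteq> 0" using j q(1) by (cases "j = 0") simp_all
        then show False using j q tight_chain_le[OF ch(2), of 1 j] by simp
      qed
    qed
    have fb: "f (i (Suc 0)) = b" by (simp add: b_def)
    have nb: "c = a \<or> c = b" if "c \<in> S" "m b c \<noteq> 2" for c
      using nbr[of 1 l c] that lodd lk eq m_sym[OF abS(2) that(1)] by (simp add: fb)
    have "card {a, b} \<le> 2" by (simp add: card_insert_if)
    then have "{a, b} \<subset> S" using abS card by auto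
    then obtain x y where "x \<in> {a, b}" "y \<in> S" "y \<notin> {a, b}" "m x y \<noteq> 2"
      using cut_connectedE[OF conn] by (metis insert_not_empty)
    then show False using leaf nb by auto
  qed
  have k: "k = Suc l" using lk ch(1) by simp
  \<comment> \<open>One period and one extra letter: the chain fills \<open>u\<close> from its first
    letter \<open>a\<close> to the translate of that letter at the end.\<close>
  define u where "u = map f [i 0..<Suc (i 0 + n)]"
  have u_nth: "u ! q = f (i 0 + q)" if "q \<le> n" for q
    using that by (simp add: u_def del: upt_Suc)
  have u_len: "length u = Suc n" by (simp add: u_def)
  have u_Cons: "u = a # rotate (Suc (i 0)) r"
  proof (rule nth_equalityI)
    show "length u = length (a # rotate (Suc (i 0)) r)" by (simp add: u_len n_def)
    fix q assume q: "q < length u"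
    show "u ! q = (a # rotate (Suc (i 0)) r) ! q"
    proof (cases q)
      case 0
      then show ?thesis using u_nth[of 0] by (simp add: a_def)
    next
      case (Suc q')
      then show ?thesis using u_nth[of q] rot_nth[of q' "Suc (i 0)"] q by (simp add: u_len)
    qed
  qed
  have uS: "u \<in> lists S" unfolding u_def using fS by (auto simp: in_lists_conv_set)
  have chu: "tight_chain m ((!) u) (\<lambda>j. i j - i 0) k"
    by (rule tight_chain_shift[OF ch(2)]) (use u_nth l lk ch(1) in auto)
  have "i 0 < i 1" using mono[of 0 1] ch(1) by simp
  moreover have "i 1 \<le> i 0 + n" using tight_chain_le[OF ch(2), of 1 l] l l0 by simp
  ultimately have u1: "u ! (i 1 - i 0) = b" using u_nth[of "i 1 - i 0"] by (simp add: b_def)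
  have u0: "u ! (i 0 - i 0) = a" using u_nth[of 0] by (simp add: a_def)
  have len: "i (k - 1) - i 0 < length u" "Suc (i (k - 1) - i 0) = length u"
    using l lk u_len by (simp_all flip: lk)
  obtain x y where xy: "commutation_equiv m u (x @ alt_word a b k @ y)"
    "a \<notin> set (x @ y) \<and> b \<notin> set (x @ y)"
    using gather_chain[OF uS chu ch(1) len(1) u0 u1 ab(2)] len(2) by (metis diff_self_eq_0)
  \<comment> \<open>Removing the leading \<open>a\<close> of \<open>u\<close> leaves a rotation of
    \<open>r\<close>. As \<open>x\<close> is free of \<open>a\<close>, the same removal takes the
    first letter off the alternating word, which then starts with \<open>b\<close> and has
    \<open>k - 1\<close> letters.\<close>
  have band: "commutation_equiv m (rotate (Suc (i 0)) r) (x @ alt_word b a (k - 1) @ y)"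
    using commutation_equiv_remove1[OF xy(1), of a] xy(2) k by (simp add: u_Cons remove1_append)
  show ?thesis
    by (rule that[OF abS _ ch(1) leaf band]) (use lodd k xy(2) in auto)
qed

end

section \<open>Removing a leaf and its letter\<close>

lemma coxeter_matrix_subset: "coxeter_matrix S m \<Longrightarrow> T \<subseteq> S \<Longrightarrow> coxeter_matrix T m"
  unfolding coxeter_matrix_def by blast

context coxeter_mat
begin

text \<open>The leaf is put on the side of the cut that contains its only neighbour
  \<open>b\<close>; then no crossing edge involves the leaf.\<close>

lemma cut_connected_remove_leaf:
  assumes conn: "cut_connected S m" and ab: "a \<in> S"
    and leaf: "\<And>c. c \<in> S \<Longrightarrow> c \<noteq> a \<Longrightarrow> m a c \<noteq> 2 \<Longrightarrow> c = b"
  shows "cut_connected (S - {a}) m"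
  unfolding cut_connected_def
proof (intro allI impI)
  fix A assume A: "A \<subset> S - {a}" "A \<noteq> {}"
  show "\<exists>x\<in>A. \<exists>y\<in>S - {a} - A. m x y \<noteq> 2"
  proof (cases "b \<in> A")
    case True
    have "insert a A \<subset> S" using A ab by blast
    then obtain x y where xy: "x \<in> insert a A" "y \<in> S" "y \<notin> insert a A" "m x y \<noteq> 2"
      using cut_connectedE[OF conn] by (metis insert_not_empty)
    then have "x \<noteq> a" using leaf[of y] True by auto
    with xy show ?thesis by blast
  next
    case False
    have "A \<subset> S" using A by blast
    then obtain x y where xy: "x \<in> A" "y \<in> S" "y \<notin> A" "m x y \<noteq> 2"
      using cut_connectedE[OF conn] A(2) by metis
    have "x \<in> S" "x \<noteq> a" using xy A by auto
    then have "y \<noteq> a" using leaf[of x] m_sym[of x a] ab xy False by auto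
    with xy show ?thesis by blast
  qed
qed

text \<open>The single \<open>b\<close> lies on one side of the single \<open>a\<close>. On the
  other side every letter commutes with \<open>a\<close>, which can therefore be moved to that
  end.\<close>

lemma leaf_letter_to_end:
  assumes u: "u \<in> lists S" and a: "a \<in> S" "count_list u a = 1" and b: "count_list u b = 1" "b \<noteq> a"
    and leaf: "\<And>c. c \<in> S \<Longrightarrow> c \<noteq> a \<Longrightarrow> m a c \<noteq> 2 \<Longrightarrow> c = b"
  shows "commutation_equiv m u (a # removeAll a u) \<or> commutation_equiv m u (removeAll a u @ [a])"
proof -
  have "a \<in> set u" using a(2) by (metis count_list_0_iff zero_neq_one)
  then obtain p q where u': "u = p @ a # q" "a \<notin> set p" by (meson split_list_first)
  then have "count_list q a = 0" using a(2) by simp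
  then have q: "a \<notin> set q" by (simp add: count_list_0_iff)
  have rem: "removeAll a u = p @ q" using u' q by simp
  have "count_list p b = 0 \<or> count_list q b = 0" using b u' by auto
  then show ?thesis
  proof
    assume "count_list p b = 0"
    then have "b \<notin> set p" by (simp add: count_list_0_iff)
    then have "m x a = 2" if "x \<in> set p" for x
      using leaf[of x] that u u' m_sym[of x a] a(1) by (auto simp: in_lists_conv_set)
    then have "commutation_equiv m (p @ [a]) (a # p)" by (rule commutation_equiv_snoc_Cons)
    from commutation_equiv_context[OF this, of "[]" q] show ?thesis
      unfolding rem unfolding u'(1) by simp
  next
    assume "count_list q b = 0"
    then have "b \<notin> set q" by (simp add: count_list_0_iff)
    then have "m a x = 2" if "x \<in> set q" for x
      using leaf[of x] that u u' q by (auto simp: in_lists_conv_set)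
    then have "commutation_equiv m (a # q) (q @ [a])" by (rule commutation_equiv_Cons_snoc)
    from commutation_equiv_context[OF this, of p "[]"] show ?thesis
      unfolding rem unfolding u'(1) by simp
  qed
qed

end

lemma count_list_removeAll: "count_list (removeAll a r) x = (if x = a then 0 else count_list r x)"
  by (induction r) auto

lemma count_list_alt_word: "s \<noteq> t \<Longrightarrow> count_list (alt_word s t n) s = (n + 1) div 2 \<and> count_list (alt_word s t n) t = n div 2"
  by (induction n arbitrary: s t) auto

text \<open>If the band is small, both of its letters occur only once. Removing the leaf then preserves
  the hypotheses, and a large band of the shorter word avoids the neighbour of the leaf.\<close>
lemma large_band_exists:
  assumes "coxeter_matrix S m" "finite S" "cut_connected S m" "3 \<le> card S"
    and "\<And>r. r \<in> lists S \<Longrightarrow> power_good m r \<Longrightarrow> r = []"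
    and "r \<in> lists S" "set r = S" "\<And>j. good_word m (rotate j r)" "count_list r s > 1"
  shows "\<exists>a b k j x y. a \<in> S \<and> b \<in> S \<and> m a b = enat k \<and> odd k \<and> 5 \<le> k \<and>
    (\<forall>c\<in>S. c \<noteq> a \<longrightarrow> m a c \<noteq> 2 \<longrightarrow> c = b) \<and>
    commutation_equiv m (rotate j r) (x @ alt_word b a (k - 1) @ y) \<and>
    a \<notin> set (x @ y) \<and> b \<notin> set (x @ y)"
  using assms
proof (induction "card S" arbitrary: S r rule: less_induct)
  case less
  interpret coxeter_mat S m by unfold_locales (rule less.prems(1))
  have "r \<noteq> []" using less.prems(4,7) by auto
  then have "\<not> power_good m r" using less.prems(5,6) by blast
  from band_exists[OF less.prems(2-4,6-8) this]
  obtain a b k j x y where band: "a \<in> S" "b \<in> S" "m a b = enat k" "odd k" "3 \<le> k"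
    "\<And>c. c \<in> S \<Longrightarrow> c \<noteq> a \<Longrightarrow> m a c \<noteq> 2 \<Longrightarrow> c = b"
    "commutation_equiv m (rotate j r) (x @ alt_word b a (k - 1) @ y)"
    "a \<notin> set (x @ y)" "b \<notin> set (x @ y)"
    by metis
  show ?case
  proof (cases "5 \<le> k")
    case True
    with band show ?thesis by blast
  next
    case False
    then have "k = 3" using band(4,5) by (cases "k = 4") auto
    have ab: "a \<noteq> b" using m_eq_1_iff[OF band(1,2)] band(3) \<open>k = 3\<close> by (auto simp: one_enat_def)
    have cnt: "count_list r a = 1" "count_list r b = 1"
    proof -
      have "count_list r c = count_list (x @ [b, a] @ y) c" for c
        using commutation_equiv_count[OF band(7), of c] \<open>k = 3\<close>
        by (simp add: count_list_rotate numeral_2_eq_2)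
      moreover have "count_list (x @ y) a = 0" "count_list (x @ y) b = 0"
        using band(8,9) by (simp_all only: count_list_0_iff not_False_eq_True)
      ultimately show "count_list r a = 1" "count_list r b = 1" using ab by auto
    qed
    define S' where "S' = S - {a}"
    define r' where "r' = removeAll a r"
    have S': "S' \<subseteq> S" "finite S'" "card S' = card S - 1" "set r' = S'" "b \<in> S'"
      using less.prems(2,7) band(1,2) ab by (auto simp: S'_def r'_def)
    have r': "r' \<in> lists S'" using S'(4) by (simp add: in_lists_conv_set)
    \<comment> \<open>Up to commutation, a rotation of the shortened word is a rotation of
      \<open>r\<close> with \<open>a\<close> at one of its ends; goodness descends and bands lift
      along this.\<close>
    have shift: "\<exists>j. commutation_equiv m (rotate j r) (a # rotate j' r') \<or>
        commutation_equiv m (rotate j r) (rotate j' r' @ [a])" for j'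
    proof -
      obtain j where j: "rotate j' (filter ((\<noteq>) a) r) = filter ((\<noteq>) a) (rotate j r)"
        by (rule rotate_filter)
      have "rotate j r \<in> lists S" using less.prems(6) by (simp add: in_lists_conv_set)
      then have "commutation_equiv m (rotate j r) (a # removeAll a (rotate j r)) \<or>
          commutation_equiv m (rotate j r) (removeAll a (rotate j r) @ [a])"
        using band(1,6) cnt ab by (intro leaf_letter_to_end[where b = b]) (auto simp: count_list_rotate)
      then show ?thesis using j by (auto simp: r'_def removeAll_filter_not_eq)
    qed
    have rot': "good_word m (rotate j' r')" for j'
    proof -
      obtain j where j: "commutation_equiv m (rotate j r) (a # rotate j' r') \<or>
        commutation_equiv m (rotate j r) (rotate j' r' @ [a])" using shift by blast
      have "rotate j r \<in> lists S" using less.prems(6) by (simp add: in_lists_conv_set)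
      then have "good_word m (a # rotate j' r') \<or> good_word m (rotate j' r' @ [a])"
        using j good_word_equiv less.prems(8) by blast
      then show ?thesis
        using good_word_factor[of m "[a]" "rotate j' r'" "[]"]
          good_word_factor[of m "[]" "rotate j' r'" "[a]"] by auto
    qed
    have cnt': "count_list r' c = count_list r c" if "c \<noteq> a" for c
      using that by (simp add: r'_def count_list_removeAll)
    have s: "s \<noteq> a" "s \<noteq> b" using less.prems(9) cnt by auto
    have "s \<in> set r" using less.prems(9) by (metis count_list_0_iff not_less_zero)
    then have sS: "s \<in> S'" using less.prems(7) s by (simp add: S'_def)
    show ?thesis
    proof (cases "card S' = 2")
      case True
      \<comment> \<open>The induction cannot reach two letters: \<open>b\<close> occurs once, so
        after rotating it to the end the repeated letter \<open>s\<close> stands next to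
        itself.\<close>
      then have Seq: "S' = {b, s}"
        using S'(2,5) sS s by (metis card_2_iff insert_iff insert_commute singletonD)
      obtain p q where pq: "r' = p @ b # q" "b \<notin> set p"
        using S'(4,5) by (meson split_list_first)
      have "count_list q b = 0" using cnt'[of b] cnt(2) ab pq(1) by simp
      then have "b \<notin> set q" by (simp add: count_list_0_iff)
      then have sub: "set (q @ p) \<subseteq> {s}" using pq S'(4) Seq by auto
      have "count_list r' s > 1" using cnt'[of s] s less.prems(9) by simp
      then have "count_list (q @ p) s > 1" using pq(1) s by simp
      then have "length (q @ p) > 1" using count_le_length[of "q @ p" s] by linarith
      then obtain c d z where "q @ p = c # d # z"
        by (metis One_nat_def length_0_conv length_Cons less_irrefl list.exhaust not_less_zero)
      with sub have z: "q @ p = s # s # z" by auto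
      have "rotate (length (p @ [b])) r' = q @ p @ [b]"
        unfolding pq(1) using rotate_append[of "p @ [b]" q] by simp
      also have "\<dots> = (q @ p) @ [b]" by simp
      finally have "good_word m (s # s # z @ [b])" using rot'[of "length (p @ [b])"] z by simp
      then show ?thesis using not_good_word_square[of m "[]" s "z @ [b]"] by simp
    next
      case False
      have "2 \<le> card S'" using S'(2,5) sS s card_mono[of S' "{b, s}"] by simp
      with False have c3: "3 \<le> card S'" by simp
      have "card S' < card S" using S'(3) less.prems(4) by simp
      moreover have "coxeter_matrix S' m" using coxeter_matrix_subset less.prems(1) S'(1) by blast
      moreover have "cut_connected S' m"
        unfolding S'_def using cut_connected_remove_leaf less.prems(3) band(1,6) by blast
      moreover have "v = []" if "v \<in> lists S'" "power_good m v" for v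
        using that less.prems(5) S'(1) by (metis lists_mono subsetD)
      ultimately obtain a' b' k' j' x' y' where IH: "a' \<in> S'" "b' \<in> S'" "m a' b' = enat k'" "odd k'"
        "5 \<le> k'" "\<And>c. c \<in> S' \<Longrightarrow> c \<noteq> a' \<Longrightarrow> m a' c \<noteq> 2 \<Longrightarrow> c = b'"
        "commutation_equiv m (rotate j' r') (x' @ alt_word b' a' (k' - 1) @ y')"
        "a' \<notin> set (x' @ y')" "b' \<notin> set (x' @ y')"
        using less.hyps[of S' r'] S'(2,4) c3 r' rot' cnt'[OF s(1)] less.prems(9) by metis
      have S'_ne: "a' \<noteq> a" "b' \<noteq> a" "a' \<in> S" "b' \<in> S" using IH(1,2) by (auto simp: S'_def)
      have "enat k' \<noteq> 1" using IH(5) by (simp add: one_enat_def)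
      then have ab': "b' \<noteq> a'" using m_eq_1_iff[OF S'_ne(3,4)] IH(3) by auto
      \<comment> \<open>A large band has at least four letters, two of each kind. Since
        \<open>b\<close> occurs only once, it does not take part in the band.\<close>
      have cnt2: "count_list r' c > 1" if "c = a' \<or> c = b'" for c
      proof -
        have "count_list r' c = count_list (x' @ alt_word b' a' (k' - 1) @ y') c"
          using commutation_equiv_count[OF IH(7), of c] by (simp add: count_list_rotate)
        moreover have "count_list (alt_word b' a' (k' - 1)) c > 1"
          using count_list_alt_word[OF ab', of "k' - 1"] that IH(5) by auto
        ultimately show ?thesis by simp
      qed
      have "b \<noteq> a'" "b \<noteq> b'" using cnt2[of a'] cnt2[of b'] cnt'[of b] cnt(2) ab by auto
      \<comment> \<open>The removed leaf \<open>a\<close> has \<open>b\<close> as its only neighbour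
        and \<open>a'\<close> is not \<open>b\<close>, so restoring \<open>a\<close> gives
        \<open>a'\<close> no new neighbour.\<close>
      then have leaf': "c = b'" if "c \<in> S" "c \<noteq> a'" "m a' c \<noteq> 2" for c
        using IH(6)[of c] band(6)[of a'] that S'_ne m_sym[OF S'_ne(3) band(1)]
        by (cases "c = a") (auto simp: S'_def)
      obtain j where j: "commutation_equiv m (rotate j r) (a # rotate j' r') \<or>
        commutation_equiv m (rotate j r) (rotate j' r' @ [a])" using shift by blast
      have "\<exists>x y. commutation_equiv m (rotate j r) (x @ alt_word b' a' (k' - 1) @ y) \<and>
          a' \<notin> set (x @ y) \<and> b' \<notin> set (x @ y)"
        using j
      proof
        assume "commutation_equiv m (rotate j r) (a # rotate j' r')"
        then have "commutation_equiv m (rotate j r) ((a # x') @ alt_word b' a' (k' - 1) @ y')"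
          using commutation_equiv_Cons[OF IH(7), of a] by (auto intro: commutation_equiv_trans)
        moreover have "a' \<notin> set ((a # x') @ y') \<and> b' \<notin> set ((a # x') @ y')"
          using IH(8,9) S'_ne by auto
        ultimately show ?thesis by blast
      next
        assume "commutation_equiv m (rotate j r) (rotate j' r' @ [a])"
        then have "commutation_equiv m (rotate j r) (x' @ alt_word b' a' (k' - 1) @ y' @ [a])"
          using commutation_equiv_context[OF IH(7), of "[]" "[a]"]
          by (auto intro: commutation_equiv_trans)
        moreover have "a' \<notin> set (x' @ y' @ [a]) \<and> b' \<notin> set (x' @ y' @ [a])"
          using IH(8,9) S'_ne by auto
        ultimately show ?thesis by blast
      qed
      with S'_ne(3,4) IH(3-5) leaf' show ?thesis by blast
    qed
  qed
qed

section \<open>Infinite families\<close>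

definition tight_triple :: "('a \<Rightarrow> 'a \<Rightarrow> enat) \<Rightarrow> (nat \<Rightarrow> 'a) \<Rightarrow> nat \<Rightarrow> nat \<Rightarrow> nat \<Rightarrow> bool" where
  "tight_triple m f p c q \<longleftrightarrow> p < c \<and> c < q \<and> f p = f q \<and>
     (\<forall>x. p < x \<longrightarrow> x < q \<longrightarrow> m (f x) (f p) \<noteq> 2 \<longrightarrow> x = c)"

lemma tight_chain_triple:
  assumes "tight_chain m f i k" "j + 2 < k"
  shows "tight_triple m f (i j) (i (j + 1)) (i (j + 2))"
  using assms tight_chain_less[OF assms(1), of j "j + 1"] tight_chain_less[OF assms(1), of "j + 1" "j + 2"]
  by (simp add: tight_triple_def tight_chain_def)

lemma tight_triple_middle:
  "tight_triple m f p c q \<Longrightarrow> p < x \<Longrightarrow> x < q \<Longrightarrow> m (f x) (f p) \<noteq> 2 \<Longrightarrow> x = c"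
  by (simp add: tight_triple_def)

text \<open>A tight chain with four or more entries contains two overlapping triples, so only braids
  of length 3 remain, and these are excluded by their label.\<close>

lemma braid_free_isolated_triples:
  assumes "\<And>p q. p < q \<Longrightarrow> f p = f q \<Longrightarrow> \<exists>x>p. x < q \<and> m (f x) (f p) \<noteq> 2"
    and "\<And>p c q. tight_triple m f p c q \<Longrightarrow> m (f p) (f c) \<noteq> 3"
    and "\<And>p c q q'. tight_triple m f p c q \<Longrightarrow> \<not> tight_triple m f c q q'"
  shows "braid_free m f N"
  unfolding braid_free_def
proof (intro conjI allI impI)
  fix i k assume *: "3 \<le> k" "tight_chain m f i k" "i (k - 1) < N"
  have t0: "tight_triple m f (i 0) (i 1) (i 2)" using tight_chain_triple[OF *(2), of 0] *(1) by (simp add: numeral_2_eq_2)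
  have "\<not> tight_triple m f (i 1) (i 2) (i 3)" using assms(3)[OF t0] .
  then have "\<not> 3 < k"
    using tight_chain_triple[OF *(2), of 1] by (auto simp: numeral_2_eq_2 numeral_3_eq_3)
  with *(1) have "k = 3" by simp
  with assms(2)[OF t0] show "m (f (i 0)) (f (i 1)) \<noteq> enat k" by (simp add: numeral_eq_enat)
qed (rule assms(1))

context coxeter_mat
begin

text \<open>The word walks along a path and back. Consecutive letters do not commute, so alternating factors
  of length 3 occur only at the two turning points, and no longer ones exist.\<close>
lemma power_good_zigzag:
  assumes L: "2 \<le> L" and v: "inj_on v {..L}" "v ` {..L} \<subseteq> S"
    and adj: "\<And>i. i < L \<Longrightarrow> m (v i) (v (Suc i)) \<noteq> 2"
    and ends: "m (v 0) (v 1) \<noteq> 3" "m (v (L - 1)) (v L) \<noteq> 3"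
  shows "power_good m (map (\<lambda>h. v (if h \<le> L then h else 2 * L - h)) [0..<2 * L])"
proof -
  define g where "g h = (if h \<le> L then h else 2 * L - h)" for h
  \<comment> \<open>The cyclic successor within a period: it reduces statements about the periodic
    walk to case distinctions on one residue.\<close>
  define next_pos where "next_pos h = (if Suc h = 2 * L then 0 else Suc h)" for h
  define G where "G i = g (i mod (2 * L))" for i
  let ?f = "\<lambda>i. v (G i)"
  let ?r = "map (\<lambda>h. v (if h \<le> L then h else 2 * L - h)) [0..<2 * L]"
  have G_Suc: "G (Suc i) = g (next_pos (i mod (2 * L)))"
    "G (Suc (Suc i)) = g (next_pos (next_pos (i mod (2 * L))))" for i
    by (simp_all add: G_def next_pos_def mod_Suc)
  have GL: "G i \<le> L" for i unfolding G_def g_def by auto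
  have hn: "i mod (2 * L) < 2 * L" for i using L by simp
  have "g (next_pos h) = Suc (g h) \<or> g h = Suc (g (next_pos h))" if "h < 2 * L" for h
    using that L unfolding g_def next_pos_def by (auto split: if_splits)
  then have step: "G (Suc i) = Suc (G i) \<or> G i = Suc (G (Suc i))" for i
    unfolding G_Suc(2) unfolding G_Suc(1) unfolding G_def using hn by blast
  have "g (next_pos h) = 0 \<or> g (next_pos h) = L" if "g (next_pos (next_pos h)) = g h" "h < 2 * L" for h
    using that L unfolding g_def next_pos_def by (auto split: if_splits)
  then have turn: "G (Suc i) = 0 \<or> G (Suc i) = L" if "G (Suc (Suc i)) = G i" for i
    using that hn unfolding G_Suc(2) unfolding G_Suc(1) unfolding G_def by blast
  have vS: "v i \<in> S" if "i \<le> L" for i using v(2) that by auto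
  have veq: "v i = v j \<longleftrightarrow> i = j" if "i \<le> L" "j \<le> L" for i j
    using v(1) that by (auto simp: inj_on_def)
  have nc: "m (?f (Suc i)) (?f i) \<noteq> 2" "m (?f i) (?f (Suc i)) \<noteq> 2" for i
    using step[of i] adj[of "G i"] adj[of "G (Suc i)"] GL[of i] GL[of "Suc i"]
      m_sym[OF vS[OF GL[of i]] vS[OF GL[of "Suc i"]]] by auto
  have ne: "?f (Suc i) \<noteq> ?f i" for i using step[of i] veq[OF GL GL] by (metis n_not_Suc_n)
  have triple: "c = Suc p \<and> q = Suc (Suc p) \<and> (G c = 0 \<or> G c = L) \<and> G q = G p"
    if t: "tight_triple m ?f p c q" for p c q
  proof -
    have pq: "p < c" "c < q" "?f p = ?f q" using t by (auto simp: tight_triple_def)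
    have "Suc p = c" using tight_triple_middle[OF t _ _ nc(1)[of p]] pq(1,2) by simp
    moreover have "q - 1 = c"
    proof (rule tight_triple_middle[OF t])
      show "m (?f (q - 1)) (?f p) \<noteq> 2" using nc(2)[of "q - 1"] pq by simp
    qed (use pq in auto)
    ultimately have "c = Suc p \<and> q = Suc (Suc p)" using pq by auto
    moreover have "G q = G p" using pq(3) veq[OF GL GL] by simp
    ultimately show ?thesis using turn[of p] by simp
  qed
  have "braid_free m ?f N" for N
  proof (rule braid_free_isolated_triples)
    fix p q assume pq: "p < q" "?f p = ?f q"
    then have "Suc p < q" using ne[of p] by (cases "q = Suc p") auto
    then show "\<exists>x>p. x < q \<and> m (?f x) (?f p) \<noteq> 2" using nc[of p] by (intro exI[of _ "Suc p"]) auto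
  next
    fix p c q assume "tight_triple m ?f p c q"
    from triple[OF this] have c: "c = Suc p" "G c = 0 \<or> G c = L" by auto
    have "G p \<le> L" by (rule GL)
    \<comment> \<open>The middle of a triple is a turning point, so its edge is the first or the
      last of the path, whose labels are not 3.\<close>
    with c step[of p] have "G p = 1 \<and> G c = 0 \<or> G p = L - 1 \<and> G c = L" by auto
    then show "m (?f p) (?f c) \<noteq> 3"
      using ends m_sym[OF vS[of 0] vS[of 1]] L by auto
  next
    fix p c q q' assume t: "tight_triple m ?f p c q"
    show "\<not> tight_triple m ?f c q q'"
    proof
      assume "tight_triple m ?f c q q'"
      with triple[OF t] triple[OF this] step[of p] L GL[of p] show False by auto
    qed
  qed
  moreover have "(\<lambda>i. ?r ! (i mod length ?r)) = ?f"
    using hn by (simp add: fun_eq_iff G_def g_def)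
  ultimately show ?thesis unfolding power_good_def by metis
qed

text \<open>Here one end of the path is replaced by two branches that are visited one after the other.\<close>
lemma power_good_fork:
  assumes l: "2 \<le> l" and v: "inj_on v {..Suc l}" "v ` {..Suc l} \<subseteq> S"
    and adj: "\<And>i. i < l \<Longrightarrow> m (v i) (v (Suc i)) \<noteq> 2" "m (v (l - 1)) (v (Suc l)) \<noteq> 2"
    and ends: "m (v 0) (v 1) \<noteq> 3"
  shows "power_good m (map (\<lambda>h. v (if h \<le> Suc l then h else 2 * l + 1 - h)) [0..<2 * l + 1])"
proof -
  define n where "n = 2 * l + 1"
  define g where "g h = (if h \<le> Suc l then h else n - h)" for h
  define next_pos where "next_pos h = (if Suc h = n then 0 else Suc h)" for h
  define G where "G i = g (i mod n)" for i
  let ?f = "\<lambda>i. v (G i)"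
  let ?r = "map (\<lambda>h. v (if h \<le> Suc l then h else n - h)) [0..<n]"
  \<comment> \<open>The edges of the fork. The letters \<open>v l\<close> and
    \<open>v (Suc l)\<close> follow each other in the word, but nothing is assumed about their
    label; hence the exception \<open>G i \<noteq> l\<close> below.\<close>
  define E where "E i j \<longleftrightarrow> (j = Suc i \<and> j \<le> l) \<or> (i = l - 1 \<and> j = Suc l)" for i j
  have G_Suc: "G (Suc i) = g (next_pos (i mod n))"
    "G (Suc (Suc i)) = g (next_pos (next_pos (i mod n)))"
    "G (Suc (Suc (Suc i))) = g (next_pos (next_pos (next_pos (i mod n))))" for i
    by (simp_all add: G_def next_pos_def mod_Suc)
  have hn: "i mod n < n" for i by (simp add: n_def)
  have GL: "G i \<le> Suc l" for i using hn[of i] unfolding G_def g_def n_def by auto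
  have "E (g h) (g (next_pos h)) \<or> E (g (next_pos h)) (g h)" if "g h \<noteq> l" "h < n" for h
    using that l unfolding g_def next_pos_def E_def n_def by (auto split: if_splits)
  then have step: "E (G i) (G (Suc i)) \<or> E (G (Suc i)) (G i)" if "G i \<noteq> l" for i
    using that hn unfolding G_Suc(3) unfolding G_Suc(2) unfolding G_Suc(1) unfolding G_def by blast
  have "g (next_pos h) = Suc l \<and> g (next_pos (next_pos h)) = l - 1 \<and> g (next_pos (next_pos (next_pos h))) \<noteq> l" if "g h = l" "h < n" for h
    using that l unfolding g_def next_pos_def E_def n_def by (auto split: if_splits)
  then have top: "G (Suc i) = Suc l \<and> G (Suc (Suc i)) = l - 1 \<and> G (Suc (Suc (Suc i))) \<noteq> l" if "G i = l" for i
    using that hn unfolding G_Suc(3) unfolding G_Suc(2) unfolding G_Suc(1) unfolding G_def by blast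
  have "g h = l" if "g (next_pos h) = Suc l" "h < n" for h
    using that l unfolding g_def next_pos_def E_def n_def by (auto split: if_splits)
  then have top': "G i = l" if "G (Suc i) = Suc l" for i
    using that hn unfolding G_Suc(3) unfolding G_Suc(2) unfolding G_Suc(1) unfolding G_def by blast
  have "g (next_pos (next_pos (next_pos h))) \<noteq> Suc l" if "g h = Suc l" "h < n" for h
    using that l unfolding g_def next_pos_def E_def n_def by (auto split: if_splits)
  then have top'': "G (Suc (Suc (Suc i))) \<noteq> Suc l" if "G i = Suc l" for i
    using that hn unfolding G_Suc(3) unfolding G_Suc(2) unfolding G_Suc(1) unfolding G_def by blast
  have "g h = l - 1" if "g (next_pos h) = l" "h < n" for h
    using that l unfolding g_def next_pos_def E_def n_def by (auto split: if_splits)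
  then have prev: "G i = l - 1" if "G (Suc i) = l" for i
    using that hn unfolding G_Suc(3) unfolding G_Suc(2) unfolding G_Suc(1) unfolding G_def by blast
  have "g (next_pos h) = 0 \<and> g h = 1" if h: "g (next_pos (next_pos h)) = g h" "g h < l" "h < n" for h
  proof -
    consider "h < l" | "l + 2 \<le> h" "Suc (Suc h) < n" | "l + 2 \<le> h" "Suc (Suc h) = n" | "Suc h = n"
      using h(2,3) by (force simp: g_def)
    then show ?thesis
    proof cases
      case 1
      then have "g h = h" "next_pos (next_pos h) = Suc (Suc h)" "g (Suc (Suc h)) = Suc (Suc h)"
        by (simp_all add: g_def next_pos_def n_def)
      with h(1) show ?thesis by simp
    next
      case 2
      then have "g h = n - h" "next_pos (next_pos h) = Suc (Suc h)"
        "g (Suc (Suc h)) = n - Suc (Suc h)"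
        by (simp_all add: g_def next_pos_def)
      with h(1) 2 show ?thesis by simp
    next
      case 3
      then have "g h = n - h" "next_pos (next_pos h) = 0" "g 0 = 0"
        by (simp_all add: g_def next_pos_def)
      with h(1) 3 show ?thesis by simp
    next
      case 4
      then have "g h = 1" "next_pos h = 0" "g 0 = 0"
        using l by (auto simp: g_def next_pos_def n_def)
      then show ?thesis by simp
    qed
  qed
  then have turn: "G (Suc i) = 0 \<and> G i = 1" if "G (Suc (Suc i)) = G i" "G i < l" for i
    using that hn unfolding G_Suc(3) unfolding G_Suc(2) unfolding G_Suc(1) unfolding G_def by blast
  have vS: "v i \<in> S" if "i \<le> Suc l" for i using v(2) that by auto
  have veq: "v i = v j \<longleftrightarrow> i = j" if "i \<le> Suc l" "j \<le> Suc l" for i j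
    using v(1) that by (auto simp: inj_on_def)
  have Enc: "m (v i) (v j) \<noteq> 2 \<and> m (v j) (v i) \<noteq> 2" if "E i j" for i j
  proof -
    have ij: "i \<le> Suc l" "j \<le> Suc l" using that l by (auto simp: E_def)
    show ?thesis using that adj m_sym[OF vS[OF ij(1)] vS[OF ij(2)]] by (auto simp: E_def)
  qed
  have nc: "m (?f (Suc i)) (?f i) \<noteq> 2 \<and> m (?f i) (?f (Suc i)) \<noteq> 2 \<and> ?f i \<noteq> ?f (Suc i)"
    if "G i \<noteq> l" for i
  proof -
    have "G i \<noteq> G (Suc i)" using step[OF that] l by (auto simp: E_def)
    then show ?thesis using step[OF that] Enc veq[OF GL GL] by auto
  qed
  have nc2: "m (?f (Suc (Suc i))) (?f i) \<noteq> 2 \<and> ?f (Suc (Suc i)) \<noteq> ?f i \<and> ?f (Suc i) \<noteq> ?f i" if "G i = l" for i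
    using top[OF that] that Enc[of "l - 1" l] l veq[of "l - 1" l] veq[of "Suc l" l] by (auto simp: E_def)
  \<comment> \<open>For a triple starting at a branch vertex, the pass of \<open>l - 1\<close> after
    it and the one before the return would have to coincide, so the walk would be back within three
    steps. Only the turn at 0 remains.\<close>
  have triple: "c = Suc p \<and> q = Suc (Suc p) \<and> G c = 0 \<and> G p = 1 \<and> G q = 1"
    if t: "tight_triple m ?f p c q" for p c q
  proof -
    have pq: "p < c" "c < q" "?f p = ?f q" using t by (auto simp: tight_triple_def)
    have Gq: "G q = G p" using pq(3) veq[OF GL GL] by simp
    obtain q1 where q1: "q = Suc q1" using pq by (cases q) auto
    obtain q2 where q2: "q1 = Suc q2" using pq q1 by (cases q1) auto
    note mid = tight_triple_middle[OF t]
    consider "G p = l" | "G p = Suc l" | "G p < l" using GL[of p] by linarith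
    then show ?thesis
    proof cases
      case 1
      have "q \<noteq> Suc p" "q \<noteq> Suc (Suc p)" using pq nc2[OF 1] by auto
      then have c: "Suc (Suc p) = c" using mid[of "Suc (Suc p)"] nc2[OF 1] pq by simp
      have "G q1 = l - 1" using prev[of q1] Gq 1 q1 by simp
      then have "m (?f q1) (?f p) \<noteq> 2" using 1 Enc[of "l - 1" l] l by (simp add: E_def)
      then have "q1 = c" using mid[of q1] pq q1 by simp
      then show ?thesis using top[OF 1] c q1 Gq 1 by simp
    next
      case 2
      have "Suc p = c" using mid[of "Suc p"] nc[of p] 2 pq by simp
      moreover have "G q1 = l" using top'[of q1] Gq 2 q1 by simp
      then have "G q2 = l - 1" using prev[of q2] q2 by simp
      then have "m (?f q2) (?f p) \<noteq> 2" using 2 Enc[of "l - 1" "Suc l"] by (simp add: E_def)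
      moreover have "p \<noteq> q2" using 2 \<open>G q2 = l - 1\<close> l by auto
      ultimately have "q2 = c" using mid[of q2] pq q1 q2 by simp
      then show ?thesis using top''[OF 2] \<open>Suc p = c\<close> q1 q2 Gq 2 by simp
    next
      case 3
      have c: "Suc p = c" using mid[of "Suc p"] nc[of p] 3 pq by simp
      have "m (?f q1) (?f p) \<noteq> 2"
      proof -
        have "G q1 \<noteq> l" using top[of q1] Gq 3 q1 by auto
        then show ?thesis using nc[of q1] pq(3) q1 by simp
      qed
      then have "q1 = c" using mid[of q1] pq q1 by simp
      then show ?thesis using turn[of p] c q1 Gq 3 by simp
    qed
  qed
  have "braid_free m ?f N" for N
  proof (rule braid_free_isolated_triples)
    fix p q assume pq: "p < q" "?f p = ?f q"
    show "\<exists>x>p. x < q \<and> m (?f x) (?f p) \<noteq> 2"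
    proof (cases "G p = l")
      case True
      then have "q \<noteq> Suc p" "q \<noteq> Suc (Suc p)" using pq nc2[OF True] by auto
      with pq nc2[OF True] show ?thesis by (intro exI[of _ "Suc (Suc p)"]) auto
    next
      case False
      then have "q \<noteq> Suc p" using pq nc by auto
      with pq nc[OF False] show ?thesis by (intro exI[of _ "Suc p"]) auto
    qed
  next
    fix p c q assume "tight_triple m ?f p c q"
    then have "G p = 1" "G c = 0" using triple by blast+
    then show "m (?f p) (?f c) \<noteq> 3" using ends m_sym[OF vS[of 0] vS[of 1]] by simp
  next
    fix p c q q' assume t: "tight_triple m ?f p c q"
    show "\<not> tight_triple m ?f c q q'"
    proof
      assume "tight_triple m ?f c q q'"
      with triple[OF t] triple[OF this] show False by simp
    qed
  qed
  moreover have "(\<lambda>i. ?r ! (i mod length ?r)) = ?f"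
    using hn by (simp add: fun_eq_iff G_def g_def)
  ultimately show ?thesis unfolding power_good_def n_def[symmetric] by metis
qed

text \<open>As \<open>c\<close> does not commute with \<open>b\<close>, the only tight triple
  starting at \<open>b\<close> is \<open>bab\<close> inside one period. A chain passes through at
  most one of these and so has at most five letters; this is why the label 5 escapes and 6 does
  not.\<close>

lemma power_good_label_6:
  assumes S: "a \<in> S" "b \<in> S" "c \<in> S" "a \<noteq> b" "a \<noteq> c" "b \<noteq> c"
    and mab: "m a b \<ge> 6" and mbc: "m b c \<noteq> 2"
  shows "power_good m [a, b, a, b, c]"
proof -
  define f where "f i = [a, b, a, b, c] ! (i mod 5)" for i
  have nab: "m a b \<noteq> 2" "m b a \<noteq> 2" "m c b \<noteq> 2" "m b a \<ge> 6"
  proof -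
    have "m b a = m a b" "m c b = m b c" by (rule m_sym; fact)+
    moreover from mab have "m a b \<noteq> 2" by auto
    ultimately show "m a b \<noteq> 2" "m b a \<noteq> 2" "m c b \<noteq> 2" "m b a \<ge> 6" using mab mbc by simp_all
  qed
  have f: "i mod 5 = 0 \<Longrightarrow> f i = a" "i mod 5 = 1 \<Longrightarrow> f i = b" "i mod 5 = 2 \<Longrightarrow> f i = a"
    "i mod 5 = 3 \<Longrightarrow> f i = b" "i mod 5 = 4 \<Longrightarrow> f i = c" for i
    by (simp_all add: f_def)
  have cases5: "i mod 5 = 0 \<or> i mod 5 = 1 \<or> i mod 5 = 2 \<or> i mod 5 = 3 \<or> i mod 5 = 4" for i :: nat
    by linarith
  have suc: "Suc i mod 5 = (if i mod 5 = 4 then 0 else Suc (i mod 5))" for i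
    by (simp add: mod_Suc)
  have nc1: "m (f (Suc p)) (f p) \<noteq> 2 \<and> f (Suc p) \<noteq> f p" if "p mod 5 \<noteq> 4" for p
    using cases5[of p] that f[of p] f[of "Suc p"] suc[of p] nab mbc S by auto
  have c4: "f (Suc p) = a \<and> f (Suc (Suc p)) = b \<and> f (Suc (Suc (Suc p))) = a \<and>
      f (Suc (Suc (Suc (Suc p)))) = b" if "p mod 5 = 4" for p
    using that f suc by simp
  have c3: "f p = b \<and> f (Suc p) = c \<and> f (Suc (Suc p)) = a" if "p mod 5 = 3" for p
    using that f suc by simp
  have c1: "f p = b \<and> f (Suc p) = a \<and> f (Suc (Suc p)) = b \<and> f (Suc (Suc (Suc p))) = c" if "p mod 5 = 1" for p
    using that f suc by simp
  have triple: "f p = a \<and> f d = b \<or> f p = b \<and> f d = a \<and> p mod 5 = 1 \<and> q mod 5 = 3"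
    if t: "tight_triple m f p d q" for p d q
  proof -
    have pq: "p < d" "d < q" "f p = f q" using t by (auto simp: tight_triple_def)
    note mid = tight_triple_middle[OF t]
    consider "p mod 5 = 0 \<or> p mod 5 = 2" | "p mod 5 = 1" | "p mod 5 = 3" | "p mod 5 = 4"
      using cases5[of p] by blast
    then show ?thesis
    proof cases
      case 1
      then have "f p = a" "f (Suc p) = b" using f[of p] f[of "Suc p"] suc[of p] by auto
      moreover have "Suc p = d" using mid[of "Suc p"] nc1[of p] 1 pq by auto
      ultimately show ?thesis by simp
    next
      case 2
      have d: "Suc p = d" using mid[of "Suc p"] nc1[of p] 2 pq by auto
      have "q = Suc (Suc p)"
      proof (rule ccontr)
        assume "q \<noteq> Suc (Suc p)"
        then have "Suc (Suc (Suc p)) < q" using pq d c1[OF 2] S by (cases "q = Suc (Suc (Suc p))") auto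
        then have "Suc (Suc (Suc p)) = d" using mid[of "Suc (Suc (Suc p))"] c1[OF 2] nab by simp
        with d show False by simp
      qed
      with d c1[OF 2] 2 suc[of p] suc[of "Suc p"] show ?thesis by simp
    next
      case 3
      have "q \<noteq> Suc p" "q \<noteq> Suc (Suc p)" using pq c3[OF 3] S by auto
      then have "Suc p = d" "Suc (Suc p) = d"
        using mid[of "Suc p"] mid[of "Suc (Suc p)"] pq c3[OF 3] nab by auto
      then show ?thesis by simp
    next
      case 4
      have "q \<noteq> Suc p" "q \<noteq> Suc (Suc p)" "q \<noteq> Suc (Suc (Suc p))" "q \<noteq> Suc (Suc (Suc (Suc p)))"
        using pq c4[OF 4] f[of p] 4 S by auto
      then have "Suc (Suc p) < q" "Suc (Suc (Suc (Suc p))) < q" using pq by auto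
      then have "Suc (Suc p) = d" "Suc (Suc (Suc (Suc p))) = d"
        using mid[of "Suc (Suc p)"] mid[of "Suc (Suc (Suc (Suc p)))"] c4[OF 4] f[of p] 4 mbc by auto
      then show ?thesis by simp
    qed
  qed
  have "braid_free m f N" for N
    unfolding braid_free_def
  proof (intro conjI allI impI)
    fix p q assume pq: "p < q" "f p = f q"
    show "\<exists>x>p. x < q \<and> m (f x) (f p) \<noteq> 2"
    proof (cases "p mod 5 = 4")
      case True
      then have "q \<noteq> Suc p" "q \<noteq> Suc (Suc p)" using pq c4[OF True] f[of p] S by auto
      with pq c4[OF True] f[of p] True mbc show ?thesis by (intro exI[of _ "Suc (Suc p)"]) auto
    next
      case False
      then have "q \<noteq> Suc p" using pq nc1 by metis
      with pq nc1[OF False] show ?thesis by (intro exI[of _ "Suc p"]) auto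
    qed
  next
    fix i k assume *: "3 \<le> k" "tight_chain m f i k"
    have tr: "tight_triple m f (i j) (i (Suc j)) (i (Suc (Suc j)))" if "Suc (Suc j) < k" for j
      using tight_chain_triple[OF *(2), of j] that by simp
    have t0: "f (i 0) = a \<and> f (i 1) = b \<or> f (i 0) = b \<and> f (i 1) = a"
      using triple[OF tr[of 0]] *(1) by auto
    show "m (f (i 0)) (f (i 1)) \<noteq> enat k"
    proof
      assume eq: "m (f (i 0)) (f (i 1)) = enat k"
      then have "6 \<le> enat k" using t0 mab nab(4) by auto
      then have k: "6 \<le> k" by (simp add: numeral_eq_enat)
      \<comment> \<open>The index of the first \<open>b\<close> on the chain. With six letters,
        triples start both there and two places later, but the first one ends at residue 3 and the
        second would have to start at residue 1.\<close>
      define j where "j = (if f (i 0) = b then 0 else 1 :: nat)"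
      have "f (i j) = b" using t0 S by (auto simp: j_def)
      moreover have "j \<le> 1" by (simp add: j_def)
      ultimately have "i (Suc (Suc j)) mod 5 = 3"
        using triple[OF tr[of j]] k S by auto
      moreover have "f (i (Suc (Suc j))) = b"
        using tight_chain_letter[OF *(2), of j] tight_chain_letter[OF *(2), of "Suc (Suc j)"]
          \<open>f (i j) = b\<close> \<open>j \<le> 1\<close> k by auto
      ultimately show False
        using triple[OF tr[of "Suc (Suc j)"]] \<open>j \<le> 1\<close> k S by auto
    qed
  qed
  moreover have "(\<lambda>i. [a, b, a, b, c] ! (i mod length [a, b, a, b, c])) = f"
    by (simp add: fun_eq_iff f_def)
  ultimately show ?thesis unfolding power_good_def by metis
qed

text \<open>Used to exclude the infinite dihedral group in rank two.\<close>

lemma power_good_infinite_label: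
  assumes "s \<in> S" "t \<in> S" "m s t = \<infinity>"
  shows "power_good m [s, t]"
proof -
  define f where "f i = [s, t] ! (i mod 2)" for i
  have st: "s \<noteq> t" using m_eq_1_iff[OF assms(1,2)] assms(3) by auto
  have ts: "m t s = \<infinity>" using m_sym assms by simp
  have f: "f i = (if even i then s else t)" for i
    by (auto simp: f_def even_iff_mod_2_eq_zero odd_iff_mod_2_eq_one)
  have "braid_free m f N" for N
    unfolding braid_free_def
  proof (intro conjI allI impI)
    fix p q assume pq: "p < q" "f p = f q"
    then have "q \<noteq> Suc p" using st by (auto simp: f split: if_splits)
    then show "\<exists>x>p. x < q \<and> m (f x) (f p) \<noteq> 2"
      using pq assms(3) ts by (intro exI[of _ "Suc p"]) (auto simp: f)
  next
    fix i :: "nat \<Rightarrow> nat" and k :: nat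
    assume "3 \<le> k"
    then show "m (f (i 0)) (f (i 1)) \<noteq> enat k"
      using assms(3) ts m_eq_1_iff[of s s] m_eq_1_iff[of t t] assms(1,2)
      by (auto simp: f one_enat_def)
  qed
  moreover have "(\<lambda>i. [s, t] ! (i mod length [s, t])) = f"
    by (simp add: fun_eq_iff f_def numeral_2_eq_2)
  ultimately show ?thesis unfolding power_good_def by metis
qed

end

section \<open>Graphs with an odd endpoint of weight at least five\<close>

context coxeter_mat
begin

text \<open>An explored initial part of the graph: every vertex except the last has its whole
  neighbourhood on the path, so anything unexplored hangs off \<open>v (l - 1)\<close>. The label of
  the first edge is left open.\<close>

definition leaf_path :: "(nat \<Rightarrow> 'a) \<Rightarrow> nat \<Rightarrow> bool" where
  "leaf_path v l \<longleftrightarrow> 2 \<le> l \<and> inj_on v {..<l} \<and> v ` {..<l} \<subseteq> S \<and>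
     (\<forall>i c. Suc i < l \<longrightarrow> c \<in> S \<longrightarrow> c \<noteq> v i \<longrightarrow> m (v i) c \<noteq> 2 \<longrightarrow>
        c = v (Suc i) \<or> 0 < i \<and> c = v (i - 1)) \<and>
     (\<forall>i. Suc i < l \<longrightarrow> m (v i) (v (Suc i)) \<noteq> 2) \<and>
     (\<forall>i. 1 \<le> i \<longrightarrow> Suc i < l \<longrightarrow> m (v i) (v (Suc i)) = 3)"

lemma leaf_pathD:
  assumes "leaf_path v l"
  shows "2 \<le> l" "inj_on v {..<l}" "v ` {..<l} \<subseteq> S"
    "\<And>i c. Suc i < l \<Longrightarrow> c \<in> S \<Longrightarrow> c \<noteq> v i \<Longrightarrow> m (v i) c \<noteq> 2 \<Longrightarrow> c = v (Suc i) \<or> 0 < i \<and> c = v (i - 1)"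
    "\<And>i. Suc i < l \<Longrightarrow> m (v i) (v (Suc i)) \<noteq> 2"
    "\<And>i. 1 \<le> i \<Longrightarrow> Suc i < l \<Longrightarrow> m (v i) (v (Suc i)) = 3"
  using assms unfolding leaf_path_def by blast+

text \<open>Take a longest such path and the new neighbours \<open>N\<close> of its end. Two of them
  give a fork, one with label other than 3 gives a zigzag, and one with label 3 prolongs the path.
  So \<open>N\<close> is empty and connectedness finishes. The condition
  \<open>m a b \<noteq> 3\<close> allows the walks to turn at \<open>a\<close>.\<close>

lemma odd_leaf_path_exhausts:
  assumes fin: "finite S" and conn: "cut_connected S m"
    and nopow: "\<And>r. r \<in> lists S \<Longrightarrow> power_good m r \<Longrightarrow> r = []"
    and ab: "a \<in> S" "b \<in> S" "m a b \<noteq> 1" "m a b \<noteq> 2" "m a b \<noteq> 3"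
    and leaf: "\<And>c. c \<in> S \<Longrightarrow> c \<noteq> a \<Longrightarrow> m a c \<noteq> 2 \<Longrightarrow> c = b"
  obtains v l where "leaf_path v l" "v 0 = a" "v 1 = b" "v ` {..<l} = S"
proof -
  let ?P = "\<lambda>l. \<exists>v. leaf_path v l \<and> v 0 = a \<and> v 1 = b"
  have ne: "a \<noteq> b" using ab(3) m_eq_1_iff[OF ab(1,2)] by simp
  have "leaf_path (\<lambda>i. if i = 0 then a else b) 2"
    unfolding leaf_path_def
  proof (intro conjI allI impI)
    show "inj_on (\<lambda>i. if i = 0 then a else b) {..<2::nat}"
      using ne by (auto simp: inj_on_def split: if_splits)
  next
    fix i :: nat and c
    assume "Suc i < 2" "c \<in> S" "c \<noteq> (if i = 0 then a else b)" "m (if i = 0 then a else b) c \<noteq> 2"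
    then show "c = (if Suc i = 0 then a else b) \<or> 0 < i \<and> c = (if i - 1 = 0 then a else b)"
      using leaf by simp
  qed (use ab in auto)
  moreover have "(1::nat) \<noteq> 0" by simp
  ultimately have ex: "?P 2" by (metis (mono_tags, lifting))
  have bound: "l \<le> card S" if "?P l" for l
  proof -
    obtain v where v: "leaf_path v l" using \<open>?P l\<close> by blast
    then show ?thesis using card_inj_on_le[OF leaf_pathD(2,3)[OF v] fin] by simp
  qed
  define l where "l = (GREATEST l. ?P l)"
  have "?P l" unfolding l_def by (rule GreatestI_nat[of ?P 2 "card S"]) (use ex bound in auto)
  then obtain v where v: "leaf_path v l" "v 0 = a" "v 1 = b" by blast
  have maxl: "\<not> ?P (Suc l)"
  proof
    assume "?P (Suc l)"
    then have "Suc l \<le> l" unfolding l_def by (rule Greatest_le_nat[of ?P _ "card S"]) (use bound in auto)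
    then show False by simp
  qed
  note D = leaf_pathD[OF v(1)]
  have vS: "v i \<in> S" if "i < l" for i using D(3) that by auto
  have veq: "v i = v j \<longleftrightarrow> i = j" if "i < l" "j < l" for i j
    using D(2) that by (auto simp: inj_on_def)
  define w where "w = v (l - 1)"
  define N where "N = {c \<in> S. c \<noteq> w \<and> m w c \<noteq> 2 \<and> c \<noteq> v (l - 2)}"
  have wS: "w \<in> S" using vS[of "l - 1"] D(1) by (simp add: w_def)
  \<comment> \<open>This excludes cycles: earlier vertices have all their neighbours next to them on
    the path, so an edge from the end cannot lead back.\<close>
  have fresh: "c \<notin> v ` {..<l}" if c: "c \<in> N" for c
  proof
    assume "c \<in> v ` {..<l}"
    then obtain i where i: "i < l" "c = v i" by auto
    have "i \<noteq> l - 1" "i \<noteq> l - 2" using c i by (auto simp: N_def w_def)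
    then have il: "Suc i < l - 1" using i D(1) by linarith
    have "m (v i) w \<noteq> 2" using c i m_sym[OF vS[OF i(1)] wS] by (simp add: N_def)
    moreover have "w \<noteq> v i" using c i by (auto simp: N_def)
    ultimately have "w = v (Suc i) \<or> 0 < i \<and> w = v (i - 1)" using D(4)[of i w] il wS by linarith
    then show False
      unfolding w_def using veq[of "l - 1" "Suc i"] veq[of "l - 1" "i - 1"] il by auto
  qed
  have adj: "m (v i) (v (Suc i)) \<noteq> 2" if "Suc i < l" for i by (rule D(5)[OF that])
  have end0: "m (v 0) (v 1) \<noteq> 3" using v ab by simp
  have "N = {}"
  proof (rule ccontr)
    assume "N \<noteq> {}"
    then obtain x where x: "x \<in> N" by blast
    show False
    proof (cases "\<exists>y\<in>N. y \<noteq> x")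
      case True
      then obtain y where y: "y \<in> N" "y \<noteq> x" by blast
      \<comment> \<open>The path has its end at index \<open>l - 1\<close>; the two branch vertices
        take the indices \<open>l\<close> and \<open>Suc l\<close> expected by
        \<open>power_good_fork\<close>.\<close>
      define v' where "v' i = (if i < l then v i else if i = l then x else y)" for i
      have xy: "x \<in> S" "y \<in> S" "m w x \<noteq> 2" "m w y \<noteq> 2" using x y by (auto simp: N_def)
      have v'S: "v' i \<in> S" for i using vS xy by (simp add: v'_def)
      have good: "power_good m (map (\<lambda>h. v' (if h \<le> Suc l then h else 2 * l + 1 - h)) [0..<2 * l + 1])"
      proof (rule power_good_fork[OF D(1)])
        show "inj_on v' {..Suc l}"
          unfolding inj_on_def v'_def using veq fresh[OF x] fresh[OF y(1)] y(2) by auto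
        show "v' ` {..Suc l} \<subseteq> S" using v'S by blast
        show "m (v' i) (v' (Suc i)) \<noteq> 2" if "i < l" for i
          using adj[of i] that xy by (cases "Suc i = l") (auto simp: v'_def w_def)
        show "m (v' (l - 1)) (v' (Suc l)) \<noteq> 2" using xy D(1) by (simp add: v'_def w_def)
        show "m (v' 0) (v' 1) \<noteq> 3" using end0 D(1) by (simp add: v'_def)
      qed
      have "map (\<lambda>h. v' (if h \<le> Suc l then h else 2 * l + 1 - h)) [0..<2 * l + 1] \<in> lists S"
        using v'S by (simp only: in_lists_conv_set set_map ball_simps) simp
      from nopow[OF this good] show False by simp
    next
      case False
      define v' where "v' i = (if i < l then v i else x)" for i
      have xS: "x \<in> S" "m w x \<noteq> 2" "x \<noteq> w" using x by (auto simp: N_def)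
      have inj: "inj_on v' {..l}" unfolding inj_on_def v'_def using veq fresh[OF x] by auto
      have v'S: "v' i \<in> S" for i using vS xS by (simp add: v'_def)
      then have sub: "v' ` {..l} \<subseteq> S" by blast
      have adj': "m (v' i) (v' (Suc i)) \<noteq> 2" if "i < l" for i
        using adj[of i] that xS by (cases "Suc i = l") (auto simp: v'_def w_def)
      have "m w x = 3"
      \<comment> \<open>Otherwise the walk could turn round at \<open>x\<close> as well as at
        \<open>a\<close>.\<close>
      proof (rule ccontr)
        assume w3: "m w x \<noteq> 3"
        have good: "power_good m (map (\<lambda>h. v' (if h \<le> l then h else 2 * l - h)) [0..<2 * l])"
        proof (rule power_good_zigzag[OF D(1) inj sub adj'])
          show "m (v' 0) (v' 1) \<noteq> 3" using end0 D(1) by (simp add: v'_def)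
          show "m (v' (l - 1)) (v' l) \<noteq> 3" using w3 D(1) by (simp add: v'_def w_def)
        qed
        have "map (\<lambda>h. v' (if h \<le> l then h else 2 * l - h)) [0..<2 * l] \<in> lists S"
          using v'S by (simp only: in_lists_conv_set set_map ball_simps) simp
        from nopow[OF this good] show False using D(1) by simp
      qed
      have "leaf_path v' (Suc l)"
        unfolding leaf_path_def lessThan_Suc_atMost
      proof (intro conjI allI impI)
        fix i c assume i: "Suc i < Suc l" and c: "c \<in> S" "c \<noteq> v' i" "m (v' i) c \<noteq> 2"
        show "c = v' (Suc i) \<or> 0 < i \<and> c = v' (i - 1)"
        proof (cases "Suc i < l")
          case True
          then show ?thesis using D(4)[of i c] c by (auto simp: v'_def)
        next
          case l: False
          then have il: "i = l - 1" using i by simp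
          then have "c \<in> N \<or> c = v (l - 2)" using c D(1) by (auto simp: N_def w_def v'_def)
          then show ?thesis using False il D(1) by (auto simp: v'_def numeral_2_eq_2)
        qed
      next
        fix i assume i: "1 \<le> i" "Suc i < Suc l"
        show "m (v' i) (v' (Suc i)) = 3"
        proof (cases "Suc i < l")
          case True
          then show ?thesis using D(6)[of i] i by (simp add: v'_def)
        next
          case l: False
          then have "i = l - 1" "\<not> Suc i < l" using i by auto
          then show ?thesis using \<open>m w x = 3\<close> D(1) by (simp add: v'_def w_def)
        qed
      qed (use D(1) inj sub adj' in auto)
      moreover have "v' 0 = a" "v' 1 = b" using v D(1) by (simp_all add: v'_def)
      ultimately show False using maxl by blast
    qed
  qed
  have "v ` {..<l} = S"
  proof (rule ccontr)
    assume "v ` {..<l} \<noteq> S"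
    then have A: "v ` {..<l} \<subset> S" using D(3) by blast
    have "v 0 \<in> v ` {..<l}" using D(1) by simp
    then have A': "v ` {..<l} \<noteq> {}" by blast
    from cut_connectedE[OF conn A A'] obtain x y
      where xy: "x \<in> v ` {..<l}" "y \<in> S" "y \<notin> v ` {..<l}" "m x y \<noteq> 2" .
    then obtain i where i: "i < l" "x = v i" by auto
    have yv: "y \<noteq> v j" if "j < l" for j using xy(3) that by auto
    show False
    proof (cases "Suc i < l")
      case True
      then show False using D(4)[of i y] xy i yv[of i] yv[of "Suc i"] yv[of "i - 1"] by auto
    next
      case False
      then have "i = l - 1" using i by simp
      then have "y \<in> N" using xy i yv D(1) by (auto simp: N_def w_def)
      with \<open>N = {}\<close> show False by simp
    qed
  qed
  with v that show ?thesis by blast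
qed

lemma odd_leaf_is_H:
  assumes fin: "finite S" and conn: "cut_connected S m" and card: "3 \<le> card S"
    and nopow: "\<And>r. r \<in> lists S \<Longrightarrow> power_good m r \<Longrightarrow> r = []"
    and ab: "a \<in> S" "b \<in> S" "m a b = enat k" "odd k" "5 \<le> k"
    and leaf: "\<And>c. c \<in> S \<Longrightarrow> c \<noteq> a \<Longrightarrow> m a c \<noteq> 2 \<Longrightarrow> c = b"
  shows "\<exists>n>2. is_H n S m"
proof -
  have ne: "m a b \<noteq> 1" "m a b \<noteq> 2" "m a b \<noteq> 3"
    using ab by (auto simp: one_enat_def numeral_eq_enat)
  obtain v l where v: "leaf_path v l" "v 0 = a" "v 1 = b" "v ` {..<l} = S"
    by (rule odd_leaf_path_exhausts[OF fin conn nopow ab(1,2) ne leaf])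
  note D = leaf_pathD[OF v(1)]
  have l: "l = card S" using card_image[OF D(2)] v(4) by simp
  have vS: "v i \<in> S" if "i < l" for i using v(4) that by auto
  have veq: "v i = v j \<longleftrightarrow> i = j" if "i < l" "j < l" for i j
    using D(2) that by (auto simp: inj_on_def)
  \<comment> \<open>A larger odd label is at least 6 and \<open>b\<close> has the further neighbour
    \<open>v 2\<close>, which supplies the third letter of the word in
    \<open>power_good_label_6\<close>.\<close>
  have "k = 5"
  proof (rule ccontr)
    assume "k \<noteq> 5"
    then have "6 \<le> k" using ab by simp
    then have "6 \<le> m a b" using ab(3) by (simp add: numeral_eq_enat)
    moreover have "m b (v 2) \<noteq> 2" using D(5)[of 1] v l card by (simp add: numeral_2_eq_2)
    moreover have "v 2 \<in> S" "a \<noteq> b" "a \<noteq> v 2" "b \<noteq> v 2"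
      using vS[of 2] veq[of 0 1] veq[of 0 2] veq[of 1 2] v(2,3) l card by auto
    ultimately have "power_good m [a, b, a, b, v 2]"
      using power_good_label_6 ab(1,2) by blast
    with nopow[of "[a, b, a, b, v 2]"] ab \<open>v 2 \<in> S\<close> show False by simp
  qed
  define p where "p i = v (i - 1)" for i
  have "bij_betw p {1..l} S"
  proof (rule bij_betw_imageI)
    show "inj_on p {1..l}" by (auto simp: inj_on_def p_def veq)
    show "p ` {1..l} = S"
    proof -
      have "{..<l} = (\<lambda>i. i - 1) ` {1..l}" by (force simp: image_iff Bex_def)
      then show ?thesis using v(4) by (simp add: p_def image_image)
    qed
  qed
  moreover have "m (p i) (p j) = (if j = i + 1 then (if i = 1 then 5 else 3) else 2)"
    if ij: "i \<in> {1..l}" "j \<in> {1..l}" "i < j" for i j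
  proof -
    obtain i' where i': "i = Suc i'" using ij(1) by (cases i) auto
    obtain j' where j': "j = Suc j'" using ij(2) by (cases j) auto
    have lt: "i' < j'" "j' < l" using ij i' j' by auto
    show ?thesis
    proof (cases "j' = Suc i'")
      case True
      show ?thesis
      proof (cases "i' = 0")
        case i0: True
        then show ?thesis using True i' j' v ab(3) \<open>k = 5\<close> by (simp add: p_def numeral_eq_enat)
      next
        case False
        then show ?thesis using True i' j' D(6)[of i'] lt by (simp add: p_def)
      qed
    next
      case False
      have "m (v i') (v j') = 2"
      proof (rule ccontr)
        assume "m (v i') (v j') \<noteq> 2"
        then have "v j' = v (Suc i') \<or> 0 < i' \<and> v j' = v (i' - 1)"
          using D(4)[of i' "v j'"] lt vS veq[of j' i'] by auto
        moreover have "Suc i' < l" "i' - 1 < l" using lt by linarith+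
        ultimately show False using veq[of j' "Suc i'"] veq[of j' "i' - 1"] lt False by auto
      qed
      then show ?thesis using False i' j' by (simp add: p_def)
    qed
  qed
  ultimately have "is_H l S m" unfolding is_H_def by blast
  moreover have "l > 2" using l card by simp
  ultimately show ?thesis by blast
qed

end

section \<open>Rank two and conclusion\<close>

lemma alternating_word_two_letters:
  assumes "set r \<subseteq> {s, t}" "s \<noteq> t" "\<And>x y a. r \<noteq> x @ a # a # y" "r = s # r'"
  shows "r = alt_word s t (length r)"
  using assms
proof (induction r' arbitrary: r s t)
  case Nil
  then show ?case by simp
next
  case (Cons c r')
  have "c \<noteq> s" using Cons.prems(3)[of "[]" s r'] Cons.prems(4) by auto
  then have c: "c = t" using Cons.prems(1,4) by auto
  have "c # r' = alt_word t s (length (c # r'))"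
  proof (rule Cons.IH)
    show "set (c # r') \<subseteq> {t, s}" using Cons.prems(1,4) by auto
    show "c # r' \<noteq> x @ a # a # y" for x a y
      using Cons.prems(3)[of "s # x" a y] Cons.prems(4) by auto
  qed (use Cons.prems c in auto)
  then show ?case using Cons.prems(4) c by simp
qed

theorem proposition5p4:
  fixes W :: "('a, 'b) monoid_scheme"
    and S :: "'a set"
    and m :: "'a \<Rightarrow> 'a \<Rightarrow> enat"
    and w :: 'a
  assumes "coxeter_system W S m"
    and "coxeter_irreducible S m"
    and "CFC_finite W S m"
    and "w \<in> CFC W S m"
    and "supp W S w = S"
    and "\<exists>s\<in>S. \<exists>r. reduced_expression W S r w \<and> count_list r s > 1"
  shows "(\<exists>k s t. is_I2 k S m s t \<and>
            w = word_prod W (alt_word s t (coxeter_length W S w)) \<and>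
            even (coxeter_length W S w) \<and>
            0 \<le> coxeter_length W S w \<and> coxeter_length W S w < k) \<or>
         (\<exists>n>2. is_H n S m \<and> has_large_band W S m w)"
proof -
  interpret coxeter W S m by unfold_locales (rule assms(1))
  have conn: "cut_connected S m" using irreducible_cut_connected assms(2) .
  have nopow: "r = []" if "r \<in> lists S" "power_good m r" for r
    using CFC_finite_no_power_good[OF assms(3) that] .
  obtain s0 r where r: "s0 \<in> S" "reduced r" "wp r = w" "count_list r s0 > 1"
    using assms(6) by (auto simp: reduced_expression_iff)
  have rS: "r \<in> lists S" using reduced_in_lists[OF r(2)] .
  have rot: "good_word m (rotate j r)" for j using CFC_good_rotation[OF assms(4) r(2,3)] .
  then have good: "good_word m r" using rot[of 0] by simp
  have len: "coxeter_length W S w = length r"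
    using reduced_expression_iff[of r w] r by (simp add: reduced_expression_def)
  \<comment> \<open>All reduced expressions are commutation equivalent, so one of them already shows
    the support.\<close>
  have "set r' = set r" if "reduced_expression W S r' w" for r'
    using good_word_reduced[OF rS good] that r commutation_equiv_set[of m r r']
    by (auto simp: reduced_expression_iff)
  moreover have "reduced_expression W S r w" using r by (simp add: reduced_expression_iff)
  ultimately have "supp W S w = set r" unfolding supp_def by blast
  then have setr: "set r = S" using assms(5) by simp
  show ?thesis
  proof (cases "3 \<le> card S")
    case True
    from large_band_exists[OF matrix finite_S conn True nopow rS setr rot r(4)]
    obtain a b k j x y where band: "a \<in> S" "b \<in> S" "m a b = enat k" "odd k" "5 \<le> k"
      "\<And>c. c \<in> S \<Longrightarrow> c \<noteq> a \<Longrightarrow> m a c \<noteq> 2 \<Longrightarrow> c = b"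
      "commutation_equiv m (rotate j r) (x @ alt_word b a (k - 1) @ y)"
      "a \<notin> set (x @ y)" "b \<notin> set (x @ y)"
      by metis
    have H: "\<exists>n>2. is_H n S m"
      by (rule odd_leaf_is_H[OF finite_S conn True nopow band(1-5) band(6)])
    have mba: "m b a = enat k" using band m_sym by metis
    have "enat k \<noteq> 2" "enat k \<noteq> 3" "enat k \<noteq> 1"
      using band(5) by (auto simp: numeral_eq_enat one_enat_def)
    then have ab: "a \<noteq> b" "m a b \<noteq> 2" using m_eq_1_iff[OF band(1,2)] band(3) by auto
    have edge: "(u, c) \<in> coxeter_edges S m \<longleftrightarrow> u \<in> S \<and> c \<in> S \<and> u \<noteq> c \<and> m u c \<noteq> 2" for u c
      by (auto simp: coxeter_edges_def m_ge_3_iff)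
    have "(a, u) \<in> coxeter_edges S m \<longleftrightarrow> u = b" for u
      using edge[of a u] band(1,2) band(6)[of u] ab by blast
    then have "{u. (a, u) \<in> coxeter_edges S m} = {b}" by blast
    then have "odd_endpoint S m a" using band(1,3,4) by (auto simp: odd_endpoint_def)
    \<comment> \<open>With at least three generators, connectedness gives \<open>b\<close> a
      neighbour besides \<open>a\<close>, so exactly one of the two is an odd endpoint.\<close>
    moreover have "\<not> odd_endpoint S m b"
    proof
      assume "odd_endpoint S m b"
      then obtain t where t: "{u. (b, u) \<in> coxeter_edges S m} = {t}" by (auto simp: odd_endpoint_def)
      have "(b, a) \<in> coxeter_edges S m" using edge[of b a] band(1,2) ab mba \<open>enat k \<noteq> 2\<close> by simp
      then have "a \<in> {u. (b, u) \<in> coxeter_edges S m}" by simp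
      then have ta: "t = a" unfolding t by simp
      have "card {a, b} \<le> 2" by (simp add: card_insert_if)
      then have "{a, b} \<noteq> S" using True by auto
      then have "{a, b} \<subset> S" using band(1,2) by blast
      from cut_connectedE[OF conn this] obtain u c
        where uc: "u \<in> {a, b}" "c \<in> S" "c \<notin> {a, b}" "m u c \<noteq> 2" by blast
      then have "u \<noteq> a" using band(6)[of c] by auto
      then have "u = b" using uc(1) by blast
      then have "(b, c) \<in> coxeter_edges S m" using edge[of b c] uc(2-4) band(2) by blast
      then have "c \<in> {u. (b, u) \<in> coxeter_edges S m}" by simp
      then show False unfolding t using ta uc(3) by simp
    qed
    ultimately have odd: "odd_endpoint S m b \<noteq> odd_endpoint S m a" by simp
    have red: "reduced (rotate j r)"
    proof -
      have "rotate j r \<in> lists S" using rS by (simp add: in_lists_conv_set)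
      then show ?thesis using good_word_reduced rot by blast
    qed
    have "reduced_expression W S (x @ alt_word b a (k - 1) @ y) (wp (x @ alt_word b a (k - 1) @ y))"
      using reduced_commutation_equiv[OF band(7) red] by (simp add: reduced_expression_iff)
    moreover have "reduced_expression W S r w" using r by (simp add: reduced_expression_iff)
    ultimately have "has_band W S m w b a"
      unfolding has_band_def assms(5) using band(1,2,7-9) ab odd mba by blast
    moreover have "m b a \<noteq> 3" using mba \<open>enat k \<noteq> 3\<close> by simp
    ultimately have "has_large_band W S m w" unfolding has_large_band_def by blast
    with H show ?thesis by blast
  next
    case False
    obtain s r' where sr: "r = s # r'" using r(4) by (cases r) auto
    have nosq: "r \<noteq> x @ a # a # y" for x a y using good not_good_word_square by metis
    have len2: "length r \<ge> 2" using r(4) count_le_length[of r s0] by linarith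
    have "card S \<noteq> 1"
    proof
      assume "card S = 1"
      then obtain c where "S = {c}" by (auto simp: card_1_singleton_iff)
      moreover obtain d r'' where "r' = d # r''" using len2 sr by (cases r') auto
      ultimately have "r = [] @ c # c # r''" using setr sr by auto
      then show False using nosq by blast
    qed
    moreover have "card S \<noteq> 0" using finite_S r(1) by auto
    ultimately have "card S = 2" using False by linarith
    then obtain t where St: "S = {s, t}" "s \<noteq> t"
      using sr setr by (metis card_2_iff doubleton_eq_iff insertE list.set_intros(1) singletonD)
    have alt: "r = alt_word s t (length r)"
      by (rule alternating_word_two_letters) (use setr St nosq sr in auto)
    have st: "s \<in> S" "t \<in> S" using St by auto
    have mst: "m s t \<noteq> 2"
    proof -
      have "{s} \<subset> S" "{s} \<noteq> {}" using St by blast+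
      from cut_connectedE[OF conn this] obtain u c
        where uc: "u \<in> {s}" "c \<in> S" "c \<notin> {s}" "m u c \<noteq> 2" .
      then have "u = s" "c = t" using St by blast+
      with uc(4) show ?thesis by simp
    qed
    have "m s t \<noteq> \<infinity>"
    proof
      assume "m s t = \<infinity>"
      then have "power_good m [s, t]" using power_good_infinite_label st by blast
      with nopow[of "[s, t]"] st show False by simp
    qed
    then obtain k where k: "m s t = enat k" by auto
    have k3: "3 \<le> k" using m_ge_3_iff[OF st] St(2) mst k by (simp add: numeral_eq_enat)
    \<comment> \<open>An alternating word of odd length begins and ends with the same letter, and
      rotating the last letter to the front makes a square.\<close>
    have even: "even (length r)"
    proof (rule ccontr)
      assume odd: "odd (length r)"
      then obtain n where n: "length r = Suc n" "even n" by (cases "length r") auto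
      have snoc: "r = alt_word s t n @ [s]" using alt n alt_word_snoc[of s t n] by simp
      have "n \<noteq> 0" using len2 n by simp
      then obtain n' where "n = Suc n'" by (cases n) auto
      then have "rotate n r = s # s # alt_word t s n'"
        unfolding snoc using rotate_append[of "alt_word s t n" "[s]"] by simp
      then show False using rot[of n] not_good_word_square[of m "[]" s "alt_word t s n'"] by simp
    qed
    have "length r < k"
    proof (rule ccontr)
      assume "\<not> length r < k"
      then have "r = alt_word s t k @ drop k r"
        using alt alt_word_add[of s t k "length r - k"] by (metis append_eq_conv_conj
            le_add_diff_inverse length_alt_word not_less)
      then have "\<not> good_word m r"
        using not_good_word_braid[of m s t k "[]" "drop k r", OF k k3] by simp
      with good show False by simp
    qed
    moreover have "is_I2 k S m s t" using St k by (simp add: is_I2_def)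
    moreover have "w = wp (alt_word s t (length r))" using alt r(3) by simp
    ultimately show ?thesis using even unfolding len by blast
  qed
qed

end
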